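(* Let $L$ be a hexagonal lattice around an odd face, with odd face $O$. Then there exist a proper face coloring $c$ of $L$ with the four colors $\{1,2,3,4\}$ and a partition of the set of faces of $L$ into three zones $Z_1, Z_2, Z_3$ such that each zone is colored with a different 3-color subset of the four colors, i.e. there are three pairwise distinct subsets $S_1,S_2,S_3\subset\{1,2,3,4\}$, each of size $3$, with $c(f)\in S_i$ for every face $f\in Z_i$, $i=1,2,3$.
   Context: A hexagonal lattice around an odd face is an infinite, locally finite cell decomposition of the plane in which every vertex has degree $3$, exactly one face $O$ is non-hexagonal, the number of sides of $O$ is odd (and at least $3$), and all other faces are hexagons; geometrically it is the hexagonal lattice on a cone whose apex corresponds to $O$. Two faces are adjacent if they share an edge. A proper face coloring assigns different colors to adjacent faces. A zone is a nonempty set of faces that is connected with respect to face adjacency. (A coloring of this kind is called a multiple 3-coloring.) *)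

theory Defs
  imports "HOL-Analysis.Analysis" "HOL-Library.Disjoint_Sets"
begin

text \<open>
  The plane is the type of complex numbers. A cell decomposition is given by its vertices
  (points), its open edges and its open faces (subsets of the plane).
\<close>

definition is_edge :: "complex set \<Rightarrow> complex set \<Rightarrow> bool" where
  "is_edge V e \<longleftrightarrow>
     (\<exists>g. arc g \<and> pathstart g \<in> V \<and> pathfinish g \<in> V \<and>
          e = path_image g - {pathstart g, pathfinish g})"

text \<open>
  An open cell \<open>f\<close> is a \<open>k\<close>-gon if its closure is a closed disc under a homeomorphism \<open>h\<close> that
  carries the \<open>k\<close>-th roots of unity to vertices and the \<open>k\<close> open arcs of the unit circle between
  consecutive roots to edges.
\<close>

definition is_polygon :: "complex set \<Rightarrow> complex set set \<Rightarrow> nat \<Rightarrow> complex set \<Rightarrow> bool" where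
  "is_polygon V E k f \<longleftrightarrow> 0 < k \<and>
     (\<exists>h h'. homeomorphism (cball 0 1) (closure f) h h' \<and> h ` ball 0 1 = f \<and>
        (\<forall>i<k. h (cis (2 * pi * real i / real k)) \<in> V \<and>
               h ` cis ` {2 * pi * real i / real k <..< 2 * pi * real (Suc i) / real k} \<in> E))"

definition cells :: "complex set \<Rightarrow> complex set set \<Rightarrow> complex set set \<Rightarrow> complex set set" where
  "cells V E F = (\<lambda>v. {v}) ` V \<union> E \<union> F"

definition cell_decomposition ::
    "complex set \<Rightarrow> complex set set \<Rightarrow> complex set set \<Rightarrow> bool" where
  "cell_decomposition V E F \<longleftrightarrow>
     partition_on UNIV (cells V E F) \<and>
     (\<forall>e\<in>E. is_edge V e) \<and>
     (\<forall>f\<in>F. \<exists>k. is_polygon V E k f)"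

definition locally_finite_cells :: "complex set set \<Rightarrow> bool" where
  "locally_finite_cells C \<longleftrightarrow>
     (\<forall>z. \<exists>U. open U \<and> z \<in> U \<and> finite {c \<in> C. c \<inter> U \<noteq> {}})"

text \<open>Edges are arcs, so there are no loops and the degree is the number of incident edges.\<close>

definition vertex_degree :: "complex set set \<Rightarrow> complex \<Rightarrow> nat" where
  "vertex_degree E v = card {e \<in> E. v \<in> closure e}"

definition hexagonal_lattice_around_odd_face ::
    "complex set \<Rightarrow> complex set set \<Rightarrow> complex set set \<Rightarrow> complex set \<Rightarrow> bool" where
  "hexagonal_lattice_around_odd_face V E F f\<^sub>0 \<longleftrightarrow>
     cell_decomposition V E F \<and>
     infinite (cells V E F) \<and>
     locally_finite_cells (cells V E F) \<and>
     (\<forall>v\<in>V. vertex_degree E v = 3) \<and>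
     {f \<in> F. \<not> is_polygon V E 6 f} = {f\<^sub>0} \<and>
     (\<exists>n. odd n \<and> 3 \<le> n \<and> is_polygon V E n f\<^sub>0)"

definition adjacent :: "complex set set \<Rightarrow> complex set \<Rightarrow> complex set \<Rightarrow> bool" where
  "adjacent E f g \<longleftrightarrow> f \<noteq> g \<and> (\<exists>e\<in>E. e \<subseteq> frontier f \<and> e \<subseteq> frontier g)"

definition proper_face_coloring ::
    "complex set set \<Rightarrow> complex set set \<Rightarrow> nat set \<Rightarrow> (complex set \<Rightarrow> nat) \<Rightarrow> bool" where
  "proper_face_coloring E F S c \<longleftrightarrow>
     c ` F \<subseteq> S \<and> (\<forall>f\<in>F. \<forall>g\<in>F. adjacent E f g \<longrightarrow> c f \<noteq> c g)"

definition zone :: "complex set set \<Rightarrow> complex set set \<Rightarrow> complex set set \<Rightarrow> bool" where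
  "zone E F Z \<longleftrightarrow> Z \<noteq> {} \<and> Z \<subseteq> F \<and>
     (\<forall>f\<in>Z. \<forall>g\<in>Z. (\<lambda>a b. a \<in> Z \<and> b \<in> Z \<and> adjacent E a b)\<^sup>*\<^sup>* f g)"

end

theory Submission
  imports Defs
begin

text \<open>
  A hexagonal lattice around an \<open>n\<close>-gon has the shape of a cone: it consists of \<open>n\<close> wedges of the
  regular hexagonal lattice, glued in cyclic order around the apex. Give a face of a wedge the
  coordinates \<open>a \<ge> 1\<close> and \<open>0 \<le> b < a\<close>: it is reached from the apex by \<open>a\<close> steps along one axis of
  the wedge, followed by \<open>b\<close> steps in the direction that makes an angle of 120 degrees with it. The
  classes of \<open>a + b\<close> modulo 3 colour a wedge properly, the apex belongs to class 0, and this
  colouring continues into the next wedge with the classes 1 and 2 exchanged. For odd \<open>n\<close> a turn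
  around the apex therefore exchanges two colours, and three colours do not suffice. The fourth
  colour repairs this: it replaces one of the two exchanged colours in the first wedge and the other
  one in the last wedge, so that neighbours across the seam still get different colours
  (\<open>colour_next_sector\<close>). The first wedge, the last wedge, and the remaining wedges with the odd
  face are the three zones. Each is connected because lowering \<open>b\<close> and then \<open>a\<close> leads to the first
  face of the wedge, and from there to the apex.

  It remains to see that a lattice given by purely local conditions is such a cone. Its
  combinatorics is carried by the flags, the incident triples of a vertex, an edge and a face, with
  the involutions that change one of the three components. They are well defined because an edge
  has two ends, a polygon has two edges at each of its vertices, and an edge lies on exactly two
  faces (\<open>edge_two_faces\<close>); the last fact is where invariance of domain enters. That vertices have
  degree 3 gives the braid relation \<open>s_braid\<close>.

  Away from the odd face these are the relations of the regular hexagonal lattice, so the lattice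
  develops onto the regular one along paths that avoid the odd face. The result depends on how often
  the path winds around the odd face, but a full turn acts as a rotation about the image of the odd
  face. Hence there is a well defined development onto the flags of the regular lattice modulo
  the six rotations about a face (\<open>development\<close>). To prove this, the developments near a point
  are regarded as a locally constant family over the complement of the odd face, and the family is
  pulled back to the plane along an exponential map. Over the plane such a family has a section
  through every prescribed value (\<open>flat_section\<close>). A section that is central far to the left, where
  the plane winds around the odd face at its boundary, is periodic by uniqueness and hence descends.

  The development yields the cone structure. A walk of \<open>a\<close> and then \<open>b\<close> steps from the odd face
  cannot meet the odd face again, since its development has left the centre. So all faces on the way
  are hexagons and the commutation of the steps follows from the relations between the involutions.
  Walks with different coordinates end in different faces, because their developments differ
  (\<open>Q_inj\<close>), and every face is reached, because the faces reached are closed under adjacency and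
  the lattice is connected (\<open>Q_cover\<close>).
\<close>

section \<open>Global sections of locally constant families over the plane\<close>

text \<open>
  A locally constant family is presented by its fibres \<open>X w\<close>, a transport relation \<open>A w w'\<close> between
  the fibres over \<open>w\<close> and a point \<open>w'\<close> of the neighbourhood \<open>N w\<close>, and the requirement that transport
  is bijective and coherent. A relation is used instead of a function because the families below are
  made of functions with different domains that are to agree where both are defined.
\<close>

locale locally_constant =
  fixes X :: "complex \<Rightarrow> 'x set" and A :: "complex \<Rightarrow> complex \<Rightarrow> 'x \<Rightarrow> 'x \<Rightarrow> bool" and N :: "complex \<Rightarrow> complex set"
  assumes N: "open (N w)" "w \<in> N w"
    and refl: "x \<in> X w \<Longrightarrow> A w w x x"
    and forward: "\<lbrakk>w' \<in> N w; x \<in> X w\<rbrakk> \<Longrightarrow> \<exists>!x'. x' \<in> X w' \<and> A w w' x x'"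
    and backward: "\<lbrakk>w' \<in> N w; x' \<in> X w'\<rbrakk> \<Longrightarrow> \<exists>!x. x \<in> X w \<and> A w w' x x'"
    and coherent: "\<lbrakk>w' \<in> N w; w'' \<in> N w; w'' \<in> N w'; x \<in> X w; x' \<in> X w'; x'' \<in> X w'';
        A w w' x x'; A w w'' x x''\<rbrakk> \<Longrightarrow> A w' w'' x' x''"
begin

text \<open>
  Flat functions are the continuous sections: nearby values correspond under transport.
\<close>

definition flat :: "complex set \<Rightarrow> (complex \<Rightarrow> 'x) \<Rightarrow> bool" where
  "flat U s \<longleftrightarrow> (\<forall>w\<in>U. s w \<in> X w \<and> (\<forall>\<^sub>F w' in nhds w. w' \<in> U \<longrightarrow> A w w' (s w) (s w')))"

lemma flatD: "\<lbrakk>flat U s; w \<in> U\<rbrakk> \<Longrightarrow> s w \<in> X w"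
    "\<lbrakk>flat U s; w \<in> U\<rbrakk> \<Longrightarrow> \<forall>\<^sub>F w' in nhds w. w' \<in> U \<longrightarrow> A w w' (s w) (s w')"
  unfolding flat_def by blast+

lemma flat_subset: assumes "flat U s" "U' \<subseteq> U" shows "flat U' s"
  unfolding flat_def
proof (intro ballI conjI)
  fix w assume "w \<in> U'"
  then have w: "w \<in> U" using assms by blast
  show "s w \<in> X w" using flatD[OF assms(1) w] by blast
  from flatD(2)[OF assms(1) w] show "\<forall>\<^sub>F w' in nhds w. w' \<in> U' \<longrightarrow> A w w' (s w) (s w')"
    by eventually_elim (use assms in blast)
qed

lemma flat_cong: assumes "flat U s" "\<And>w. w \<in> U \<Longrightarrow> s w = t w" shows "flat U t"
  unfolding flat_def
proof (intro ballI conjI)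
  fix w assume w: "w \<in> U"
  show "t w \<in> X w" using flatD(1)[OF assms(1) w] assms(2)[OF w] by simp
  from flatD(2)[OF assms(1) w] show "\<forall>\<^sub>F w' in nhds w. w' \<in> U \<longrightarrow> A w w' (t w) (t w')"
    by eventually_elim (use assms(2) w in auto)
qed

text \<open>
  Since transport is injective in both directions, the set where two sections agree is open and so is
  its complement.
\<close>

lemma flat_unique:
  assumes "connected U" "flat U s" "flat U t" "y \<in> U" "s y = t y" "z \<in> U"
  shows "s z = t z"
proof (rule connected_induction_simple[OF assms(1), where P = "\<lambda>z. s z = t z"])
  fix w assume w: "w \<in> U"
  have "\<forall>\<^sub>F w' in nhds w. w' \<in> U \<longrightarrow> A w w' (s w) (s w')" "\<forall>\<^sub>F w' in nhds w. w' \<in> U \<longrightarrow> A w w' (t w) (t w')"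
    using assms w unfolding flat_def by auto
  moreover have "\<forall>\<^sub>F w' in nhds w. w' \<in> N w" using N eventually_nhds by blast
  ultimately have "\<forall>\<^sub>F w' in nhds w. w' \<in> N w \<and> (w' \<in> U \<longrightarrow> A w w' (s w) (s w') \<and> A w w' (t w) (t w'))"
    by eventually_elim auto
  then obtain T where T: "open T" "w \<in> T"
      "\<And>w'. w' \<in> T \<Longrightarrow> w' \<in> N w \<and> (w' \<in> U \<longrightarrow> A w w' (s w) (s w') \<and> A w w' (t w) (t w'))"
    unfolding eventually_nhds by auto
  have "s w' = t w' \<longleftrightarrow> s w = t w" if "w' \<in> U \<inter> T" for w'
  proof -
    have X: "s w \<in> X w" "t w \<in> X w" "s w' \<in> X w'" "t w' \<in> X w'" using assms w that unfolding flat_def by auto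
    show ?thesis using forward[of w' w] backward[of w' w] T(3)[of w'] X that by (metis IntD1 IntD2)
  qed
  moreover have "openin (top_of_set U) (U \<inter> T)" using T(1) by (rule openin_open_Int)
  moreover have "w \<in> U \<inter> T" using w T(2) by blast
  ultimately show "\<exists>T. openin (top_of_set U) T \<and> w \<in> T \<and> (\<forall>x\<in>T. \<forall>y\<in>T. s x = t x \<longrightarrow> s y = t y)"
    by metis
qed (use assms in auto)

definition good :: "complex set \<Rightarrow> bool" where
  "good K \<longleftrightarrow> (\<forall>y\<in>K. \<forall>x\<in>X y. \<exists>s. flat K s \<and> s y = x)"

lemma good_small:
  assumes "K \<subseteq> N w" shows "good K"
  unfolding good_def
proof (intro ballI)
  fix y x assume y: "y \<in> K" and x: "x \<in> X y"
  obtain x0 where x0: "x0 \<in> X w" "A w y x0 x" using backward[of y w x] y x assms by blast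
  define s where "s w' = (THE x'. x' \<in> X w' \<and> A w w' x0 x')" for w'
  have s: "s w' \<in> X w' \<and> A w w' x0 (s w')" if "w' \<in> K" for w'
    unfolding s_def by (rule theI') (use forward[of w' w x0] x0 that assms in blast)
  have "s y = x" using s[OF y] x0 x forward[of y w x0] y assms by blast
  moreover have "flat K s"
    unfolding flat_def
  proof (intro ballI conjI)
    fix v assume v: "v \<in> K"
    show "s v \<in> X v" using s v by blast
    have "\<forall>\<^sub>F v' in nhds v. v' \<in> N v" using N eventually_nhds by blast
    then show "\<forall>\<^sub>F v' in nhds v. v' \<in> K \<longrightarrow> A v v' (s v) (s v')"
    proof eventually_elim
      case (elim v')
      then show ?case using coherent[of v w v' x0 "s v" "s v'"] s v x0 assms by auto
    qed
  qed
  ultimately show "\<exists>s. flat K s \<and> s y = x" by blast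
qed

text \<open>
  Two sections that agree at one point of the connected intersection agree on all of it and can be
  glued; closedness of both sets makes the glued function flat at their common points.
\<close>

lemma good_Un:
  assumes "good K" "good L" "closed K" "closed L" "connected (K \<inter> L)" "K \<inter> L \<noteq> {}"
  shows "good (K \<union> L)"
proof -
  have *: "\<exists>s. flat (K \<union> L) s \<and> s y = x"
    if KL: "good K" "good L" "closed K" "closed L" "connected (K \<inter> L)" "K \<inter> L \<noteq> {}"
      and yx: "y \<in> K" "x \<in> X y" for K L y x
  proof -
    obtain s where s: "flat K s" "s y = x" using KL(1) yx unfolding good_def by blast
    obtain z where z: "z \<in> K" "z \<in> L" using KL(6) by blast
    have "s z \<in> X z" using s z unfolding flat_def by blast
    then obtain t where t: "flat L t" "t z = s z" using KL(2) z unfolding good_def by blast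
    define r where "r w = (if w \<in> K then s w else t w)" for w
    have "s w = t w" if "w \<in> K \<inter> L" for w
      using flat_unique[OF KL(5), of s t z w] flat_subset[OF s(1), of "K \<inter> L"] flat_subset[OF t(1), of "K \<inter> L"] z t that by auto
    then have r: "flat K r" "flat L r" using flat_cong[OF s(1), of r] flat_cong[OF t(1), of r] by (auto simp: r_def)
    have "flat (K \<union> L) r"
      unfolding flat_def
    proof (intro ballI conjI)
      fix w assume w: "w \<in> K \<union> L"
      then show "r w \<in> X w" using r unfolding flat_def by blast
      have "\<forall>\<^sub>F w' in nhds w. w' \<in> C \<longrightarrow> A w w' (r w) (r w')" if "closed C" "flat C r" for C
      proof (cases "w \<in> C")
        case True then show ?thesis using that unfolding flat_def by blast
      next
        case False
        then have "\<forall>\<^sub>F w' in nhds w. w' \<in> - C" using that(1) by (intro eventually_nhds_in_open) auto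
        then show ?thesis by eventually_elim auto
      qed
      from this[OF KL(3) r(1)] this[OF KL(4) r(2)]
      show "\<forall>\<^sub>F w' in nhds w. w' \<in> K \<union> L \<longrightarrow> A w w' (r w) (r w')" by eventually_elim auto
    qed
    moreover have "r y = x" using s yx by (simp add: r_def)
    ultimately show ?thesis by blast
  qed
  show ?thesis unfolding good_def
    using *[OF assms] *[of L K] assms by (metis Int_commute Un_commute UnE)
qed

abbreviation rect :: "real \<Rightarrow> real \<Rightarrow> real \<Rightarrow> real \<Rightarrow> complex set" where
  "rect a b c d \<equiv> cbox (Complex a c) (Complex b d)"

lemma in_rect: "z \<in> rect a b c d \<longleftrightarrow> a \<le> Re z \<and> Re z \<le> b \<and> c \<le> Im z \<and> Im z \<le> d"
  by (auto simp: in_cbox_complex_iff)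

lemma rect_split_Re: "\<lbrakk>a \<le> b; b \<le> c\<rbrakk> \<Longrightarrow> rect a b p q \<union> rect b c p q = rect a c p q \<and> rect a b p q \<inter> rect b c p q = rect b b p q"
  by (auto simp: in_rect set_eq_iff)

lemma rect_split_Im: "\<lbrakk>p \<le> q; q \<le> r\<rbrakk> \<Longrightarrow> rect a b p q \<union> rect a b q r = rect a b p r \<and> rect a b p q \<inter> rect a b q r = rect a b q q"
  by (auto simp: in_rect set_eq_iff)

lemma rect_ne: "\<lbrakk>a \<le> b; p \<le> q\<rbrakk> \<Longrightarrow> rect a b p q \<noteq> {}"
  using in_rect[of "Complex a p" a p b q] by auto

text \<open>
  Compactness in the first coordinate: a horizontal segment has a good neighbourhood of uniform
  height.
\<close>

lemma good_strip:
  assumes "a \<le> b"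
  shows "\<exists>d>0. \<forall>p q. p \<le> y \<and> y \<le> q \<and> q - p < d \<longrightarrow> good (rect a b p q)"
  using assms
proof (induction a b rule: Bolzano)
  case (trans a b c)
  then obtain d e where d: "d > 0" "\<And>p q. p \<le> y \<Longrightarrow> y \<le> q \<Longrightarrow> q - p < d \<Longrightarrow> good (rect a b p q)"
    and e: "e > 0" "\<And>p q. p \<le> y \<Longrightarrow> y \<le> q \<Longrightarrow> q - p < e \<Longrightarrow> good (rect b c p q)" by metis
  have "good (rect a c p q)" if "p \<le> y" "y \<le> q" "q - p < min d e" for p q
    using good_Un[OF d(2) e(2), of p q p q] rect_split_Re[OF trans(3,4), of p q] rect_ne[of b b p q] that
    by (simp add: convex_connected closed_cbox)
  then show ?case using d e by (intro exI[of _ "min d e"]) auto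
next
  case (local x)
  obtain r where r: "r > 0" "ball (Complex x y) r \<subseteq> N (Complex x y)" using N open_contains_ball by blast
  have "good (rect a b p q)" if "a \<le> x" "x \<le> b" "b - a < r/2" "p \<le> y" "y \<le> q" "q - p < r/2" for a b p q
  proof (rule good_small)
    show "rect a b p q \<subseteq> N (Complex x y)"
    proof
      fix z assume z: "z \<in> rect a b p q"
      have "cmod (z - Complex x y) \<le> \<bar>Re (z - Complex x y)\<bar> + \<bar>Im (z - Complex x y)\<bar>" by (rule cmod_le)
      also have "\<dots> < r" using z that by (auto simp: in_rect)
      finally show "z \<in> N (Complex x y)" using r by (auto simp: dist_norm norm_minus_commute)
    qed
  qed
  then have "\<exists>d>0. \<forall>p q. p \<le> y \<and> y \<le> q \<and> q - p < d \<longrightarrow> good (rect a b p q)"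
    if "a \<le> x" "x \<le> b" "b - a < r/2" for a b
    using that r(1) by (intro exI[of _ "r/2"]) auto
  then show ?case using half_gt_zero[OF r(1)] by blast
qed

lemma good_rect:
  assumes "a \<le> b" "p \<le> q" shows "good (rect a b p q)"
  using assms(2)
proof (induction p q rule: Bolzano)
  case (trans p q r)
  show ?case
    using good_Un[OF trans(1,2)] rect_split_Im[OF trans(3,4), of a b] rect_ne[OF assms(1), of q q]
    by (simp add: convex_connected closed_cbox)
next
  case (local y)
  show ?case using good_strip[OF assms(1), of y] by blast
qed

text \<open>
  The plane is simply connected, so locally constant families over it are trivial. Here this is
  obtained by hand: small squares are good, Bolzano bisection in both coordinates makes all
  rectangles good, and by uniqueness the sections over growing squares fit together.
\<close>

theorem flat_section:
  assumes "x \<in> X w0" obtains s where "flat UNIV s" "s w0 = x"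
proof -
  define B where "B k = rect (Re w0 - real k) (Re w0 + real k) (Im w0 - real k) (Im w0 + real k)" for k
  have w0: "w0 \<in> B k" for k by (simp add: B_def in_rect)
  have "\<exists>s. flat (B k) s \<and> s w0 = x" for k
    using good_rect[of "Re w0 - real k" "Re w0 + real k" "Im w0 - real k" "Im w0 + real k"] w0[of k] assms
    unfolding good_def B_def by auto
  then obtain S where S: "\<And>k. flat (B k) (S k)" "\<And>k. S k w0 = x" by metis
  have mono: "B j \<subseteq> B k" if "j \<le> k" for j k
    using that by (auto simp: B_def in_rect)
  have eq: "S j w = S k w" if "j \<le> k" "w \<in> B j" for j k w
  proof (rule flat_unique[of "B j" "S j" "S k" w0])
    show "connected (B j)" by (simp add: B_def convex_connected)
    show "flat (B j) (S k)" using S(1) mono[OF that(1)] by (rule flat_subset)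
  qed (use S w0 that in auto)
  \<comment> \<open>The index of a square that contains \<open>w\<close>.\<close>
  define m where "m w = nat \<lceil>cmod (w - w0)\<rceil>" for w
  have m: "w \<in> B k" if "m w \<le> k" for w k
  proof -
    have "cmod (w - w0) \<le> real k" using that by (simp add: m_def nat_le_iff ceiling_le_iff)
    then have "\<bar>Re (w - w0)\<bar> \<le> real k" "\<bar>Im (w - w0)\<bar> \<le> real k"
      using abs_Re_le_cmod abs_Im_le_cmod order_trans by blast+
    then show ?thesis by (auto simp: B_def in_rect)
  qed
  define s where "s w = S (m w) w" for w
  have s: "s w = S k w" if "m w \<le> k" for w k unfolding s_def by (rule eq[OF that m]) simp
  have "flat UNIV s"
    unfolding flat_def
  proof (intro ballI conjI)
    fix w
    show "s w \<in> X w" using S(1)[of "m w"] m[of w "m w"] unfolding s_def flat_def by auto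
    let ?k = "Suc (m w)"
    have "\<forall>\<^sub>F w' in nhds w. w' \<in> B ?k \<longrightarrow> A w w' (S ?k w) (S ?k w')"
      using S(1)[of ?k] m[of w ?k] unfolding flat_def by auto
    moreover have "\<forall>\<^sub>F w' in nhds w. w' \<in> ball w 1" by (intro eventually_nhds_in_open) auto
    ultimately show "\<forall>\<^sub>F w' in nhds w. w' \<in> UNIV \<longrightarrow> A w w' (s w) (s w')"
    proof eventually_elim
      case (elim w')
      have "cmod (w' - w0) \<le> cmod (w' - w) + cmod (w - w0)" using norm_triangle_ineq[of "w' - w" "w - w0"] by simp
      also have "\<dots> \<le> 1 + cmod (w - w0)" using elim by (simp add: dist_norm norm_minus_commute)
      finally have "m w' \<le> ?k" unfolding m_def by linarith
      then show ?case using elim s[of w ?k] s[of w' ?k] m[of w' ?k] by simp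
    qed
  qed
  moreover have "s w0 = x" using S(2) by (simp add: s_def)
  ultimately show thesis by (rule that)
qed

end

section \<open>Functions on dihedral cycles\<close>

text \<open>
  The orbit of a point under two involutions \<open>a\<close> and \<open>b\<close>, applied alternately.
\<close>

primrec walk :: "('a \<Rightarrow> 'a) \<Rightarrow> ('a \<Rightarrow> 'a) \<Rightarrow> 'a \<Rightarrow> nat \<Rightarrow> 'a" where
  "walk a b x 0 = x"
| "walk a b x (Suc i) = (if even i then a else b) (walk a b x i)"

lemma walk_numeral:
  "walk a b x 1 = a x" "walk a b x 2 = b (a x)" "walk a b x 3 = a (b (a x))"
  "walk a b x 4 = b (a (b (a x)))" "walk a b x 5 = a (b (a (b (a x))))" "walk a b x 6 = b (a (b (a (b (a x)))))"
proof -
  note step = walk.simps(2)[of a b x]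
  show 1: "walk a b x 1 = a x" using step[of 0] by simp
  show 2: "walk a b x 2 = b (a x)" using step[of 1] 1 by (simp add: numeral_2_eq_2)
  show 3: "walk a b x 3 = a (b (a x))" using step[of 2] 2 by simp
  show 4: "walk a b x 4 = b (a (b (a x)))" using step[of 3] 3 by simp
  show 5: "walk a b x 5 = a (b (a (b (a x))))" using step[of 4] 4 by simp
  show "walk a b x 6 = b (a (b (a (b (a x)))))" using step[of 5] 5 by simp
qed

text \<open>
  On a cycle of length \<open>2 * m\<close> traced out by two involutions, an equivariant function is determined
  by one value. It exists because the corresponding walk in the target also closes up after
  \<open>2 * m\<close> steps.
\<close>

lemma dihedral_extension:
  fixes \<alpha> \<beta> :: "'t \<Rightarrow> 't"
  assumes inv: "\<And>y. a (a y) = y" "\<And>y. b (b y) = y" "\<And>s. \<alpha> (\<alpha> s) = s" "\<And>s. \<beta> (\<beta> s) = s"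
    and S: "S = walk a b x ` {..<2 * m}" "inj_on (walk a b x) {..<2 * m}" and m: "0 < m"
    and per: "walk a b x (2 * m) = x" "walk \<alpha> \<beta> \<tau> (2 * m) = \<tau>"
  shows "\<exists>!g. (\<forall>y\<in>S. g (a y) = \<alpha> (g y) \<and> g (b y) = \<beta> (g y)) \<and> (\<forall>y. y \<notin> S \<longrightarrow> g y = undefined) \<and> g x = \<tau>"
proof (rule ex_ex1I)
  let ?u = "walk a b x" and ?w = "walk \<alpha> \<beta> \<tau>"
  define g where "g y = (if y \<in> S then ?w (inv_into {..<2 * m} ?u y) else undefined)" for y
  have g: "g (?u i) = ?w i" if "i < 2 * m" for i
    using that S by (simp add: g_def inv_into_f_f)
  have g': "g (?u i) = ?w i" if "i \<le> 2 * m" for i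
    using that g[of i] g[of 0] per m by (cases "i = 2 * m") auto
  have up: "g (?u (Suc i)) = (if even i then \<alpha> else \<beta>) (g (?u i))" if "i < 2 * m" for i
    using g'[of i] g'[of "Suc i"] that by simp
  have "g (a (?u i)) = \<alpha> (g (?u i)) \<and> g (b (?u i)) = \<beta> (g (?u i))" if i: "i < 2 * m" for i
  proof -
    have pos: "g (a (?u j)) = \<alpha> (g (?u j)) \<and> g (b (?u j)) = \<beta> (g (?u j))" if j0: "0 < j" and j2: "j \<le> 2 * m" for j
    proof (cases "j = 2 * m")
      case True
      have "g (a (?u 0)) = \<alpha> (g (?u 0))" using up[of 0] m by simp
      moreover have "g (b (?u j)) = \<beta> (g (?u j))"
      proof -
        obtain l where l: "j = Suc l" using j0 by (cases j) auto
        then have "odd l" "l < 2 * m" using True by (presburger, simp)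
        then have "?u j = b (?u l)" "g (?u j) = \<beta> (g (?u l))" using l up[of l] by simp_all
        then show ?thesis by (simp add: inv)
      qed
      ultimately show ?thesis using True per(1) by simp
    next
      case False
      then have j: "j < 2 * m" using j2 by simp
      obtain l where l: "j = Suc l" using j0 by (cases j) auto
      have "g (?u (Suc j)) = (if even j then \<alpha> else \<beta>) (g (?u j))" using up[OF j] .
      moreover have "?u j = (if even l then a else b) (?u l)" "g (?u j) = (if even l then \<alpha> else \<beta>) (g (?u l))"
        using l up[of l] j by simp_all
      ultimately show ?thesis using l by (cases "even l") (simp_all add: inv)
    qed
    show ?thesis
    proof (cases "i = 0")
      case True then show ?thesis using pos[of "2 * m"] m per(1) by simp
    next
      case False then show ?thesis using pos[of i] i by simp
    qed
  qed
  then have "\<forall>y\<in>S. g (a y) = \<alpha> (g y) \<and> g (b y) = \<beta> (g y)" unfolding S(1) by blast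
  moreover have "g x = \<tau>" using g[of 0] m by simp
  ultimately show "\<exists>g. (\<forall>y\<in>S. g (a y) = \<alpha> (g y) \<and> g (b y) = \<beta> (g y)) \<and> (\<forall>y. y \<notin> S \<longrightarrow> g y = undefined) \<and> g x = \<tau>"
    by (intro exI[of _ g]) (simp add: g_def)
next
  fix g g'
  assume g: "(\<forall>y\<in>S. g (a y) = \<alpha> (g y) \<and> g (b y) = \<beta> (g y)) \<and> (\<forall>y. y \<notin> S \<longrightarrow> g y = undefined) \<and> g x = \<tau>"
    and g': "(\<forall>y\<in>S. g' (a y) = \<alpha> (g' y) \<and> g' (b y) = \<beta> (g' y)) \<and> (\<forall>y. y \<notin> S \<longrightarrow> g' y = undefined) \<and> g' x = \<tau>"
  have eq: "g (walk a b x i) = g' (walk a b x i)" if "i < 2 * m" for i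
    using that
  proof (induction i)
    case (Suc i)
    then have "walk a b x i \<in> S" unfolding S(1) by simp
    then show ?case using Suc g g' by simp
  qed (use g g' in simp)
  show "g = g'"
  proof
    fix y show "g y = g' y"
    proof (cases "y \<in> S")
      case True then show ?thesis using eq unfolding S(1) by auto
    qed (use g g' in simp)
  qed
qed

section \<open>Cells of the lattice\<close>

lemma cis_eq_iff: "cis s = cis t \<longleftrightarrow> (\<exists>m::int. s = t + 2 * pi * of_int m)"
proof -
  have "cis s = cis t \<longleftrightarrow> (\<exists>m::int. \<i> * of_real s = \<i> * of_real t + (of_int (2 * m) * pi) * \<i>)"
    unfolding cis_conv_exp exp_eq ..
  also have "\<dots> \<longleftrightarrow> (\<exists>m::int. s = t + 2 * pi * of_int m)"
    by (simp add: complex_eq_iff mult_ac)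
  finally show ?thesis .
qed

text \<open>
  The inverse of the arc would map the open set injectively onto an open set of complex numbers
  that are all real.
\<close>

lemma no_open_in_arc:
  fixes g :: "real \<Rightarrow> complex"
  assumes "arc g" "open N" "N \<subseteq> path_image g" shows "N = {}"
proof (rule ccontr)
  assume "N \<noteq> {}"
  then obtain z where z: "z \<in> N" by blast
  obtain h where h: "homeomorphism {0..1} (path_image g) g h" using homeomorphism_arc[OF assms(1)] by blast
  let ?k = "\<lambda>z. complex_of_real (h z)"
  have "continuous_on N h" using h assms(3) continuous_on_subset unfolding homeomorphism_def by blast
  moreover have "inj_on h N" using h assms(3) unfolding homeomorphism_def by (metis inj_on_def subsetD)
  ultimately have op: "open (?k ` N)"
    by (intro invariance_of_domain assms continuous_intros) (auto simp: inj_on_def)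
  then obtain e where e: "e > 0" "ball (?k z) e \<subseteq> ?k ` N" using z open_contains_ball by blast
  have "?k z + \<i> * of_real (e/2) \<in> ball (?k z) e" using e(1) by (simp add: dist_norm norm_mult)
  then have "?k z + \<i> * of_real (e/2) \<in> ?k ` N" using e by blast
  then obtain w where "?k z + \<i> * of_real (e/2) = ?k w" by blast
  then have "Im (?k z + \<i> * of_real (e/2)) = 0" by simp
  then show False using e(1) by simp
qed

lemma closure_arc_interior:
  fixes g :: "real \<Rightarrow> complex"
  assumes "arc g"
  shows "closure (path_image g - {pathstart g, pathfinish g}) = path_image g"
    "path_image g - {pathstart g, pathfinish g} = g ` {0<..<1}"
proof -
  have cont: "continuous_on {0..1} g" and inj: "inj_on g {0..1}" using assms by (auto simp: arc_def path_def)
  have "{0..1} = {0<..<1} \<union> {0, 1::real}" by auto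
  then have "path_image g = g ` {0<..<1} \<union> {pathstart g, pathfinish g}"
    unfolding path_image_def pathstart_def pathfinish_def by auto
  moreover have "g t \<notin> {pathstart g, pathfinish g}" if "0 < t" "t < 1" for t
    using inj_onD[OF inj, of t 0] inj_onD[OF inj, of t 1] that by (auto simp: pathstart_def pathfinish_def)
  ultimately show *: "path_image g - {pathstart g, pathfinish g} = g ` {0<..<1}" by auto
  show "closure (path_image g - {pathstart g, pathfinish g}) = path_image g"
  proof
    show "closure (path_image g - {pathstart g, pathfinish g}) \<subseteq> path_image g"
      by (intro closure_minimal) (auto simp: closed_arc_image assms)
    have "g ` closure {0<..<1} \<subseteq> closure (g ` {0<..<1})"
      by (intro image_closure_subset closure_subset closed_closure) (use cont in simp)
    then show "path_image g \<subseteq> closure (path_image g - {pathstart g, pathfinish g})"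
      unfolding * by (simp add: path_image_def)
  qed
qed

lemma homeoD:
  assumes "homeomorphism S T f g"
  shows "continuous_on S f" "continuous_on T g" "x \<in> S \<Longrightarrow> g (f x) = x" "y \<in> T \<Longrightarrow> f (g y) = y"
    "x \<in> S \<Longrightarrow> f x \<in> T" "y \<in> T \<Longrightarrow> g y \<in> S"
  using assms unfolding homeomorphism_def by auto

locale odd_lattice =
  fixes V :: "complex set" and E F :: "complex set set" and f0 :: "complex set"
  assumes lattice: "hexagonal_lattice_around_odd_face V E F f0"
begin

lemma partition: "partition_on UNIV (cells V E F)"
  and edges: "e \<in> E \<Longrightarrow> is_edge V e"
  and locally_finite: "locally_finite_cells (cells V E F)"
  and degree: "v \<in> V \<Longrightarrow> card {e \<in> E. v \<in> closure e} = 3"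
  and hexagons: "\<lbrakk>f \<in> F; f \<noteq> f0\<rbrakk> \<Longrightarrow> is_polygon V E 6 f"
  and odd_face: "f0 \<in> F" "\<exists>n. odd n \<and> 3 \<le> n \<and> is_polygon V E n f0"
  using lattice unfolding hexagonal_lattice_around_odd_face_def cell_decomposition_def vertex_degree_def
  by auto

lemma cells_disjoint: "\<lbrakk>c \<in> cells V E F; d \<in> cells V E F; z \<in> c; z \<in> d\<rbrakk> \<Longrightarrow> c = d"
  using partition unfolding partition_on_def disjoint_def by blast

lemma cellsI: "v \<in> V \<Longrightarrow> {v} \<in> cells V E F" "e \<in> E \<Longrightarrow> e \<in> cells V E F" "f \<in> F \<Longrightarrow> f \<in> cells V E F"
  by (auto simp: cells_def)

lemma face_polygon: assumes "f \<in> F" obtains k where "3 \<le> k" "is_polygon V E k f"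
proof (cases "f = f0")
  case True then show ?thesis using odd_face(2) that by blast
next
  case False then show ?thesis using hexagons[OF assms] that[of 6] by simp
qed

lemma edge_arc:
  assumes "e \<in> E" obtains g where "arc g" "pathstart g \<in> V" "pathfinish g \<in> V" "pathstart g \<noteq> pathfinish g"
    "e = g ` {0<..<1}" "closure e = e \<union> {pathstart g, pathfinish g}" "e \<subseteq> path_image g"
proof -
  obtain g where g: "arc g" "pathstart g \<in> V" "pathfinish g \<in> V" "e = path_image g - {pathstart g, pathfinish g}"
    using edges[OF assms] unfolding is_edge_def by blast
  note c = closure_arc_interior[OF g(1)]
  have "{pathstart g, pathfinish g} \<subseteq> path_image g" using pathstart_in_path_image pathfinish_in_path_image by blast
  then have "closure e = e \<union> {pathstart g, pathfinish g}" "e \<subseteq> path_image g"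
    using c(1) unfolding g(4) by blast+
  then show thesis using g(1-3) c(2)[folded g(4)] by (intro that[of g] arc_distinct_ends[THEN not_sym])
qed

lemma face_open: assumes "f \<in> F" shows "open f"
proof -
  obtain h :: "complex \<Rightarrow> complex" and h' where "homeomorphism (cball 0 1) (closure f) h h'" "h ` ball 0 1 = f"
  proof -
    obtain k where "is_polygon V E k f" using face_polygon[OF assms] by blast
    then show ?thesis using that unfolding is_polygon_def by blast
  qed
  moreover have "continuous_on (ball 0 1) h" "inj_on h (ball 0 1)"
    using calculation ball_subset_cball unfolding homeomorphism_def
    by (metis continuous_on_subset, metis inj_on_def subsetD)
  ultimately show ?thesis using invariance_of_domain[of "ball 0 1" h] by auto
qed

lemma cell_nonempty: "c \<in> cells V E F \<Longrightarrow> c \<noteq> {}"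
  using partition unfolding partition_on_def by blast

text \<open>
  Together with the openness of faces this separates the three kinds of cells: they are pairwise
  disjoint as sets, but a priori the same set could be listed as an edge and as a face.
\<close>

lemma edge_no_open: assumes "e \<in> E" "open N" "N \<subseteq> e" shows "N = {}"
  using edge_arc[OF assms(1)] no_open_in_arc[OF _ assms(2)] assms(3) by (metis subset_trans)

lemma vertex_not_in_edge: assumes "v \<in> V" "e \<in> E" shows "v \<notin> e"
proof
  assume "v \<in> e"
  then have ev: "e = {v}" using cells_disjoint[of "{v}" e v] assms cellsI by auto
  obtain g where g: "arc g" "e = g ` {0<..<1}" using edge_arc[OF assms(2)] by metis
  have "g (1/3) \<in> e" "g (2/3) \<in> e" unfolding g(2) by auto
  then have "g (1/3) = g (2/3)" using ev by auto
  then show False using g(1) inj_onD[of g "{0..1}" "1/3" "2/3"] by (auto simp: arc_def)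
qed

lemma vertex_not_in_face: assumes "v \<in> V" "f \<in> F" shows "v \<notin> f"
proof
  assume "v \<in> f"
  then have "f = {v}" using cells_disjoint[of "{v}" f v] assms cellsI by auto
  then show False using face_open[OF assms(2)] not_open_singleton by metis
qed

lemma edge_face_disjoint: assumes "e \<in> E" "f \<in> F" "z \<in> e" shows "z \<notin> f"
proof
  assume "z \<in> f"
  then have "f = e" using cells_disjoint[of e f z] assms cellsI by auto
  then show False using edge_no_open[OF assms(1) face_open[OF assms(2)]] assms(3) by auto
qed

lemma edges_disjoint: "\<lbrakk>e \<in> E; e' \<in> E; z \<in> e; z \<in> e'\<rbrakk> \<Longrightarrow> e = e'"
  and faces_disjoint: "\<lbrakk>f \<in> F; f' \<in> F; z \<in> f; z \<in> f'\<rbrakk> \<Longrightarrow> f = f'"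
  using cells_disjoint cellsI by blast+

lemma point_cases: obtains "z \<in> V" | e where "e \<in> E" "z \<in> e" | f where "f \<in> F" "z \<in> f"
proof -
  have "z \<in> \<Union>(cells V E F)" using partition unfolding partition_on_def by blast
  then show thesis using that unfolding cells_def by auto
qed

lemma edge_ends:
  assumes "e \<in> E" obtains p q where "p \<in> V" "q \<in> V" "p \<noteq> q" "closure e = e \<union> {p, q}"
    "\<And>v. v \<in> V \<Longrightarrow> v \<in> closure e \<longleftrightarrow> v = p \<or> v = q"
proof -
  obtain p q where pq: "p \<in> V" "q \<in> V" "p \<noteq> q" "closure e = e \<union> {p, q}" using edge_arc[OF assms] by metis
  then show thesis using that[of p q] vertex_not_in_edge[OF _ assms] by blast
qed

text \<open>
  The parametrization of a polygon with its vertices and edges extended periodically from \<open>i < k\<close> to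
  all natural numbers, so that the next vertex and the next edge are always those of index \<open>Suc i\<close>.
\<close>

definition polygon_chart ::
    "complex set \<Rightarrow> nat \<Rightarrow> (complex \<Rightarrow> complex) \<Rightarrow> (complex \<Rightarrow> complex) \<Rightarrow> (nat \<Rightarrow> complex) \<Rightarrow> (nat \<Rightarrow> complex set) \<Rightarrow> bool"
  where "polygon_chart f k h h' v e \<longleftrightarrow>
    homeomorphism (cball 0 1) (closure f) h h' \<and> h ` ball 0 1 = f \<and>
    (\<forall>i. v i \<in> V \<and> e i \<in> E \<and> closure (e i) = e i \<union> {v i, v (Suc i)} \<and>
      e i = h ` cis ` {2 * pi * real i / real k <..< 2 * pi * real (Suc i) / real k}) \<and>
    (\<forall>i j. (v i = v j \<longleftrightarrow> i mod k = j mod k) \<and> (e i = e j \<longleftrightarrow> i mod k = j mod k)) \<and>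
    closure f = f \<union> range v \<union> \<Union> (range e)"

lemma polygon_chartD:
  assumes "polygon_chart f k h h' v e"
  shows "homeomorphism (cball 0 1) (closure f) h h'" "h ` ball 0 1 = f" "v i \<in> V" "e i \<in> E"
    "closure (e i) = e i \<union> {v i, v (Suc i)}"
    "e i = h ` cis ` {2 * pi * real i / real k <..< 2 * pi * real (Suc i) / real k}"
    "v i = v j \<longleftrightarrow> i mod k = j mod k" "e i = e j \<longleftrightarrow> i mod k = j mod k"
    "closure f = f \<union> range v \<union> \<Union> (range e)"
proof -
  note c = assms[unfolded polygon_chart_def]
  note c2 = c[THEN conjunct2, THEN conjunct2]
  note side = c2[THEN conjunct1, THEN spec[of _ i]]
  note cyc = c2[THEN conjunct2, THEN conjunct1, THEN spec[of _ i], THEN spec[of _ j]]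
  show "homeomorphism (cball 0 1) (closure f) h h'" by (rule c[THEN conjunct1])
  show "h ` ball 0 1 = f" by (rule c[THEN conjunct2, THEN conjunct1])
  show "v i \<in> V" by (rule side[THEN conjunct1])
  show "e i \<in> E" by (rule side[THEN conjunct2, THEN conjunct1])
  show "closure (e i) = e i \<union> {v i, v (Suc i)}" by (rule side[THEN conjunct2, THEN conjunct2, THEN conjunct1])
  show "e i = h ` cis ` {2 * pi * real i / real k <..< 2 * pi * real (Suc i) / real k}"
    by (rule side[THEN conjunct2, THEN conjunct2, THEN conjunct2])
  show "v i = v j \<longleftrightarrow> i mod k = j mod k" by (rule cyc[THEN conjunct1])
  show "e i = e j \<longleftrightarrow> i mod k = j mod k" by (rule cyc[THEN conjunct2])
  show "closure f = f \<union> range v \<union> \<Union> (range e)" by (rule c2[THEN conjunct2, THEN conjunct2])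
qed

text \<open>
  The vertices and edges in the boundary are indexed by the classes modulo \<open>k\<close> because \<open>cis\<close> has period
  \<open>2 * pi\<close> and the chart is injective.
\<close>

lemma polygon:
  assumes "f \<in> F" "is_polygon V E k f" "3 \<le> k"
  obtains h h' v e where "polygon_chart f k h h' v e"
proof -
  obtain h h' where h: "homeomorphism (cball 0 1) (closure f) h h'" "h ` ball 0 1 = f"
    and VE: "\<And>i. i < k \<Longrightarrow> h (cis (2 * pi * real i / real k)) \<in> V"
      "\<And>i. i < k \<Longrightarrow> h ` cis ` {2 * pi * real i / real k <..< 2 * pi * real (Suc i) / real k} \<in> E"
    using assms(2) unfolding is_polygon_def by blast
  have k: "real k > 0" using assms(3) by simp
  have cont: "continuous_on (cball 0 1) h" and inj: "inj_on h (cball 0 1)"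
    using h(1) unfolding homeomorphism_def by (auto intro: inj_on_inverseI)
  define \<theta> where "\<theta> t = 2 * pi * t / real k" for t
  have \<theta>: "\<theta> s < \<theta> t \<longleftrightarrow> s < t" "\<theta> s \<le> \<theta> t \<longleftrightarrow> s \<le> t" for s t
    using k by (auto simp: \<theta>_def divide_less_cancel divide_le_cancel)
  have \<theta>_surj: "\<exists>s. t = \<theta> s" for t using k by (intro exI[of _ "t * real k / (2 * pi)"]) (simp add: \<theta>_def)
  have \<theta>_shift: "\<theta> s + 2 * pi * of_int m = \<theta> (s + real k * of_int m)" for s m
    using k by (simp add: \<theta>_def field_simps)
  have h_eq: "h (cis (\<theta> s)) = h (cis (\<theta> t)) \<longleftrightarrow> (\<exists>m::int. s = t + real k * of_int m)" for s t
  proof -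
    have "h (cis (\<theta> s)) = h (cis (\<theta> t)) \<longleftrightarrow> cis (\<theta> s) = cis (\<theta> t)"
      using inj_onD[OF inj, of "cis (\<theta> s)" "cis (\<theta> t)"] by auto
    also have "\<dots> \<longleftrightarrow> (\<exists>m::int. \<theta> s = \<theta> (t + real k * of_int m))" unfolding cis_eq_iff \<theta>_shift ..
    also have "\<dots> \<longleftrightarrow> (\<exists>m::int. s = t + real k * of_int m)" using \<theta> by (metis linorder_neq_iff)
    finally show ?thesis .
  qed
  define v where "v i = h (cis (\<theta> (real i)))" for i
  define e where "e i = h ` cis ` \<theta> ` {real i <..< real (Suc i)}" for i
  have img: "\<theta> ` {a<..<b} = {\<theta> a<..<\<theta> b}" "\<theta> ` {a..b} = {\<theta> a..\<theta> b}" for a b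
  proof -
    have "t \<in> \<theta> ` {a<..<b} \<longleftrightarrow> t \<in> {\<theta> a<..<\<theta> b}" "t \<in> \<theta> ` {a..b} \<longleftrightarrow> t \<in> {\<theta> a..\<theta> b}" for t
    proof -
      obtain s where s: "t = \<theta> s" using \<theta>_surj by blast
      have "inj \<theta>" by (intro injI) (metis \<theta>(1) linorder_neq_iff)
      then show "t \<in> \<theta> ` {a<..<b} \<longleftrightarrow> t \<in> {\<theta> a<..<\<theta> b}" "t \<in> \<theta> ` {a..b} \<longleftrightarrow> t \<in> {\<theta> a..\<theta> b}"
        unfolding s by (simp_all add: inj_image_mem_iff \<theta>)
    qed
    then show "\<theta> ` {a<..<b} = {\<theta> a<..<\<theta> b}" "\<theta> ` {a..b} = {\<theta> a..\<theta> b}" by blast+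
  qed
  have e_eq: "e i = h ` cis ` {2 * pi * real i / real k <..< 2 * pi * real (Suc i) / real k}" for i
    unfolding e_def img by (simp add: \<theta>_def)
  have cong: "(\<exists>m::int. real i = real j + real k * of_int m) \<longleftrightarrow> i mod k = j mod k" for i j
  proof -
    have "real_of_int (int i) = real_of_int (int j + int k * m) \<longleftrightarrow> int i = int j + int k * m" for m
      by (rule of_int_eq_iff)
    then have "(\<exists>m::int. real i = real j + real k * of_int m) \<longleftrightarrow> (\<exists>m::int. int i = int j + int k * m)"
      by simp
    also have "\<dots> \<longleftrightarrow> int k dvd int i - int j"
      unfolding dvd_def by (intro ex_cong1) linarith
    also have "\<dots> \<longleftrightarrow> int (i mod k) = int (j mod k)" by (simp add: mod_eq_dvd_iff zmod_int)
    finally show ?thesis by simp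
  qed
  have v_eq: "v i = v j \<longleftrightarrow> i mod k = j mod k" for i j
    unfolding v_def h_eq cong ..
  have e_point: "h (cis (\<theta> s)) \<in> e i \<longleftrightarrow> (\<exists>m::int. s + real k * of_int m \<in> {real i <..< real (Suc i)})" for s i
  proof -
    have "h (cis (\<theta> s)) \<in> e i \<longleftrightarrow> (\<exists>t\<in>{real i <..< real (Suc i)}. \<exists>m::int. t = s + real k * of_int m)"
      unfolding e_def image_image by (subst image_iff) (metis h_eq)
    then show ?thesis by blast
  qed
  have e_mod: "e i = e j" if "i mod k = j mod k" for i j
  proof -
    have *: "h (cis (\<theta> s)) \<in> e j" if hi: "h (cis (\<theta> s)) \<in> e i" and ij: "i mod k = j mod k" for i j s
    proof -
      obtain m where m: "s + real k * of_int m \<in> {real i <..< real (Suc i)}"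
        using e_point[THEN iffD1, OF hi] by (elim exE)
      obtain l where l: "real j = real i + real k * of_int l"
        using cong[THEN iffD2, OF ij[symmetric]] by (elim exE)
      have "s + real k * of_int (m + l) \<in> {real j <..< real (Suc j)}" using m l by (auto simp: algebra_simps)
      then show ?thesis by (intro e_point[THEN iffD2] exI)
    qed
    have "x \<in> e j" if xi: "x \<in> e i" and "i mod k = j mod k" for x i j
    proof -
      obtain s where "x = h (cis (\<theta> s))" using xi unfolding e_def by blast
      then show ?thesis using *[of s i j] that by simp
    qed
    from this[of _ i j] this[of _ j i] show ?thesis using that by auto
  qed
  have ne: "h (cis (\<theta> (real i + 1/2))) \<in> e i" for i unfolding e_def by auto
  have e_inj: "i mod k = j mod k" if ij: "e i = e j" for i j
  proof -
    obtain m where m: "real i + 1/2 + real k * of_int m \<in> {real j <..< real (Suc j)}"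
      using e_point[THEN iffD1, OF ne[of i, unfolded ij]] by (elim exE)
    then have "real_of_int (int i + int k * m) < real_of_int (int j + 1)" "real_of_int (int j - 1) < real_of_int (int i + int k * m)" by auto
    then have "int i + int k * m < int j + 1" "int j - 1 < int i + int k * m" unfolding of_int_less_iff by blast+
    then have "int j = int i + int k * m" by linarith
    then have "real j = real i + real k * of_int m" by (metis of_int_add of_int_mult of_int_of_nat_eq)
    then show ?thesis by (intro cong[THEN iffD1, symmetric] exI)
  qed
  have cont': "continuous_on S (\<lambda>t. h (cis t))" for S
    by (intro continuous_on_compose2[OF cont] continuous_intros) auto
  have closed_e: "e i \<union> {v i, v (Suc i)} = h ` cis ` {\<theta> (real i)..\<theta> (real (Suc i))}" for i
  proof -
    have "{real i..real (Suc i)} = {real i<..<real (Suc i)} \<union> {real i, real (Suc i)}" by auto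
    then show ?thesis unfolding img(2)[symmetric] e_def v_def by auto
  qed
  have clo: "closure (e i) = e i \<union> {v i, v (Suc i)}" for i
  proof
    have "compact (h ` cis ` {\<theta> (real i)..\<theta> (real (Suc i))})"
      unfolding image_image by (intro compact_continuous_image cont' compact_Icc)
    then show "closure (e i) \<subseteq> e i \<union> {v i, v (Suc i)}"
      unfolding closed_e[symmetric] by (intro closure_minimal compact_imp_closed) auto
    have "(\<lambda>t. h (cis t)) ` closure {\<theta> (real i)<..<\<theta> (real (Suc i))} \<subseteq> closure (e i)"
      unfolding e_def img image_image by (intro image_closure_subset cont' closure_subset closed_closure)
    moreover have "\<theta> (real i) < \<theta> (real (Suc i))" by (simp add: \<theta>)
    ultimately show "e i \<union> {v i, v (Suc i)} \<subseteq> closure (e i)"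
      unfolding closed_e by (simp add: image_image)
  qed
  have k0: "k > 0" using assms(3) by simp
  have vV: "v i \<in> V" for i
    using VE(1)[of "i mod k"] v_eq[of i "i mod k"] k0 by (simp add: v_def \<theta>_def)
  have eE: "e i \<in> E" for i
    using VE(2)[of "i mod k"] e_mod[of i "i mod k"] e_eq[of "i mod k"] k0 by simp
  have "h ` cball 0 1 = closure f" using h(1) unfolding homeomorphism_def by blast
  moreover have "cball 0 1 = ball 0 1 \<union> sphere (0::complex) 1" by auto
  ultimately have clf: "closure f = f \<union> h ` sphere 0 1" using h(2) by (metis image_Un)
  have sph: "h ` sphere 0 1 = range v \<union> \<Union> (range e)"
  proof
    show "range v \<union> \<Union> (range e) \<subseteq> h ` sphere 0 1" unfolding v_def e_def by auto
    show "h ` sphere 0 1 \<subseteq> range v \<union> \<Union> (range e)"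
    proof clarify
      fix z :: complex assume "z \<in> sphere 0 1" and nE: "h z \<notin> \<Union> (range e)"
      then obtain t where t: "0 \<le> t" "z = cis t"
        using complex_unimodular_polar[of z] by (metis cis.code mem_sphere_0)
      obtain s where s: "t = \<theta> s" using \<theta>_surj by blast
      have s0: "0 \<le> s" using t(1) \<theta>(2)[of 0 s] unfolding s by (simp add: \<theta>_def)
      define i where "i = nat \<lfloor>s\<rfloor>"
      have i: "real i \<le> s" "s < real (Suc i)" using s0 unfolding i_def by linarith+
      show "h z \<in> range v"
      proof (cases "s = real i")
        case True then show ?thesis unfolding v_def t(2) s by blast
      next
        case False
        then have "h z \<in> e i" unfolding e_def t(2) s using i by auto
        then show ?thesis using nE by blast
      qed
    qed
  qed
  have e_iff: "e i = e j \<longleftrightarrow> i mod k = j mod k" for i j using e_mod e_inj by blast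
  have "closure f = f \<union> range v \<union> \<Union> (range e)" unfolding clf sph by (rule Un_assoc[symmetric])
  then have "polygon_chart f k h h' v e"
    unfolding polygon_chart_def by (intro conjI allI h vV eE e_eq v_eq e_iff clo)
  then show thesis by (rule that)
qed

lemma edge_nonempty: "e \<in> E \<Longrightarrow> e \<noteq> {}"
  using cell_nonempty cellsI by blast

text \<open>
  The boundary of a polygon is a union of cells.
\<close>

lemma edge_subset_face:
  assumes "e \<in> E" "f \<in> F" "z \<in> e" "z \<in> closure f" shows "e \<subseteq> closure f"
proof -
  obtain k where k: "3 \<le> k" "is_polygon V E k f" using face_polygon[OF assms(2)] by blast
  obtain h h' v e' where "polygon_chart f k h h' v e'" using polygon[OF assms(2) k(2,1)] by blast
  note chart = polygon_chartD[OF this]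
  note cl = chart(9)
  then obtain i where "z \<in> e' i" "e' i \<in> E"
    using assms edge_face_disjoint[OF assms(1,2,3)] vertex_not_in_edge[OF _ assms(1)] chart(3,4) by auto
  then have "e = e' i" using edges_disjoint assms by blast
  then show ?thesis unfolding cl by blast
qed

text \<open>
  A neighbourhood that meets only finitely many cells can be made smaller by the closures of those that
  stay away from \<open>z\<close>.
\<close>

lemma star_exists:
  obtains N where "open N" "z \<in> N" "\<And>z' c. \<lbrakk>z' \<in> N; c \<in> cells V E F; z' \<in> c\<rbrakk> \<Longrightarrow> z \<in> closure c"
proof -
  obtain U where U: "open U" "z \<in> U" "finite {c \<in> cells V E F. c \<inter> U \<noteq> {}}"
    using locally_finite unfolding locally_finite_cells_def by blast
  let ?C = "{c \<in> {c \<in> cells V E F. c \<inter> U \<noteq> {}}. z \<notin> closure c}"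
  have "closed (\<Union>c\<in>?C. closure c)" using finite_subset[OF _ U(3), of ?C] by (intro closed_UN) auto
  then have "open (U - (\<Union>c\<in>?C. closure c))" using U(1) by blast
  moreover have "z \<in> U - (\<Union>c\<in>?C. closure c)" using U by blast
  moreover have "z \<in> closure c" if "z' \<in> U - (\<Union>c\<in>?C. closure c)" "c \<in> cells V E F" "z' \<in> c" for z' c
    using that closure_subset[of c] by blast
  ultimately show thesis by (rule that)
qed

definition star :: "complex \<Rightarrow> complex set" where
  "star z = (SOME N. open N \<and> z \<in> N \<and> (\<forall>z' \<in> N. \<forall>c \<in> cells V E F. z' \<in> c \<longrightarrow> z \<in> closure c))"

lemma star: "open (star z)" "z \<in> star z" "\<lbrakk>z' \<in> star z; c \<in> cells V E F; z' \<in> c\<rbrakk> \<Longrightarrow> z \<in> closure c"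
proof -
  have "open (star z) \<and> z \<in> star z \<and> (\<forall>z' \<in> star z. \<forall>c \<in> cells V E F. z' \<in> c \<longrightarrow> z \<in> closure c)"
    unfolding star_def by (rule someI_ex) (meson star_exists)
  then show "open (star z)" "z \<in> star z" "\<lbrakk>z' \<in> star z; c \<in> cells V E F; z' \<in> c\<rbrakk> \<Longrightarrow> z \<in> closure c" by blast+
qed

lemma star_of_edge:
  assumes "e \<in> E" "p \<in> e" shows "star p \<subseteq> e \<union> \<Union>{f \<in> F. e \<subseteq> closure f}"
proof
  fix z assume z: "z \<in> star p"
  show "z \<in> e \<union> \<Union>{f \<in> F. e \<subseteq> closure f}"
  proof (cases z rule: point_cases)
    case 1
    then have "p = z" using star(3)[OF z, of "{z}"] cellsI by auto
    then show ?thesis using assms by simp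
  next
    case (2 e')
    then have "p \<in> closure e'" using star(3)[OF z, of e'] cellsI by auto
    then have "p \<in> e'" using edge_ends[OF 2(1)] vertex_not_in_edge[OF _ assms(1)] assms(2) by blast
    then show ?thesis using edges_disjoint[OF assms(1) 2(1) assms(2)] 2 by auto
  next
    case (3 f)
    then have "p \<in> closure f" using star(3)[OF z, of f] cellsI by auto
    then show ?thesis using edge_subset_face[OF assms(1) 3(1) assms(2)] 3 by blast
  qed
qed

text \<open>
  If there were only one face, it would fill a neighbourhood of a point of the edge together with
  the edge. By invariance of domain the chart of the face would then send this boundary point into the
  interior of the disc.
\<close>

lemma edge_not_one_face:
  assumes "e \<in> E" "f \<in> F" "e \<subseteq> closure f" shows "\<exists>g\<in>F. g \<noteq> f \<and> e \<subseteq> closure g"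
proof (rule ccontr)
  assume "\<not> ?thesis"
  then have fs: "{g \<in> F. e \<subseteq> closure g} = {f}" using assms by blast
  obtain p where p: "p \<in> e" using edge_nonempty[OF assms(1)] by blast
  have N: "star p \<subseteq> closure f" using star_of_edge[OF assms(1) p] assms(3) closure_subset[of f] unfolding fs by auto
  obtain k where k: "3 \<le> k" "is_polygon V E k f" using face_polygon[OF assms(2)] by blast
  obtain h h' v e' where "polygon_chart f k h h' v e'" using polygon[OF assms(2) k(2,1)] by blast
  note h = polygon_chartD[OF this]
  have "continuous_on (star p) h'" using homeoD(2)[OF h(1)] N by (rule continuous_on_subset)
  moreover have "inj_on h' (star p)" using homeoD(4)[OF h(1)] N by (intro inj_on_inverseI[of _ h]) blast
  ultimately have op: "open (h' ` star p)" using star(1) by (intro invariance_of_domain)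
  have "h' ` star p \<subseteq> cball 0 1" using homeoD(6)[OF h(1)] N by blast
  then have "h' ` star p \<subseteq> ball 0 1" using interior_maximal[OF _ op, of "cball 0 1"] by simp
  then have "h' p \<in> ball 0 1" using star(2) by blast
  then have "h (h' p) \<in> f" using h(2) by blast
  moreover have "h (h' p) = p" using homeoD(4)[OF h(1)] N star(2) by blast
  ultimately show False using edge_face_disjoint[OF assms(1,2) p] by simp
qed

lemma edge_some_face: assumes "e \<in> E" obtains f where "f \<in> F" "e \<subseteq> closure f"
proof -
  obtain p where p: "p \<in> e" using edge_nonempty[OF assms(1)] by blast
  have "\<not> star p \<subseteq> e" using edge_no_open[OF assms star(1)] star(2) by blast
  then show thesis using star_of_edge[OF assms p] that by blast
qed

text \<open>
  Two faces along a common edge fill a neighbourhood of one of its points. Radial coordinates of the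
  two charts, matched along the edge, combine to a continuous injection of an open rectangle, and
  its image is open by invariance of domain. So there is no room for a third face.
\<close>

lemma two_faces_fill:
  assumes f: "f1 \<in> F" "f2 \<in> F" "f1 \<noteq> f2" and e: "e \<in> E" "e \<subseteq> closure f1" "e \<subseteq> closure f2"
  obtains N p where "open N" "p \<in> N" "p \<in> e" "N \<subseteq> e \<union> f1 \<union> f2"
proof -
  obtain k where k: "3 \<le> k" "is_polygon V E k f1" using face_polygon[OF f(1)] by blast
  obtain h1 h1' v e1 where "polygon_chart f1 k h1 h1' v e1" using polygon[OF f(1) k(2,1)] by blast
  note h1 = polygon_chartD[OF this]
  note ve = h1(3,4) and e1 = h1(6) and cl1 = h1(9)
  obtain k2 where k2: "3 \<le> k2" "is_polygon V E k2 f2" using face_polygon[OF f(2)] by blast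
  obtain h2 h2' v' e2 where "polygon_chart f2 k2 h2 h2' v' e2" using polygon[OF f(2) k2(2,1)] by blast
  note h2 = polygon_chartD[OF this]
  obtain z where z: "z \<in> e" using edge_nonempty[OF e(1)] by blast
  then obtain i where i: "z \<in> e1 i" using e(2) cl1 edge_face_disjoint[OF e(1) f(1) z] vertex_not_in_edge[OF _ e(1)] ve(1) by blast
  have ei: "e = e1 i" using edges_disjoint[OF e(1) ve(2) z i] .
  define I where "I = {2 * pi * real i / real k <..< 2 * pi * real (Suc i) / real k}"
  have eI: "e = h1 ` cis ` I" unfolding ei e1 I_def ..
  have k0: "real k > 0" using k by simp
  have inj_cis: "s = t" if "s \<in> I" "t \<in> I" "cis s = cis t" for s t
  proof -
    obtain m where m: "s = t + 2 * pi * of_int m" using \<open>cis s = cis t\<close> unfolding cis_eq_iff by blast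
    have "2 * pi * real (Suc i) / real k - 2 * pi * real i / real k = 2 * pi / real k"
      using k0 by (simp add: field_simps)
    also have "\<dots> < 2 * pi" using k by (simp add: field_simps)
    finally have "\<bar>s - t\<bar> < 2 * pi" using that(1,2) unfolding I_def by auto
    then have "2 * pi * \<bar>of_int m\<bar> < 2 * pi * 1" unfolding m by (simp add: abs_mult)
    then have "\<bar>m\<bar> < 1" by simp
    then show ?thesis using m by simp
  qed
  have cont: "continuous_on (cball 0 1) h1" "continuous_on (cball 0 1) h2" "continuous_on (closure f2) h2'"
    and inv1: "\<And>x. x \<in> cball 0 1 \<Longrightarrow> h1' (h1 x) = x" and inv2: "\<And>x. x \<in> cball 0 1 \<Longrightarrow> h2' (h2 x) = x" "\<And>y. y \<in> closure f2 \<Longrightarrow> h2 (h2' y) = y"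
    and im2: "\<And>y. y \<in> closure f2 \<Longrightarrow> h2' y \<in> cball 0 1"
    using homeoD[OF h1(1)] homeoD[OF h2(1)] by blast+
  define c where "c z = h2' (h1 (cis (Re z)))" for z
  have he: "h1 (cis t) \<in> e" if "t \<in> I" for t using that eI by blast
  have c1: "cmod (c z) = 1" if "Re z \<in> I" for z
  proof -
    have *: "h1 (cis (Re z)) \<in> e" by (rule he[OF that])
    then have "c z \<in> cball 0 1" "h2 (c z) = h1 (cis (Re z))" using im2 inv2 e(3) unfolding c_def by blast+
    moreover have "c z \<notin> ball 0 1" using calculation(2) h2(2) * edge_face_disjoint[OF e(1) f(2)] by (metis imageI)
    ultimately show ?thesis by auto
  qed
  define S where "S = {z. Re z \<in> I \<and> \<bar>Im z\<bar> < 1}"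
  define P where "P z = h1 ((1 - Im z) *\<^sub>R cis (Re z))" for z
  define Q where "Q z = h2 ((1 + Im z) *\<^sub>R c z)" for z
  \<comment> \<open>The real part runs along the edge; the imaginary part is the distance from it, into \<open>f1\<close> for positive and into \<open>f2\<close> for negative values.\<close>
  define G where "G z = (if 0 \<le> Im z then P z else Q z)" for z
  have nP: "cmod ((1 - Im z) *\<^sub>R cis (Re z)) = 1 - Im z" if "z \<in> S" for z using that by (auto simp: S_def abs_if)
  have nQ: "cmod ((1 + Im z) *\<^sub>R c z) = 1 + Im z" if "z \<in> S" for z using that c1[of z] by (auto simp: S_def abs_if)
  have PQ: "P z = Q z" if "z \<in> S" "Im z = 0" for z
    using that inv2(2)[of "h1 (cis (Re z))"] he[of "Re z"] e(3) by (auto simp: P_def Q_def c_def S_def)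
  have contc: "continuous_on S c"
  proof -
    have "(\<lambda>z. h1 (cis (Re z))) ` S \<subseteq> closure f2" using he e(3) unfolding S_def by blast
    moreover have "continuous_on S (\<lambda>z. h1 (cis (Re z)))"
      by (intro continuous_on_compose2[OF cont(1)] continuous_intros) auto
    ultimately show ?thesis unfolding c_def by (intro continuous_on_compose2[OF cont(3)]) auto
  qed
  have "continuous_on {z \<in> S. 0 \<le> Im z} P"
    unfolding P_def by (intro continuous_on_compose2[OF cont(1)] continuous_intros) (use nP in auto)
  moreover have "continuous_on {z \<in> S. Im z \<le> 0} Q"
    unfolding Q_def
    by (intro continuous_on_compose2[OF cont(2)] continuous_intros continuous_on_subset[OF contc]) (use nQ in auto)
  ultimately have contG: "continuous_on S G"
    using continuous_on_cases_le[of S "\<lambda>z. - Im z" 0 P Q] PQ by (simp add: G_def continuous_intros)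
  have regP: "P z \<in> (if Im z = 0 then e else f1)" if "z \<in> S" "0 \<le> Im z" for z
  proof (cases "Im z = 0")
    case True then show ?thesis using he that by (simp add: P_def S_def)
  next
    case False
    then have "(1 - Im z) *\<^sub>R cis (Re z) \<in> ball 0 1" using nP[OF that(1)] that by simp
    then show ?thesis using False h1(2) unfolding P_def by auto
  qed
  have regQ: "Q z \<in> f2" if "z \<in> S" "Im z < 0" for z
  proof -
    have "(1 + Im z) *\<^sub>R c z \<in> ball 0 1" using nQ[OF that(1)] that by simp
    then show ?thesis using h2(2) unfolding Q_def by auto
  qed
  have sep: "P z \<noteq> Q w" if "z \<in> S" "0 \<le> Im z" "w \<in> S" "Im w < 0" for z w
    using regP[OF that(1,2)] regQ[OF that(3,4)] edge_face_disjoint[OF e(1) f(2)] faces_disjoint[OF f(1,2)] f(3)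
    by (metis (full_types))
  have injP: "z = w" if zw: "z \<in> S" "w \<in> S" "0 \<le> Im z" "0 \<le> Im w" "P z = P w" for z w
  proof -
    have "(1 - Im z) *\<^sub>R cis (Re z) \<in> cball 0 1" "(1 - Im w) *\<^sub>R cis (Re w) \<in> cball 0 1"
      using nP zw by auto
    then have eq: "(1 - Im z) *\<^sub>R cis (Re z) = (1 - Im w) *\<^sub>R cis (Re w)"
      using inv1 zw(5) unfolding P_def by metis
    then have "Im z = Im w" using nP[OF zw(1)] nP[OF zw(2)] by simp
    moreover from this have "cis (Re z) = cis (Re w)" using eq zw(1) by (auto simp: S_def)
    then have "Re z = Re w" using inj_cis zw(1,2) by (simp add: S_def)
    ultimately show ?thesis by (simp add: complex_eq_iff)
  qed
  have injQ: "z = w" if zw: "z \<in> S" "w \<in> S" "Im z < 0" "Im w < 0" "Q z = Q w" for z w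
  proof -
    have "(1 + Im z) *\<^sub>R c z \<in> cball 0 1" "(1 + Im w) *\<^sub>R c w \<in> cball 0 1" using nQ zw by auto
    then have eq: "(1 + Im z) *\<^sub>R c z = (1 + Im w) *\<^sub>R c w"
      using inv2(1) zw(5) unfolding Q_def by metis
    then have "Im z = Im w" using nQ[OF zw(1)] nQ[OF zw(2)] by simp
    moreover from this have "c z = c w" using eq zw(1) by (auto simp: S_def)
    then have "h1 (cis (Re z)) = h1 (cis (Re w))" using inv2(2) he e(3) zw(1,2) unfolding c_def S_def
      by (metis (mono_tags, lifting) mem_Collect_eq subsetD)
    then have "h1' (h1 (cis (Re z))) = h1' (h1 (cis (Re w)))" by (rule arg_cong)
    moreover have "h1' (h1 (cis t)) = cis t" for t by (rule inv1) simp
    ultimately have "cis (Re z) = cis (Re w)" by metis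
    then have "Re z = Re w" using inj_cis zw(1,2) by (simp add: S_def)
    with \<open>Im z = Im w\<close> show ?thesis by (simp add: complex_eq_iff)
  qed
  have injG: "inj_on G S"
  proof (rule inj_onI)
    fix z w assume zw: "z \<in> S" "w \<in> S" "G z = G w"
    consider "0 \<le> Im z" "0 \<le> Im w" | "0 \<le> Im z" "Im w < 0" | "Im z < 0" "0 \<le> Im w" | "Im z < 0" "Im w < 0" by linarith
    then show "z = w"
      using injP[OF zw(1,2)] injQ[OF zw(1,2)] sep[OF zw(1) _ zw(2)] sep[OF zw(2) _ zw(1)] zw(3)
      by cases (auto simp: G_def)
  qed
  have "open S"
  proof -
    have "S = Re -` I \<inter> Im -` {-1<..<1}" by (auto simp: S_def)
    then show ?thesis unfolding I_def by (auto intro!: open_Int open_vimage continuous_intros)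
  qed
  then have "open (G ` S)" using invariance_of_domain[OF contG _ injG] by blast
  moreover have "G ` S \<subseteq> e \<union> f1 \<union> f2"
    using regP regQ unfolding G_def by (auto split: if_splits) (metis linorder_not_le)+
  moreover obtain t where t: "t \<in> I" using eI edge_nonempty[OF e(1)] by blast
  have "Complex t 0 \<in> S" "G (Complex t 0) \<in> e" using t he[OF t] by (auto simp: S_def G_def P_def)
  ultimately show thesis using that by blast
qed

lemma edge_two_faces:
  assumes "e \<in> E" obtains f g where "f \<noteq> g" "{h \<in> F. e \<subseteq> closure h} = {f, g}"
proof -
  obtain f where f: "f \<in> F" "e \<subseteq> closure f" using edge_some_face[OF assms] by blast
  obtain g where g: "g \<in> F" "g \<noteq> f" "e \<subseteq> closure g" using edge_not_one_face[OF assms f] by blast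
  obtain N p where N: "open N" "p \<in> N" "p \<in> e" "N \<subseteq> e \<union> f \<union> g"
    using two_faces_fill[OF f(1) g(1) g(2)[symmetric] assms f(2) g(3)] by metis
  have "h = f \<or> h = g" if h: "h \<in> F" "e \<subseteq> closure h" for h
  proof -
    have "p \<in> closure h" using N(3) h(2) by blast
    then obtain y where "y \<in> h" "y \<in> N" using N(1,2) closure_iff_nhds_not_empty[of p h] by blast
    then show ?thesis using N(4) edge_face_disjoint[OF assms h(1)] faces_disjoint[OF h(1)] f(1) g(1) by blast
  qed
  then have "{h \<in> F. e \<subseteq> closure h} = {f, g}" using f g by blast
  then show thesis using that g(2) by blast
qed

section \<open>Flags and their three involutions\<close>

definition Flags :: "(complex \<times> complex set \<times> complex set) set" where
  "Flags = {(v, e, f). v \<in> V \<and> e \<in> E \<and> f \<in> F \<and> v \<in> closure e \<and> e \<subseteq> closure f}"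

lemma FlagsI: "\<lbrakk>v \<in> V; e \<in> E; f \<in> F; v \<in> closure e; e \<subseteq> closure f\<rbrakk> \<Longrightarrow> (v, e, f) \<in> Flags"
  by (simp add: Flags_def)

lemma FlagsD: assumes "(v, e, f) \<in> Flags"
  shows "v \<in> V" "e \<in> E" "f \<in> F" "v \<in> closure e" "e \<subseteq> closure f" "v \<in> closure f"
proof -
  show *: "v \<in> V" "e \<in> E" "f \<in> F" "v \<in> closure e" "e \<subseteq> closure f" using assms by (simp_all add: Flags_def)
  have "closure e \<subseteq> closure f" using *(5) by (simp add: closure_minimal)
  then show "v \<in> closure f" using *(4) by blast
qed

text \<open>
  An edge in the closure of a polygon meets one of the edges of the chart, hence equals it.
\<close>

lemma chart_edge:
  assumes c: "polygon_chart f k h h' v e" and "e' \<in> E" "f \<in> F" "e' \<subseteq> closure f"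
  obtains i where "e' = e i"
proof -
  note c' = polygon_chartD[OF c]
  obtain z where z: "z \<in> e'" using edge_nonempty[OF assms(2)] by blast
  have "z \<notin> range v" using vertex_not_in_edge[OF c'(3) assms(2)] z by blast
  then obtain i where i: "z \<in> e i" using z assms(4) edge_face_disjoint[OF assms(2,3) z] unfolding c'(9) by blast
  show thesis by (rule that[OF edges_disjoint[OF assms(2) c'(4) z i]])
qed

lemma chart_flag:
  assumes c: "polygon_chart f k h h' v e" and "f \<in> F"
  shows "(w, e', f) \<in> Flags \<longleftrightarrow> (\<exists>i. e' = e i \<and> (w = v i \<or> w = v (Suc i)))"
proof -
  note c' = polygon_chartD[OF c]
  show ?thesis
  proof
    assume *: "(w, e', f) \<in> Flags"
    then obtain i where i: "e' = e i" using chart_edge[OF c FlagsD(2)[OF *] assms(2) FlagsD(5)[OF *]] by blast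
    then have "w \<in> e i \<union> {v i, v (Suc i)}" using FlagsD(4)[OF *] c'(5) by blast
    then show "\<exists>i. e' = e i \<and> (w = v i \<or> w = v (Suc i))"
      using i vertex_not_in_edge[OF FlagsD(1)[OF *] c'(4)] by blast
  next
    assume "\<exists>i. e' = e i \<and> (w = v i \<or> w = v (Suc i))"
    then obtain i where i: "e' = e i" "w = v i \<or> w = v (Suc i)" by blast
    show "(w, e', f) \<in> Flags" unfolding i(1)
    proof (rule FlagsI)
      show "w \<in> V" using i(2) c'(3) by blast
      show "e i \<in> E" by (rule c'(4))
      show "w \<in> closure (e i)" using i(2) unfolding c'(5) by blast
      show "e i \<subseteq> closure f" unfolding c'(9) by blast
    qed (rule assms(2))
  qed
qed

lemma other_vertex: assumes "(v, e, f) \<in> Flags" shows "\<exists>!v'. v' \<noteq> v \<and> (v', e, f) \<in> Flags"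
proof -
  note d = FlagsD[OF assms]
  obtain p q where pq: "p \<in> V" "q \<in> V" "p \<noteq> q" "\<And>v. v \<in> V \<Longrightarrow> v \<in> closure e \<longleftrightarrow> v = p \<or> v = q"
    using edge_ends[OF d(2)] by metis
  have "(v', e, f) \<in> Flags \<longleftrightarrow> v' = p \<or> v' = q" for v'
    using pq(1,2) pq(4)[of v'] d(2,3,5) unfolding Flags_def by auto
  then show ?thesis using assms pq(3) by metis
qed

lemma other_face: assumes "(v, e, f) \<in> Flags" shows "\<exists>!f'. f' \<noteq> f \<and> (v, e, f') \<in> Flags"
proof -
  note d = FlagsD[OF assms]
  obtain p q where pq: "p \<noteq> q" "{h \<in> F. e \<subseteq> closure h} = {p, q}" using edge_two_faces[OF d(2)] by blast
  have "(v, e, f') \<in> Flags \<longleftrightarrow> f' \<in> {h \<in> F. e \<subseteq> closure h}" for f'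
    using d(1,2,4) by (simp add: Flags_def)
  then have "(v, e, f') \<in> Flags \<longleftrightarrow> f' = p \<or> f' = q" for f' unfolding pq(2) by simp
  then show ?thesis using assms pq(1) by metis
qed

lemma other_edge: assumes "(v, e, f) \<in> Flags" shows "\<exists>!e'. e' \<noteq> e \<and> (v, e', f) \<in> Flags"
proof -
  note d = FlagsD[OF assms]
  obtain k where k: "3 \<le> k" "is_polygon V E k f" using face_polygon[OF d(3)] by blast
  obtain h h' w d' where c: "polygon_chart f k h h' w d'" using polygon[OF d(3) k(2,1)] by blast
  note c' = polygon_chartD[OF c] and fl = chart_flag[OF c d(3)]
  obtain i where "v = w i"
    using assms unfolding fl by blast
  then have i: "v = w (i + k)" using c'(7)[of i "i + k"] by simp
  define j where "j = i + k - 1"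
  have j: "v = w (Suc j)" using i k by (simp add: j_def)
  have vf: "(v, e', f) \<in> Flags \<longleftrightarrow> e' = d' j \<or> e' = d' (Suc j)" for e'
  proof
    assume "(v, e', f) \<in> Flags"
    then obtain l where l: "e' = d' l" "v = w l \<or> v = w (Suc l)" unfolding fl by blast
    show "e' = d' j \<or> e' = d' (Suc j)"
    proof (cases "v = w l")
      case True
      then have "l mod k = Suc j mod k" using c'(7) j by metis
      then show ?thesis using l(1) c'(8) by metis
    next
      case False
      then have "Suc l mod k = Suc j mod k" using c'(7) j l by metis
      then have "l mod k = j mod k" by (auto simp: mod_Suc split: if_splits)
      then show ?thesis using l(1) c'(8) by metis
    qed
  next
    assume "e' = d' j \<or> e' = d' (Suc j)"
    then show "(v, e', f) \<in> Flags" unfolding fl j by blast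
  qed
  have "j mod k \<noteq> Suc j mod k" using k(1) by (simp add: mod_Suc)
  then have "d' j \<noteq> d' (Suc j)" using c'(8) by metis
  then show ?thesis using assms unfolding vf by metis
qed

type_synonym flag = "complex \<times> complex set \<times> complex set"

text \<open>
  Outside \<open>Flags\<close> the involutions are the identity, so that the relations between them hold without side
  conditions.
\<close>

definition s0 :: "flag \<Rightarrow> flag" where
  "s0 = (\<lambda>(v, e, f). if (v, e, f) \<in> Flags then (THE v'. v' \<noteq> v \<and> (v', e, f) \<in> Flags, e, f) else (v, e, f))"
definition s1 :: "flag \<Rightarrow> flag" where
  "s1 = (\<lambda>(v, e, f). if (v, e, f) \<in> Flags then (v, THE e'. e' \<noteq> e \<and> (v, e', f) \<in> Flags, f) else (v, e, f))"
definition s2 :: "flag \<Rightarrow> flag" where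
  "s2 = (\<lambda>(v, e, f). if (v, e, f) \<in> Flags then (v, e, THE f'. f' \<noteq> f \<and> (v, e, f') \<in> Flags) else (v, e, f))"

lemma s_outside: "x \<notin> Flags \<Longrightarrow> s0 x = x" "x \<notin> Flags \<Longrightarrow> s1 x = x" "x \<notin> Flags \<Longrightarrow> s2 x = x"
  by (cases x; simp add: s0_def s1_def s2_def)+

lemma s0_eq: assumes "(v, e, f) \<in> Flags" "v' \<noteq> v" "(v', e, f) \<in> Flags" shows "s0 (v, e, f) = (v', e, f)"
  using the1_equality[OF other_vertex[OF assms(1)], of v'] assms by (simp add: s0_def)
lemma s1_eq: assumes "(v, e, f) \<in> Flags" "e' \<noteq> e" "(v, e', f) \<in> Flags" shows "s1 (v, e, f) = (v, e', f)"
  using the1_equality[OF other_edge[OF assms(1)], of e'] assms by (simp add: s1_def)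
lemma s2_eq: assumes "(v, e, f) \<in> Flags" "f' \<noteq> f" "(v, e, f') \<in> Flags" shows "s2 (v, e, f) = (v, e, f')"
  using the1_equality[OF other_face[OF assms(1)], of f'] assms by (simp add: s2_def)

lemma s0_cases: assumes "(v, e, f) \<in> Flags" obtains v' where "v' \<noteq> v" "(v', e, f) \<in> Flags" "s0 (v, e, f) = (v', e, f)"
  using other_vertex[OF assms] s0_eq[OF assms] by metis
lemma s1_cases: assumes "(v, e, f) \<in> Flags" obtains e' where "e' \<noteq> e" "(v, e', f) \<in> Flags" "s1 (v, e, f) = (v, e', f)"
  using other_edge[OF assms] s1_eq[OF assms] by metis
lemma s2_cases: assumes "(v, e, f) \<in> Flags" obtains f' where "f' \<noteq> f" "(v, e, f') \<in> Flags" "s2 (v, e, f) = (v, e, f')"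
  using other_face[OF assms] s2_eq[OF assms] by metis

lemma s_closed: "x \<in> Flags \<Longrightarrow> s0 x \<in> Flags" "x \<in> Flags \<Longrightarrow> s1 x \<in> Flags" "x \<in> Flags \<Longrightarrow> s2 x \<in> Flags"
proof -
  obtain v e f where x: "x = (v, e, f)" by (cases x)
  show "s0 x \<in> Flags" if "x \<in> Flags" using s0_cases[of v e f] that unfolding x by metis
  show "s1 x \<in> Flags" if "x \<in> Flags" using s1_cases[of v e f] that unfolding x by metis
  show "s2 x \<in> Flags" if "x \<in> Flags" using s2_cases[of v e f] that unfolding x by metis
qed

lemma s_inv: "s0 (s0 x) = x" "s1 (s1 x) = x" "s2 (s2 x) = x"
proof -
  obtain v e f where x: "x = (v, e, f)" by (cases x)
  show "s0 (s0 x) = x"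
  proof (cases "x \<in> Flags")
    case True
    then obtain v' where "v' \<noteq> v" "(v', e, f) \<in> Flags" "s0 x = (v', e, f)" using s0_cases[of v e f] x by metis
    then show ?thesis using s0_eq[of v' e f v] True x by metis
  qed (simp add: s_outside)
  show "s1 (s1 x) = x"
  proof (cases "x \<in> Flags")
    case True
    then obtain e' where "e' \<noteq> e" "(v, e', f) \<in> Flags" "s1 x = (v, e', f)" using s1_cases[of v e f] x by metis
    then show ?thesis using s1_eq[of v e' f e] True x by metis
  qed (simp add: s_outside)
  show "s2 (s2 x) = x"
  proof (cases "x \<in> Flags")
    case True
    then obtain f' where "f' \<noteq> f" "(v, e, f') \<in> Flags" "s2 x = (v, e, f')" using s2_cases[of v e f] x by metis
    then show ?thesis using s2_eq[of v e f' f] True x by metis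
  qed (simp add: s_outside)
qed

lemma s_comm: "s2 (s0 x) = s0 (s2 x)"
proof (cases "x \<in> Flags")
  case True
  obtain v e f where x: "x = (v, e, f)" by (cases x)
  obtain v' where v': "v' \<noteq> v" "(v', e, f) \<in> Flags" "s0 x = (v', e, f)" using s0_cases[of v e f] True x by metis
  obtain f' where f': "f' \<noteq> f" "(v, e, f') \<in> Flags" "s2 x = (v, e, f')" using s2_cases[of v e f] True x by metis
  have "(v', e, f') \<in> Flags" using FlagsD[OF v'(2)] FlagsD[OF f'(2)] by (intro FlagsI)
  then show ?thesis using s2_eq[OF v'(2) f'(1)] s0_eq[OF f'(2) v'(1)] v'(3) f'(3) by simp
qed (simp add: s_outside)

text \<open>
  Each of the three edges at a vertex lies on two faces, and each face at the vertex contains two of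
  the edges. The only graph on three nodes that allows this is a triangle: if two edges shared both
  their faces, the faces of the third edge would contain no further edge.
\<close>

lemma vertex_cycle:
  assumes x: "(v, e1, f) \<in> Flags"
  obtains e2 e3 g k where "e1 \<noteq> e2" "e1 \<noteq> e3" "e2 \<noteq> e3" "f \<noteq> g" "f \<noteq> k" "g \<noteq> k"
    "(v, e2, f) \<in> Flags" "(v, e2, g) \<in> Flags" "(v, e3, g) \<in> Flags" "(v, e3, k) \<in> Flags" "(v, e1, k) \<in> Flags"
    "{e \<in> E. v \<in> closure e} = {e1, e2, e3}"
proof -
  note d = FlagsD[OF x]
  let ?I = "\<lambda>e f. (v, e, f) \<in> Flags"
  let ?S = "{e \<in> E. v \<in> closure e}"
  have uf: "f'' = g \<or> f'' = g'" if "?I e g" "?I e g'" "g \<noteq> g'" "?I e f''" for e g g' f''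
    using other_face that by blast
  have ue: "e'' = a \<or> e'' = b" if "?I a f" "?I b f" "a \<noteq> b" "?I e'' f" for f a b e''
    using other_edge that by blast
  have fin: "finite ?S" using degree[OF d(1)] by (metis card.infinite zero_neq_numeral)
  obtain e2 where e2: "e2 \<noteq> e1" "?I e2 f" using other_edge[OF x] by blast
  obtain g where g: "g \<noteq> f" "?I e2 g" using other_face[OF e2(2)] by blast
  obtain e3 where e3: "e3 \<noteq> e2" "?I e3 g" using other_edge[OF g(2)] by blast
  obtain k where k: "k \<noteq> f" "?I e1 k" using other_face[OF x] by blast
  obtain e' where e': "e' \<noteq> e1" "?I e' k" using other_edge[OF k(2)] by blast
  \<comment> \<open>Any third edge at the vertex completes \<open>e1\<close> and \<open>e2\<close> to the list of all three.\<close>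
  have E3: "?S = {e1, e2, c}" if "c \<in> ?S" "c \<noteq> e1" "c \<noteq> e2" for c
  proof -
    have "{e1, e2, c} \<subseteq> ?S" using FlagsD[OF x] FlagsD[OF e2(2)] that(1) by blast
    moreover have "card {e1, e2, c} = 3" using e2(1) that(2,3) by auto
    ultimately show ?thesis
      by (intro card_subset_eq[OF fin, symmetric]) (simp_all only: degree[OF d(1)])
  qed
  have inS: "e \<in> ?S" if "?I e h" for e h using FlagsD[OF that] by blast
  have e31: "e3 \<noteq> e1"
  proof
    assume "e3 = e1"
    then have "?I e1 g" using e3 by simp
    have "\<not> ?S \<subseteq> {e1, e2}"
    proof
      assume "?S \<subseteq> {e1, e2}"
      then have "card ?S \<le> card {e1, e2}" by (rule card_mono[rotated]) simp
      then show False using degree[OF d(1)] e2(1) by simp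
    qed
    then obtain c where c: "c \<in> ?S" "c \<noteq> e1" "c \<noteq> e2" by blast
    then obtain b where "b \<in> F" "c \<subseteq> closure b" using edge_some_face[of c] by blast
    then have cb: "?I c b" using c d(1) by (intro FlagsI) auto
    obtain a where a: "a \<noteq> c" "?I a b" using other_edge[OF cb] by blast
    then have "a = e1 \<or> a = e2" using E3[OF c] inS[OF a(2)] by blast
    then have "b = f \<or> b = g" using uf[OF x \<open>?I e1 g\<close> g(1)[symmetric]] uf[OF e2(2) g(2) g(1)[symmetric]] a(2) by blast
    then show False using ue[OF x e2(2) e2(1)[symmetric]] ue[OF \<open>?I e1 g\<close> g(2) e2(1)[symmetric]] cb c(2,3) by blast
  qed
  have S: "?S = {e1, e2, e3}" using E3[OF inS[OF e3(2)] e31 e3(1)] .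
  have kg: "k \<noteq> g" using ue[OF g(2) e3(2) e3(1)[symmetric]] k(2) e2(1) e31 by blast
  have "e' = e2 \<or> e' = e3" using inS[OF e'(2)] e'(1) unfolding S by blast
  moreover have "e' \<noteq> e2" using uf[OF e2(2) g(2) g(1)[symmetric], of k] e'(2) k(1) kg by blast
  ultimately have "?I e3 k" using e'(2) by blast
  show thesis
    by (rule that[of e2 e3 g k, OF e2(1)[symmetric] e31[symmetric] e3(1)[symmetric] g(1)[symmetric]
          k(1)[symmetric] kg[symmetric] e2(2) g(2) e3(2) \<open>?I e3 k\<close> k(2) S])
qed

lemma vertex_walk:
  assumes x: "x \<in> Flags"
  obtains v e1 e2 e3 f g k where "x = (v, e1, f)" "e1 \<noteq> e2" "e1 \<noteq> e3" "e2 \<noteq> e3" "f \<noteq> g" "f \<noteq> k" "g \<noteq> k"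
    "s1 x = (v, e2, f)" "s2 (s1 x) = (v, e2, g)" "s1 (s2 (s1 x)) = (v, e3, g)"
    "s2 (s1 (s2 (s1 x))) = (v, e3, k)" "s1 (s2 (s1 (s2 (s1 x)))) = (v, e1, k)" "s2 x = (v, e1, k)"
    "\<And>e h. (v, e, h) \<in> Flags \<Longrightarrow> (v, e, h) \<in> {(v, e1, f), (v, e2, f), (v, e2, g), (v, e3, g), (v, e3, k), (v, e1, k)}"
proof -
  obtain v e1 f where xe: "x = (v, e1, f)" by (cases x)
  obtain e2 e3 g k where c: "e1 \<noteq> e2" "e1 \<noteq> e3" "e2 \<noteq> e3" "f \<noteq> g" "f \<noteq> k" "g \<noteq> k"
    "(v, e2, f) \<in> Flags" "(v, e2, g) \<in> Flags" "(v, e3, g) \<in> Flags" "(v, e3, k) \<in> Flags" "(v, e1, k) \<in> Flags"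
    "{e \<in> E. v \<in> closure e} = {e1, e2, e3}"
    by (rule vertex_cycle[OF x[unfolded xe]], rule that)
  have s: "s1 x = (v, e2, f)" "s2 (v, e2, f) = (v, e2, g)" "s1 (v, e2, g) = (v, e3, g)"
    "s2 (v, e3, g) = (v, e3, k)" "s1 (v, e3, k) = (v, e1, k)" "s2 x = (v, e1, k)"
    using s1_eq[of v e1 f e2] s2_eq[of v e2 f g] s1_eq[of v e2 g e3] s2_eq[of v e3 g k] s1_eq[of v e3 k e1]
      s2_eq[of v e1 f k] c x xe by simp_all
  have "(v, e, h) \<in> {(v, e1, f), (v, e2, f), (v, e2, g), (v, e3, g), (v, e3, k), (v, e1, k)}"
    if eh: "(v, e, h) \<in> Flags" for e h
  proof -
    have "e \<in> {e1, e2, e3}" using FlagsD[OF eh] c(12) by blast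
    then consider "e = e1" | "e = e2" | "e = e3" by blast
    then show ?thesis
    proof cases
      case 1
      then have "h = f \<or> h = k" using other_face[OF x[unfolded xe]] c(5,11) eh by blast
      then show ?thesis unfolding 1 by blast
    next
      case 2
      then have "h = f \<or> h = g" using other_face[OF c(7)] c(4,8) eh by blast
      then show ?thesis unfolding 2 by blast
    next
      case 3
      then have "h = g \<or> h = k" using other_face[OF c(9)] c(6,10) eh by blast
      then show ?thesis unfolding 3 by blast
    qed
  qed
  moreover have "s2 (s1 x) = (v, e2, g)" "s1 (s2 (s1 x)) = (v, e3, g)"
    "s2 (s1 (s2 (s1 x))) = (v, e3, k)" "s1 (s2 (s1 (s2 (s1 x)))) = (v, e1, k)" using s by simp_all
  ultimately show thesis using that[OF xe c(1-6) s(1)] s(6) by blast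
qed

lemma s_braid: "s1 (s2 (s1 x)) = s2 (s1 (s2 x))"
proof (cases "x \<in> Flags")
  case True
  obtain v e1 e2 e3 f g k where "s2 (s1 (s2 (s1 x))) = (v, e3, k)" "s1 (s2 (s1 (s2 (s1 x)))) = (v, e1, k)" "s2 x = (v, e1, k)"
    by (rule vertex_walk[OF True], rule that)
  then have "s2 (s1 (s2 x)) = s2 (s1 (s1 (s2 (s1 (s2 (s1 x))))))" by simp
  then show ?thesis by (simp add: s_inv)
qed (simp add: s_outside)

definition face :: "flag \<Rightarrow> complex set" where "face x = snd (snd x)"

lemma face_inv: "face (s0 x) = face x" "face (s1 x) = face x"
proof -
  obtain v e f where x: "x = (v, e, f)" by (cases x)
  show "face (s0 x) = face x" "face (s1 x) = face x" by (simp_all add: x s0_def s1_def face_def)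
qed

lemma face_s2: assumes "x \<in> Flags" shows "face (s2 x) \<noteq> face x"
proof -
  obtain v e f where x: "x = (v, e, f)" by (cases x)
  obtain f' where "f' \<noteq> f" "s2 (v, e, f) = (v, e, f')" using s2_cases[OF assms[unfolded x]] by metis
  then show ?thesis by (simp add: x face_def)
qed

definition R :: "flag \<Rightarrow> flag" where "R x = s0 (s1 x)"

text \<open>
  Going around a face, \<open>s0\<close> and \<open>s1\<close> alternate between the two flags of each side; \<open>R\<close> moves one
  flag of every side forwards and the other one backwards.
\<close>

lemma chart_cycle:
  assumes c: "polygon_chart f k h h' v e" and f: "f \<in> F" and k: "3 \<le> k"
  defines "A \<equiv> \<lambda>i. (v i, e i, f)" and "B \<equiv> \<lambda>i. (v (Suc i), e i, f)"
  shows "A i \<in> Flags" "B i \<in> Flags" "s0 (A i) = B i" "s0 (B i) = A i" "s1 (B i) = A (Suc i)" "s1 (A (Suc i)) = B i"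
    "(R ^^ j) (B i) = B (i + j)" "(R ^^ j) (A (i + j)) = A i"
    "A i = A j \<longleftrightarrow> i mod k = j mod k" "B i = B j \<longleftrightarrow> i mod k = j mod k"
    "x \<in> Flags \<Longrightarrow> face x = f \<Longrightarrow> \<exists>i. x = A i \<or> x = B i" "A i \<noteq> B j"
proof -
  note c' = polygon_chartD[OF c] and fl = chart_flag[OF c f]
  have Suc: "Suc i mod k = Suc j mod k \<longleftrightarrow> i mod k = j mod k" for i j using k by (auto simp: mod_Suc split: if_splits)
  have ne: "Suc i mod k \<noteq> i mod k" for i using k by (simp add: mod_Suc)
  have AF: "A i \<in> Flags" and BF: "B i \<in> Flags" for i unfolding A_def B_def fl by blast+
  show "A i \<in> Flags" "B i \<in> Flags" by (rule AF BF)+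
  have vne: "v (Suc i) \<noteq> v i" and ene: "e (Suc i) \<noteq> e i" for i using ne c'(7,8) by metis+
  have sA: "s0 (A i) = B i" for i using s0_eq[OF AF[unfolded A_def] vne BF[unfolded B_def]] by (simp add: A_def B_def)
  show "s0 (A i) = B i" by (rule sA)
  then show "s0 (B i) = A i" using s_inv(1) by metis
  have sB: "s1 (B i) = A (Suc i)" for i using s1_eq[OF BF[unfolded B_def] ene AF[unfolded A_def]] by (simp add: A_def B_def)
  show "s1 (B i) = A (Suc i)" by (rule sB)
  have sA1: "s1 (A (Suc i)) = B i" for i using sB s_inv(2) by metis
  show "s1 (A (Suc i)) = B i" by (rule sA1)
  show "(R ^^ j) (B i) = B (i + j)" by (induction j) (simp_all add: R_def sA sB)
  show "(R ^^ j) (A (i + j)) = A i"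
  proof (induction j)
    case (Suc j)
    have "R (A (i + Suc j)) = A (i + j)" using sA[of "i + j"] s_inv(1) by (simp add: R_def sA1) metis
    then show ?case using Suc by (simp add: funpow_swap1 del: add_Suc_right)
  qed simp
  show "A i = A j \<longleftrightarrow> i mod k = j mod k" using c'(7,8) unfolding A_def by blast
  show "B i = B j \<longleftrightarrow> i mod k = j mod k" using c'(7,8) Suc unfolding B_def by blast
  show "\<exists>i. x = A i \<or> x = B i" if "x \<in> Flags" "face x = f"
    using that fl unfolding A_def B_def face_def by (cases x) auto
  show "A i \<noteq> B j"
  proof
    assume "A i = B j"
    then have "v i = v (Suc j)" "e i = e j" by (simp_all add: A_def B_def)
    then show False using c'(7)[of i "Suc j"] c'(8)[of i j] ne[of j] by simp
  qed
qed

lemma face_rotation: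
  assumes x: "x \<in> Flags" and k: "is_polygon V E k (face x)" "3 \<le> k"
  shows "(R ^^ k) x = x"
    and "\<And>j. \<lbrakk>0 < j; j < k\<rbrakk> \<Longrightarrow> (R ^^ j) x \<noteq> x"
    and "\<And>y. \<lbrakk>y \<in> Flags; face y = face x\<rbrakk> \<Longrightarrow> \<exists>j. y = (R ^^ j) x \<or> y = s0 ((R ^^ j) x)"
proof -
  have f: "face x \<in> F" using x FlagsD(3) by (cases x) (auto simp: face_def)
  obtain h h' v e where c: "polygon_chart (face x) k h h' v e" using polygon[OF f k] by blast
  note cyc = chart_cycle[OF c f k(2)]
  define A B where "A i = (v i, e i, face x)" and "B i = (v (Suc i), e i, face x)" for i
  note cyc = cyc[folded A_def B_def]
  have per: "A (i + k * m) = A i" "B (i + k * m) = B i" for i m using cyc(9)[of "i + k * m" i] cyc(10)[of "i + k * m" i] by simp_all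
  obtain i where i: "x = A i \<or> x = B i" using cyc(11)[OF x] by blast
  show "(R ^^ k) x = x"
    using i cyc(7)[of k i] cyc(8)[of k i] per[of i 1] by auto
  show "(R ^^ j) x \<noteq> x" if "0 < j" "j < k" for j
  proof -
    have ne: "(i + j) mod k \<noteq> i mod k"
    proof
      assume "(i + j) mod k = i mod k"
      then have "k dvd i + j - i" by (metis mod_eq_dvd_iff_nat le_add1)
      then show False using that by (simp add: nat_dvd_not_less)
    qed
    show ?thesis
    proof (cases "x = B i")
      case True
      then have "(R ^^ j) x = B (i + j)" using cyc(7) by simp
      then show ?thesis using True ne cyc(10) by metis
    next
      case False
      define l where "l = i + k - j"
      have l: "i + k * 1 = l + j" using that by (simp add: l_def)
      have "x = A (l + j)" using False i per(1)[of i 1] l by metis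
      then have "(R ^^ j) x = A l" using cyc(8) by simp
      moreover have "A l \<noteq> A (l + j)"
      proof
        assume "A l = A (l + j)"
        then have "k dvd l + j - l" using cyc(9) by (metis mod_eq_dvd_iff_nat le_add1)
        then show False using that by (simp add: nat_dvd_not_less)
      qed
      ultimately show ?thesis using \<open>x = A (l + j)\<close> by simp
    qed
  qed
  show "\<exists>j. y = (R ^^ j) x \<or> y = s0 ((R ^^ j) x)" if y: "y \<in> Flags" "face y = face x" for y
  proof -
    obtain l where l: "y = A l \<or> y = B l" using cyc(11)[OF y] by blast
    show ?thesis
    proof (cases "x = B i")
      case True
      have "1 * i \<le> k * i" using k(2) by (intro mult_right_mono) auto
      then have "l + k * i = i + (l + k * i - i)" by linarith
      then have "B l = (R ^^ (l + k * i - i)) x" using True cyc(7) per(2) by metis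
      then show ?thesis using l cyc(4)[of l] by metis
    next
      case False
      have "1 * l \<le> k * l" using k(2) by (intro mult_right_mono) auto
      then have "i + k * l = l + (i + k * l - l)" by linarith
      then have "A l = (R ^^ (i + k * l - l)) x" using False i cyc(8) per(1) by metis
      then show ?thesis using l cyc(3)[of l] by metis
    qed
  qed
qed

section \<open>The flags at a point of the plane\<close>

definition flags_at :: "complex \<Rightarrow> flag set" where
  "flags_at z = {(v, e, f). (v, e, f) \<in> Flags \<and> (z = v \<or> z \<in> e \<or> z \<in> f)}"

lemma at_Flags: "x \<in> flags_at z \<Longrightarrow> x \<in> Flags" by (auto simp: flags_at_def)

lemma at_vertex: "z \<in> V \<Longrightarrow> (v, e, f) \<in> flags_at z \<longleftrightarrow> (v, e, f) \<in> Flags \<and> v = z"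
  unfolding flags_at_def using vertex_not_in_edge vertex_not_in_face FlagsD by blast

lemma at_edge:
  assumes "e' \<in> E" "z \<in> e'" shows "(v, e, f) \<in> flags_at z \<longleftrightarrow> (v, e, f) \<in> Flags \<and> e = e'"
proof (cases "(v, e, f) \<in> Flags")
  case True
  have "z \<noteq> v" using vertex_not_in_edge[OF FlagsD(1)[OF True] assms(1)] assms(2) by blast
  moreover have "z \<notin> f" using edge_face_disjoint[OF assms(1) FlagsD(3)[OF True] assms(2)] .
  moreover have "z \<in> e \<longleftrightarrow> e = e'" using edges_disjoint[OF FlagsD(2)[OF True] assms(1) _ assms(2)] assms(2) by blast
  ultimately show ?thesis using True by (simp add: flags_at_def)
qed (simp add: flags_at_def)

lemma at_face:
  assumes "f' \<in> F" "z \<in> f'" shows "(v, e, f) \<in> flags_at z \<longleftrightarrow> (v, e, f) \<in> Flags \<and> f = f'"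
proof (cases "(v, e, f) \<in> Flags")
  case True
  have "z \<noteq> v" using vertex_not_in_face[OF FlagsD(1)[OF True] assms(1)] assms(2) by blast
  moreover have "z \<notin> e" using edge_face_disjoint[OF FlagsD(2)[OF True] assms(1)] assms(2) by blast
  moreover have "z \<in> f \<longleftrightarrow> f = f'" using faces_disjoint[OF FlagsD(3)[OF True] assms(1) _ assms(2)] assms(2) by blast
  ultimately show ?thesis using True by (simp add: flags_at_def)
qed (simp add: flags_at_def)

lemma flag_of_edge: assumes "e \<in> E" obtains v f where "(v, e, f) \<in> Flags"
proof -
  obtain p q where "p \<in> V" "closure e = e \<union> {p, q}" using edge_ends[OF assms] by metis
  moreover obtain f where "f \<in> F" "e \<subseteq> closure f" using edge_some_face[OF assms] by blast
  ultimately show thesis using that FlagsI[OF _ assms] by blast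
qed

lemma flag_of_vertex: assumes "v \<in> V" obtains e f where "(v, e, f) \<in> Flags"
proof -
  have "{e \<in> E. v \<in> closure e} \<noteq> {}" using degree[OF assms] by (metis card.empty zero_neq_numeral)
  then obtain e where e: "e \<in> E" "v \<in> closure e" by blast
  obtain f where "f \<in> F" "e \<subseteq> closure f" using edge_some_face[OF e(1)] by blast
  then show thesis using that FlagsI[OF assms e(1) _ e(2)] by blast
qed

lemma flag_of_face_vertex: assumes "f \<in> F" "v \<in> V" "v \<in> closure f" obtains e where "(v, e, f) \<in> Flags"
proof -
  obtain k where k: "3 \<le> k" "is_polygon V E k f" using face_polygon[OF assms(1)] by blast
  obtain h h' w d where c: "polygon_chart f k h h' w d" using polygon[OF assms(1) k(2,1)] by blast
  note c' = polygon_chartD[OF c]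
  have "v \<notin> d i" for i using vertex_not_in_edge[OF assms(2) c'(4)] .
  then obtain i where "v = w i" using assms vertex_not_in_face[OF assms(2,1)] unfolding c'(9) by blast
  then have "(v, d i, f) \<in> Flags" using chart_flag[OF c assms(1)] by blast
  then show thesis by (rule that)
qed

lemma flag_of_face: assumes "f \<in> F" obtains v e where "(v, e, f) \<in> Flags"
proof -
  obtain k where k: "3 \<le> k" "is_polygon V E k f" using face_polygon[OF assms(1)] by blast
  obtain h h' w d where c: "polygon_chart f k h h' w d" using polygon[OF assms(1) k(2,1)] by blast
  have "(w 0, d 0, f) \<in> Flags" using chart_flag[OF c assms(1)] by blast
  then show thesis by (rule that)
qed

text \<open>
  The face order of cells, expressed by points: \<open>z\<close> lies in the closure of the cell of \<open>z'\<close>. It holds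
  for all \<open>z'\<close> sufficiently close to \<open>z\<close>.
\<close>

definition below :: "complex \<Rightarrow> complex \<Rightarrow> bool" where
  "below z z' \<longleftrightarrow> (\<forall>c\<in>cells V E F. z' \<in> c \<longrightarrow> z \<in> closure c)"

lemma star_below: "z' \<in> star z \<Longrightarrow> below z z'"
  unfolding below_def using star(3) by blast

lemma at_nonempty: obtains x where "x \<in> flags_at z"
proof (cases z rule: point_cases)
  case 1 then show ?thesis using flag_of_vertex at_vertex that by metis
next
  case (2 e) then show ?thesis using flag_of_edge at_edge that by metis
next
  case (3 f) then show ?thesis using flag_of_face at_face that by metis
qed

lemma closure_edge: assumes "e \<in> E" "z \<in> closure e" shows "z \<in> e \<or> z \<in> V"
proof -
  obtain p q where pq: "p \<in> V" "q \<in> V" "closure e = e \<union> {p, q}" using edge_ends[OF assms(1)] by metis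
  then show ?thesis using assms(2) by auto
qed

lemma below_cases:
  assumes "below z z'"
  obtains (same) "flags_at z = flags_at z'"
  | (ve) e where "z \<in> V" "e \<in> E" "z' \<in> e" "z \<in> closure e"
  | (vf) f where "z \<in> V" "f \<in> F" "z' \<in> f" "z \<in> closure f"
  | (ef) e f where "e \<in> E" "f \<in> F" "z \<in> e" "z' \<in> f" "e \<subseteq> closure f"
proof (cases z' rule: point_cases)
  case 1
  then have "z \<in> closure {z'}" using assms cellsI unfolding below_def by blast
  then show ?thesis using same by simp
next
  case (2 e)
  then have cl: "z \<in> closure e" using assms cellsI unfolding below_def by blast
  show ?thesis
  proof (cases "z \<in> V")
    case True
    show ?thesis by (rule ve[OF True 2 cl])
  next
    case False
    then have "z \<in> e" using closure_edge[OF 2(1) cl] by blast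
    then have "flags_at z = flags_at z'" using at_edge[OF 2(1)] 2(2) by auto
    then show ?thesis by (rule same)
  qed
next
  case (3 f)
  then have cl: "z \<in> closure f" using assms cellsI unfolding below_def by blast
  show ?thesis
  proof (cases z rule: point_cases)
    case 1 show ?thesis by (rule vf[OF 1 3 cl])
  next
    case (2 e) show ?thesis by (rule ef[OF 2(1) 3(1) 2(2) 3(2) edge_subset_face[OF 2(1) 3(1) 2(2) cl]])
  next
    case (3 f')
    have "f' \<inter> f \<noteq> {}" using cl face_open[OF 3(1)] 3(2) closure_iff_nhds_not_empty by blast
    then have "f' = f" using faces_disjoint[OF 3(1) \<open>f \<in> F\<close>] by blast
    then have "flags_at z = flags_at z'" using at_face[OF 3(1)] 3(2) \<open>z' \<in> f\<close> by auto
    then show ?thesis by (rule same)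
  qed
qed

lemma common_flag2:
  assumes "below z z'" obtains x where "x \<in> flags_at z" "x \<in> flags_at z'"
  using assms
proof (cases rule: below_cases)
  case same then show ?thesis using at_nonempty[of z] that by auto
next
  case (ve e)
  obtain f where "f \<in> F" "e \<subseteq> closure f" using edge_some_face[OF ve(2)] by blast
  then have "(z, e, f) \<in> Flags" using FlagsI ve by blast
  then show ?thesis using that at_vertex[OF ve(1)] at_edge[OF ve(2,3)] by blast
next
  case (vf f)
  obtain e where "(z, e, f) \<in> Flags" using flag_of_face_vertex[OF vf(2,1,4)] by blast
  then show ?thesis using that at_vertex[OF vf(1)] at_face[OF vf(2,3)] by blast
next
  case (ef e f)
  obtain p q where "p \<in> V" "closure e = e \<union> {p, q}" using edge_ends[OF ef(1)] by metis
  then have "(p, e, f) \<in> Flags" using FlagsI ef by blast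
  then show ?thesis using that at_edge[OF ef(1,3)] at_face[OF ef(2,4)] by blast
qed

text \<open>
  The cells of the three points form a chain in the face order, and such a chain extends to a flag. This
  makes transport between nearby points coherent.
\<close>

lemma common_flag3:
  assumes "below z z'" "below z z''" "below z' z''" obtains x where "x \<in> flags_at z" "x \<in> flags_at z'" "x \<in> flags_at z''"
  using assms(1)
proof (cases rule: below_cases)
  case same then show ?thesis using common_flag2[OF assms(3)] that by auto
next
  case (ve e)
  from assms(3) show ?thesis
  proof (cases rule: below_cases)
    case same then show ?thesis using common_flag2[OF assms(2)] that by auto
  next
    case (ef e' f)
    then have "e' = e" using edges_disjoint ve by blast
    then have "(z, e, f) \<in> Flags" using FlagsI ve ef by blast
    then show ?thesis using that at_vertex[OF ve(1)] at_edge[OF ve(2,3)] at_face[OF ef(2,4)] by blast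
  qed (use vertex_not_in_edge ve in blast)+
next
  case (vf f)
  from assms(3) show ?thesis
  proof (cases rule: below_cases)
    case same then show ?thesis using common_flag2[OF assms(2)] that by auto
  qed (use vertex_not_in_face edge_face_disjoint vf in blast)+
next
  case (ef e f)
  from assms(3) show ?thesis
  proof (cases rule: below_cases)
    case same then show ?thesis using common_flag2[OF assms(2)] that by auto
  qed (use vertex_not_in_face edge_face_disjoint ef in blast)+
qed

lemma common_flags:
  assumes "below z z'" "x \<in> flags_at z" "x \<in> flags_at z'" "y \<in> flags_at z" "y \<in> flags_at z'"
  shows "flags_at z = flags_at z' \<or> y = x \<or> (\<exists>s\<in>{s0, s1, s2}. y = s x)"
  using assms(1)
proof (cases rule: below_cases)
  case (ve e)
  obtain f f' where *: "x = (z, e, f)" "y = (z, e, f')" "(z, e, f) \<in> Flags" "(z, e, f') \<in> Flags"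
    using assms(2-5) at_vertex[OF ve(1)] at_edge[OF ve(2,3)] by (cases x; cases y) auto
  then show ?thesis using s2_eq[OF *(3) _ *(4)] by (cases "f' = f") auto
next
  case (vf f)
  obtain e e' where *: "x = (z, e, f)" "y = (z, e', f)" "(z, e, f) \<in> Flags" "(z, e', f) \<in> Flags"
    using assms(2-5) at_vertex[OF vf(1)] at_face[OF vf(2,3)] by (cases x; cases y) auto
  then show ?thesis using s1_eq[OF *(3) _ *(4)] by (cases "e' = e") auto
next
  case (ef e f)
  obtain v v' where *: "x = (v, e, f)" "y = (v', e, f)" "(v, e, f) \<in> Flags" "(v', e, f) \<in> Flags"
    using assms(2-5) at_edge[OF ef(1,3)] at_face[OF ef(2,4)] by (cases x; cases y) auto
  then show ?thesis using s0_eq[OF *(3) _ *(4)] by (cases "v' = v") auto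
qed simp

lemma vertex_at_walk:
  assumes z: "z \<in> V" and x: "x \<in> flags_at z"
  shows "flags_at z = walk s1 s2 x ` {..<2 * 3}" "inj_on (walk s1 s2 x) {..<2 * 3}" "walk s1 s2 x (2 * 3) = x"
    "\<And>y. y \<in> flags_at z \<Longrightarrow> s0 y \<notin> flags_at z \<and> s1 y \<in> flags_at z \<and> s2 y \<in> flags_at z"
proof -
  obtain v e1 e2 e3 f g k where w: "x = (v, e1, f)" "e1 \<noteq> e2" "e1 \<noteq> e3" "e2 \<noteq> e3" "f \<noteq> g" "f \<noteq> k" "g \<noteq> k"
    "s1 x = (v, e2, f)" "s2 (s1 x) = (v, e2, g)" "s1 (s2 (s1 x)) = (v, e3, g)"
    "s2 (s1 (s2 (s1 x))) = (v, e3, k)" "s1 (s2 (s1 (s2 (s1 x)))) = (v, e1, k)" "s2 x = (v, e1, k)"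
    and cov: "\<And>e h. (v, e, h) \<in> Flags \<Longrightarrow> (v, e, h) \<in> {(v, e1, f), (v, e2, f), (v, e2, g), (v, e3, g), (v, e3, k), (v, e1, k)}"
    by (rule vertex_walk[OF at_Flags[OF x]], rule that)
  have vz: "v = z" using x w(1) at_vertex[OF z] by simp
  have six: "{..<2 * 3} = {0, 1, 2, 3, 4, 5::nat}" by auto
  note ws = walk.simps(1)[of s1 s2 x] walk_numeral[of s1 s2 x]
  have im: "walk s1 s2 x ` {..<2 * 3} = {(v, e1, f), (v, e2, f), (v, e2, g), (v, e3, g), (v, e3, k), (v, e1, k)}"
    unfolding six using w ws by simp
  have cl: "s0 y \<notin> flags_at z \<and> s1 y \<in> flags_at z \<and> s2 y \<in> flags_at z" if yz: "y \<in> flags_at z" for y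
  proof -
    obtain e h where y: "y = (z, e, h)" "(z, e, h) \<in> Flags" using yz at_vertex[OF z] by (cases y) auto
    obtain v' where v': "v' \<noteq> z" "s0 y = (v', e, h)" using s0_cases[OF y(2)] y(1) by metis
    obtain e' where e': "(z, e', h) \<in> Flags" "s1 y = (z, e', h)" using s1_cases[OF y(2)] y(1) by metis
    obtain h' where h': "(z, e, h') \<in> Flags" "s2 y = (z, e, h')" using s2_cases[OF y(2)] y(1) by metis
    show ?thesis using v' e' h' at_vertex[OF z] by simp
  qed
  then show "\<And>y. y \<in> flags_at z \<Longrightarrow> s0 y \<notin> flags_at z \<and> s1 y \<in> flags_at z \<and> s2 y \<in> flags_at z" .
  have "flags_at z \<subseteq> walk s1 s2 x ` {..<2 * 3}"
  proof
    fix y assume "y \<in> flags_at z"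
    then obtain e h where y: "y = (v, e, h)" "(v, e, h) \<in> Flags" using at_vertex[OF z] vz by (cases y) auto
    show "y \<in> walk s1 s2 x ` {..<2 * 3}" unfolding im y(1) by (rule cov[OF y(2)])
  qed
  moreover have "walk s1 s2 x i \<in> flags_at z" for i by (induction i) (use x cl in auto)
  ultimately show "flags_at z = walk s1 s2 x ` {..<2 * 3}" by blast
  show "inj_on (walk s1 s2 x) {..<2 * 3}" unfolding six using w ws by (auto simp: inj_on_def)
  have "walk s1 s2 x (2 * 3) = s2 (s1 (s2 (s1 (s2 (s1 x)))))" using ws by simp
  also have "\<dots> = s2 (s2 x)" using w by simp
  finally show "walk s1 s2 x (2 * 3) = x" by (simp add: s_inv)
qed

lemma edge_at_walk:
  assumes e: "e \<in> E" "z \<in> e" and x: "x \<in> flags_at z"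
  shows "flags_at z = walk s0 s2 x ` {..<2 * 2}" "inj_on (walk s0 s2 x) {..<2 * 2}" "walk s0 s2 x (2 * 2) = x"
    "\<And>y. y \<in> flags_at z \<Longrightarrow> s0 y \<in> flags_at z \<and> s1 y \<notin> flags_at z \<and> s2 y \<in> flags_at z"
proof -
  obtain v f where xv: "x = (v, e, f)" "(v, e, f) \<in> Flags" using x at_edge[OF e] by (cases x) auto
  obtain v' where v': "v' \<noteq> v" "(v', e, f) \<in> Flags" "s0 x = (v', e, f)" using s0_cases[OF xv(2)] xv(1) by metis
  obtain f' where f': "f' \<noteq> f" "(v', e, f') \<in> Flags" "s2 (s0 x) = (v', e, f')" using s2_cases[OF v'(2)] v'(3) by metis
  have vf: "(v, e, f') \<in> Flags" using FlagsD[OF xv(2)] FlagsD[OF f'(2)] by (intro FlagsI)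
  then have s3: "s0 (s2 (s0 x)) = (v, e, f')" using s0_eq[OF f'(2) v'(1)[symmetric]] f'(3) by simp
  have four: "{..<2 * 2} = {0, 1, 2, 3::nat}" by auto
  note ws = walk.simps(1)[of s0 s2 x] walk_numeral[of s0 s2 x]
  have im: "walk s0 s2 x ` {..<2 * 2} = {(v, e, f), (v', e, f), (v', e, f'), (v, e, f')}"
    unfolding four using xv v' f' s3 ws by simp
  have cl: "s0 y \<in> flags_at z \<and> s1 y \<notin> flags_at z \<and> s2 y \<in> flags_at z" if yz: "y \<in> flags_at z" for y
  proof -
    obtain u h where y: "y = (u, e, h)" "(u, e, h) \<in> Flags" using yz at_edge[OF e] by (cases y) auto
    obtain u' where u': "(u', e, h) \<in> Flags" "s0 y = (u', e, h)" using s0_cases[OF y(2)] y(1) by metis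
    obtain e' where e': "e' \<noteq> e" "s1 y = (u, e', h)" using s1_cases[OF y(2)] y(1) by metis
    obtain h' where h': "(u, e, h') \<in> Flags" "s2 y = (u, e, h')" using s2_cases[OF y(2)] y(1) by metis
    show ?thesis using u' e' h' at_edge[OF e] by simp
  qed
  then show "\<And>y. y \<in> flags_at z \<Longrightarrow> s0 y \<in> flags_at z \<and> s1 y \<notin> flags_at z \<and> s2 y \<in> flags_at z" .
  have "flags_at z \<subseteq> walk s0 s2 x ` {..<2 * 2}"
  proof
    fix y assume "y \<in> flags_at z"
    then obtain u h where y: "y = (u, e, h)" "(u, e, h) \<in> Flags" using at_edge[OF e] by (cases y) auto
    have "(v, e, h) \<in> Flags" using FlagsD[OF xv(2)] FlagsD[OF y(2)] by (intro FlagsI)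
    then have "h = f \<or> h = f'" using other_face[OF xv(2)] vf f'(1) by blast
    moreover have "(u, e, f) \<in> Flags" using FlagsD[OF xv(2)] FlagsD[OF y(2)] by (intro FlagsI)
    then have "u = v \<or> u = v'" using other_vertex[OF xv(2)] v' by blast
    ultimately show "y \<in> walk s0 s2 x ` {..<2 * 2}" unfolding im y(1) by blast
  qed
  moreover have "walk s0 s2 x i \<in> flags_at z" for i by (induction i) (use x cl in auto)
  ultimately show "flags_at z = walk s0 s2 x ` {..<2 * 2}" by blast
  show "inj_on (walk s0 s2 x) {..<2 * 2}" unfolding four using xv v' f' s3 ws by (auto simp: inj_on_def)
  have "walk s0 s2 x (2 * 2) = s2 (s0 (s2 (s0 x)))" using ws by simp
  then show "walk s0 s2 x (2 * 2) = x" by (simp add: s_inv s_comm)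
qed

lemma face_at_closed:
  assumes f: "f \<in> F" "z \<in> f" and y: "y \<in> flags_at z" shows "s0 y \<in> flags_at z \<and> s1 y \<in> flags_at z \<and> s2 y \<notin> flags_at z"
proof -
  obtain u e where y: "y = (u, e, f)" "(u, e, f) \<in> Flags" using y at_face[OF f] by (cases y) auto
  obtain u' where u': "(u', e, f) \<in> Flags" "s0 y = (u', e, f)" using s0_cases[OF y(2)] y(1) by metis
  obtain e' where e': "(u, e', f) \<in> Flags" "s1 y = (u, e', f)" using s1_cases[OF y(2)] y(1) by metis
  obtain f' where f': "f' \<noteq> f" "s2 y = (u, e, f')" using s2_cases[OF y(2)] y(1) by metis
  show ?thesis using u' e' f' at_face[OF f] by simp
qed

text \<open>
  Depending on the direction of the flag \<open>x\<close>, one of the two orders of the involutions runs through the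
  flags of the face by increasing index.
\<close>

lemma face_at_walk:
  assumes f: "f \<in> F" "z \<in> f" "is_polygon V E k f" "3 \<le> k" and x: "x \<in> flags_at z"
  obtains a b where "(a, b) = (s0, s1) \<or> (a, b) = (s1, s0)" "flags_at z = walk a b x ` {..<2 * k}"
    "inj_on (walk a b x) {..<2 * k}" "walk a b x (2 * k) = x"
proof -
  note result = that
  obtain h h' v e where c: "polygon_chart f k h h' v e" using polygon[OF f(1,3,4)] by blast
  note cyc = chart_cycle[OF c f(1,4)]
  define A B where "A i = (v i, e i, f)" and "B i = (v (Suc i), e i, f)" for i
  note cyc = cyc[folded A_def B_def]
  have xf: "x \<in> Flags" "face x = f" using x at_face[OF f(1,2)] by (cases x; auto simp: face_def)+
  obtain i where i: "x = A i \<or> x = B i" using cyc(11)[OF xf] by blast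
  have atf: "y \<in> flags_at z \<longleftrightarrow> y \<in> Flags \<and> face y = f" for y using at_face[OF f(1,2)] by (cases y) (auto simp: face_def)
  have mod_less: "j = j'" if "j < k" "j' < k" "(i + j) mod k = (i + j') mod k" for i j j'
  proof -
    have *: "j = j'" if "j \<le> j'" "j' < k" "(i + j) mod k = (i + j') mod k" for j j'
    proof -
      have "k dvd (i + j') - (i + j)" using that by (metis mod_eq_dvd_iff_nat add_le_cancel_left)
      then show ?thesis using that by (cases "j = j'") (auto simp: nat_dvd_not_less)
    qed
    show ?thesis using *[of j j'] *[of j' j] that by (metis nat_le_linear)
  qed
  have surj: "\<exists>j<k. l mod k = (i + j) mod k" for i l
  proof (intro exI[of _ "(l + k * i - i) mod k"] conjI)
    have "1 * i \<le> k * i" using f(4) by (intro mult_right_mono) auto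
    then have "i + (l + k * i - i) = l + k * i" by linarith
    then show "l mod k = (i + (l + k * i - i) mod k) mod k" by (simp add: mod_add_right_eq)
  qed (use f(4) in simp)
  have closed: "walk a b x j \<in> flags_at z" if "(a, b) = (s0, s1) \<or> (a, b) = (s1, s0)" for a b j
  proof (induction j)
    case (Suc j)
    show ?case using that face_at_closed[OF f(1,2) Suc] by auto
  qed (simp add: x)
  have fin: thesis if ab: "(a, b) = (s0, s1) \<or> (a, b) = (s1, s0)" and
    u: "\<And>j. walk a b x (2 * j) = C (i + j)" "\<And>j. walk a b x (Suc (2 * j)) = D (i + j)"
    and C: "\<And>i j. C i = C j \<longleftrightarrow> i mod k = j mod k" "\<And>i j. D i = D j \<longleftrightarrow> i mod k = j mod k" "\<And>i j. C i \<noteq> D j"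
    and cov: "\<And>y. y \<in> flags_at z \<Longrightarrow> \<exists>i. y = C i \<or> y = D i" for a b C D
  proof (rule result[OF ab])
    have "y \<in> walk a b x ` {..<2 * k}" if y: "y \<in> flags_at z" for y
    proof -
      obtain l where l: "y = C l \<or> y = D l" using cov[OF y] by blast
      obtain j where j: "j < k" "l mod k = (i + j) mod k" using surj by blast
      have "y = walk a b x (2 * j) \<or> y = walk a b x (Suc (2 * j))" using l C(1,2) j(2) u by metis
      moreover have "2 * j < 2 * k" "Suc (2 * j) < 2 * k" using j(1) by auto
      ultimately show ?thesis by blast
    qed
    then show "flags_at z = walk a b x ` {..<2 * k}" using closed[OF ab] by blast
    show "inj_on (walk a b x) {..<2 * k}"
    proof (rule inj_onI)
      fix p q assume pq: "p \<in> {..<2 * k}" "q \<in> {..<2 * k}" "walk a b x p = walk a b x q"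
      define p' q' where "p' = p div 2" and "q' = q div 2"
      have "p = 2 * p' \<or> p = Suc (2 * p')" "q = 2 * q' \<or> q = Suc (2 * q')" unfolding p'_def q'_def by presburger+
      moreover have "p' < k" "q' < k" using pq(1,2) unfolding p'_def q'_def by auto
      moreover have "p' = q'" if "C (i + p') = C (i + q') \<or> D (i + p') = D (i + q')"
        using that C(1,2) mod_less[OF \<open>p' < k\<close> \<open>q' < k\<close>] by blast
      moreover have "D (i + p') \<noteq> C (i + q')" using C(3) by metis
      ultimately show "p = q" using pq(3) u C(3) by (elim disjE) simp_all
    qed
    show "walk a b x (2 * k) = x" using u(1)[of k] u(1)[of 0] C(1)[of "i + k" i] by simp
  qed
  show thesis
  proof (cases "x = A i")
    case True
    have u: "walk s0 s1 x (2 * j) = A (i + j) \<and> walk s0 s1 x (Suc (2 * j)) = B (i + j)" for j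
      by (induction j) (use True cyc(3,5) in simp_all)
    show thesis by (rule fin[of s0 s1 A B]) (use u cyc(9,10,12) cyc(11) atf in blast)+
  next
    case False
    then have x: "x = B i" using i by simp
    have u: "walk s1 s0 x (2 * j) = B (i + j) \<and> walk s1 s0 x (Suc (2 * j)) = A (Suc (i + j))" for j
      by (induction j) (use x cyc(3,5) in simp_all)
    have "A (Suc i) = A (Suc j) \<longleftrightarrow> i mod k = j mod k" for i j
      unfolding cyc(9) using f(4) by (auto simp: mod_Suc split: if_splits)
    moreover have "\<exists>j. y = B j \<or> y = A (Suc j)" if yz: "y \<in> flags_at z" for y
    proof -
      obtain l where "y = A l \<or> y = B l" using cyc(11) yz atf by blast
      moreover have "A l = A (Suc (l + k - 1))" using cyc(9)[of l "Suc (l + k - 1)"] f(4) by simp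
      ultimately show ?thesis by metis
    qed
    ultimately show thesis
      by (intro fin[of s1 s0 B "\<lambda>i. A (Suc i)"]) (use u cyc(10,12) in \<open>blast | metis\<close>)+
  qed
qed

lemma face_image: "face ` Flags = F"
proof
  show "face ` Flags \<subseteq> F" using FlagsD(3) by (auto simp: face_def)
  show "F \<subseteq> face ` Flags"
  proof
    fix f assume "f \<in> F"
    then obtain v e where "(v, e, f) \<in> Flags" by (rule flag_of_face)
    then show "f \<in> face ` Flags" by (intro image_eqI[of _ _ "(v, e, f)"]) (simp_all add: face_def)
  qed
qed

lemma adjacent_iff:
  assumes f: "f \<in> F" "g \<in> F"
  shows "adjacent E f g \<longleftrightarrow> (\<exists>x\<in>Flags. face x = f \<and> face (s2 x) = g)"
proof
  assume "adjacent E f g"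
  then obtain e where e: "f \<noteq> g" "e \<in> E" "e \<subseteq> closure f" "e \<subseteq> closure g"
    unfolding adjacent_def frontier_def by blast
  obtain p q where p: "p \<in> V" "closure e = e \<union> {p, q}" using edge_ends[OF e(2)] by metis
  have *: "(p, e, f) \<in> Flags" "(p, e, g) \<in> Flags" using p e f by (auto intro!: FlagsI)
  then have "s2 (p, e, f) = (p, e, g)" using s2_eq e(1) by metis
  then show "\<exists>x\<in>Flags. face x = f \<and> face (s2 x) = g"
    using * by (intro bexI[of _ "(p, e, f)"]) (simp_all add: face_def)
next
  assume "\<exists>x\<in>Flags. face x = f \<and> face (s2 x) = g"
  then obtain v e where x: "(v, e, f) \<in> Flags" "face (s2 (v, e, f)) = g" by (auto simp: face_def)
  obtain g' where g': "g' \<noteq> f" "(v, e, g') \<in> Flags" "s2 (v, e, f) = (v, e, g')" using s2_cases[OF x(1)] by metis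
  then have g: "g' = g" using x(2) by (simp add: face_def)
  have "e \<subseteq> frontier h" if "(v, e, h) \<in> Flags" for h
  proof -
    note d = FlagsD[OF that]
    have "interior h = h" by (rule interior_open[OF face_open[OF d(3)]])
    then show ?thesis unfolding frontier_def using d(5) edge_face_disjoint[OF d(2,3)] by blast
  qed
  then show "adjacent E f g" unfolding adjacent_def using g' g x(1) FlagsD(2)[OF x(1)] by blast
qed

lemma flags_at_connected:
  assumes P: "\<And>x. \<lbrakk>x \<in> Flags; P x\<rbrakk> \<Longrightarrow> P (s0 x) \<and> P (s1 x) \<and> P (s2 x)"
    and x: "x \<in> flags_at z" "P x" and y: "y \<in> flags_at z"
  shows "P y"
proof -
  have walk: "P (walk a b x i) \<and> walk a b x i \<in> Flags" if "{a, b} \<subseteq> {s0, s1, s2}" for a b i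
  proof (induction i)
    case (Suc i)
    have "a \<in> {s0, s1, s2}" "b \<in> {s0, s1, s2}" using that by auto
    then show ?case using P[of "walk a b x i"] Suc s_closed[of "walk a b x i"] by auto
  qed (use x at_Flags in simp)
  show ?thesis
  proof (cases z rule: point_cases)
    case 1
    then have "y \<in> walk s1 s2 x ` {..<2 * 3}" using vertex_at_walk(1)[OF 1 x(1)] y by simp
    then show ?thesis using walk[of s1 s2] by auto
  next
    case (2 e)
    then have "y \<in> walk s0 s2 x ` {..<2 * 2}" using edge_at_walk(1)[OF 2 x(1)] y by simp
    then show ?thesis using walk[of s0 s2] by auto
  next
    case (3 f)
    obtain k where k: "3 \<le> k" "is_polygon V E k f" using face_polygon[OF 3(1)] by blast
    obtain a b where "(a, b) = (s0, s1) \<or> (a, b) = (s1, s0)" "flags_at z = walk a b x ` {..<2 * k}"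
      by (rule face_at_walk[OF 3 k(2,1) x(1)], rule that)
    then show ?thesis using walk[of a b] y by auto
  qed
qed

text \<open>
  The points all of whose flags satisfy \<open>P\<close> form an open and closed subset of the plane, because
  nearby points share a flag.
\<close>

lemma flags_connected:
  assumes P: "\<And>x. \<lbrakk>x \<in> Flags; P x\<rbrakk> \<Longrightarrow> P (s0 x) \<and> P (s1 x) \<and> P (s2 x)"
    and r: "r \<in> Flags" "P r" and x: "x \<in> Flags"
  shows "P x"
proof -
  define U where "U = {z. \<forall>x\<in>flags_at z. P x}"
  have same: "P x \<longleftrightarrow> P y" if "x \<in> flags_at z" "y \<in> flags_at z" for x y z
    using flags_at_connected[OF P] that by blast
  have star_same: "z' \<in> U \<longleftrightarrow> z \<in> U" if z': "z' \<in> star z" for z z'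
  proof -
    obtain x where x: "x \<in> flags_at z" "x \<in> flags_at z'" using common_flag2[OF star_below[OF z']] by blast
    have "z \<in> U \<longleftrightarrow> P x" "z' \<in> U \<longleftrightarrow> P x" unfolding U_def using same x by blast+
    then show ?thesis by simp
  qed
  have "open U" unfolding open_subopen[of U] using star_same star(1,2) by blast
  moreover have "open (- U)" unfolding open_subopen[of "- U"] using star_same star(1,2) by blast
  ultimately have "U = {} \<or> U = UNIV" using clopen[of U] by (simp add: closed_open)
  moreover have vert: "x \<in> flags_at (fst x)" if "x \<in> Flags" for x
    using that by (cases x) (auto simp: flags_at_def)
  have "fst r \<in> U" unfolding U_def using same vert[OF r(1)] r(2) by blast
  ultimately have "fst x \<in> U" by blast
  then show ?thesis unfolding U_def using vert[OF x] by blast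
qed

end

section \<open>Developing the lattice around the odd face\<close>

text \<open>
  The target of a development is a set of states with involutions that satisfy the relations of
  the regular hexagonal lattice; one of them is that six turns in a face are trivial. The
  central state \<open>c0\<close> is fixed by a turn; this makes it possible to assign states to the flags of the odd
  face, whatever the number of its sides.
\<close>

locale developing = odd_lattice V E F f0
  for V :: "complex set" and E F :: "complex set set" and f0 :: "complex set" +
  fixes t0 t1 t2 :: "'t \<Rightarrow> 't" and c0 :: 't
  assumes t_inv: "t0 (t0 s) = s" "t1 (t1 s) = s" "t2 (t2 s) = s"
    and t_comm: "t2 (t0 s) = t0 (t2 s)"
    and t_braid: "t1 (t2 (t1 s)) = t2 (t1 (t2 s))"
    and t_hex: "walk t0 t1 s 12 = s" "walk t1 t0 s 12 = s"
    and c0: "t1 c0 = t0 c0"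
begin

text \<open>
  The fibre over \<open>z\<close> consists of the developments of the flags at \<open>z\<close>. The value
  \<open>undefined\<close> elsewhere makes such a function determined by its values at these flags.
\<close>

definition states :: "complex \<Rightarrow> (flag \<Rightarrow> 't) set" where
  "states z = {g. (\<forall>x\<in>flags_at z. (s0 x \<in> flags_at z \<longrightarrow> g (s0 x) = t0 (g x)) \<and>
      (s1 x \<in> flags_at z \<longrightarrow> g (s1 x) = t1 (g x)) \<and> (s2 x \<in> flags_at z \<longrightarrow> g (s2 x) = t2 (g x))) \<and>
    (\<forall>x. x \<notin> flags_at z \<longrightarrow> g x = undefined)}"

lemma states_s: assumes "g \<in> states z" "x \<in> flags_at z"
  shows "s0 x \<in> flags_at z \<Longrightarrow> g (s0 x) = t0 (g x)" "s1 x \<in> flags_at z \<Longrightarrow> g (s1 x) = t1 (g x)"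
    "s2 x \<in> flags_at z \<Longrightarrow> g (s2 x) = t2 (g x)"
  using assms unfolding states_def by blast+

lemma states_outside: "\<lbrakk>g \<in> states z; x \<notin> flags_at z\<rbrakk> \<Longrightarrow> g x = undefined"
  unfolding states_def by blast

lemma states_ext: "\<lbrakk>g \<in> states z; g' \<in> states z'; flags_at z = flags_at z'; \<And>x. x \<in> flags_at z \<Longrightarrow> g x = g' x\<rbrakk> \<Longrightarrow> g = g'"
  by (rule ext) (metis states_outside)

lemma states_cong: "flags_at z = flags_at z' \<Longrightarrow> states z = states z'"
  by (simp add: states_def)

text \<open>
  The flags at a point form a dihedral cycle of length 6, 4 or 12, and the relations in the
  target close up the walks of these lengths. For the odd face this fails, and it is excluded.
\<close>

lemma states_unique:
  assumes z: "z \<notin> f0" and x: "x \<in> flags_at z" shows "\<exists>!g. g \<in> states z \<and> g x = \<tau>"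
proof (cases z rule: point_cases)
  case 1
  note w = vertex_at_walk[OF 1 x]
  have "g \<in> states z \<and> g x = \<tau> \<longleftrightarrow> (\<forall>y\<in>flags_at z. g (s1 y) = t1 (g y) \<and> g (s2 y) = t2 (g y)) \<and>
      (\<forall>y. y \<notin> flags_at z \<longrightarrow> g y = undefined) \<and> g x = \<tau>" for g
    unfolding states_def using w(4) by auto
  moreover have "walk t1 t2 \<tau> (2 * 3) = \<tau>" using walk_numeral[of t1 t2 \<tau>] by (simp add: t_braid t_inv del: walk.simps)
  ultimately show ?thesis
    using dihedral_extension[OF s_inv(2,3) t_inv(2,3) w(1,2) _ w(3)] by simp
next
  case (2 e)
  note w = edge_at_walk[OF 2 x]
  have "g \<in> states z \<and> g x = \<tau> \<longleftrightarrow> (\<forall>y\<in>flags_at z. g (s0 y) = t0 (g y) \<and> g (s2 y) = t2 (g y)) \<and>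
      (\<forall>y. y \<notin> flags_at z \<longrightarrow> g y = undefined) \<and> g x = \<tau>" for g
    unfolding states_def using w(4) by auto
  moreover have "walk t0 t2 \<tau> (2 * 2) = \<tau>" using walk_numeral[of t0 t2 \<tau>] by (simp add: t_comm t_inv del: walk.simps)
  ultimately show ?thesis
    using dihedral_extension[OF s_inv(1,3) t_inv(1,3) w(1,2) _ w(3)] by simp
next
  case (3 f)
  then have f: "f \<noteq> f0" using z by blast
  have k: "is_polygon V E 6 f" using hexagons[OF 3(1) f] .
  note cl = face_at_closed[OF 3]
  obtain a b where ab: "(a, b) = (s0, s1) \<or> (a, b) = (s1, s0)" "flags_at z = walk a b x ` {..<2 * 6}"
      "inj_on (walk a b x) {..<2 * 6}" "walk a b x (2 * 6) = x"
    by (rule face_at_walk[OF 3 k _ x], simp, rule that)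
  have st: "g \<in> states z \<and> g x = \<tau> \<longleftrightarrow> (\<forall>y\<in>flags_at z. g (s0 y) = t0 (g y) \<and> g (s1 y) = t1 (g y)) \<and>
      (\<forall>y. y \<notin> flags_at z \<longrightarrow> g y = undefined) \<and> g x = \<tau>" for g
    unfolding states_def using cl by auto
  have h: "walk t0 t1 \<tau> (2 * 6) = \<tau>" "walk t1 t0 \<tau> (2 * 6) = \<tau>" using t_hex by simp_all
  from ab(1) show ?thesis
  proof
    assume "(a, b) = (s0, s1)"
    then have w: "flags_at z = walk s0 s1 x ` {..<2 * 6}" "inj_on (walk s0 s1 x) {..<2 * 6}" "walk s0 s1 x (2 * 6) = x"
      using ab by simp_all
    show ?thesis unfolding st
      by (rule dihedral_extension[OF s_inv(1,2) t_inv(1,2) w(1,2) _ w(3) h(1)]) simp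
  next
    assume "(a, b) = (s1, s0)"
    then have w: "flags_at z = walk s1 s0 x ` {..<2 * 6}" "inj_on (walk s1 s0 x) {..<2 * 6}" "walk s1 s0 x (2 * 6) = x"
      using ab by simp_all
    have st': "g \<in> states z \<and> g x = \<tau> \<longleftrightarrow> (\<forall>y\<in>flags_at z. g (s1 y) = t1 (g y) \<and> g (s0 y) = t0 (g y)) \<and>
      (\<forall>y. y \<notin> flags_at z \<longrightarrow> g y = undefined) \<and> g x = \<tau>" for g
      unfolding st by blast
    show ?thesis unfolding st'
      by (rule dihedral_extension[OF s_inv(2,1) t_inv(2,1) w(1,2) _ w(3) h(2)]) simp
  qed
qed

lemma states_agree:
  assumes z: "below z z'" "z \<notin> f0" and g: "g \<in> states z" "g' \<in> states z'"
    and x: "x \<in> flags_at z" "x \<in> flags_at z'" "g x = g' x" and y: "y \<in> flags_at z" "y \<in> flags_at z'"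
  shows "g y = g' y"
proof -
  consider "flags_at z = flags_at z'" | "y = x" | "y = s0 x" | "y = s1 x" | "y = s2 x"
    using common_flags[OF z(1) x(1,2) y] by blast
  then show ?thesis
  proof cases
    case 1
    then have "g' \<in> states z" using g(2) states_cong by blast
    then have "g = g'" using states_unique[OF z(2) x(1)] g(1) x(3) by blast
    then show ?thesis by simp
  next
    case 2 then show ?thesis using x by simp
  next
    case 3 then show ?thesis using states_s(1)[OF g(1) x(1)] states_s(1)[OF g(2) x(2)] x(3) y by simp
  next
    case 4 then show ?thesis using states_s(2)[OF g(1) x(1)] states_s(2)[OF g(2) x(2)] x(3) y by simp
  next
    case 5 then show ?thesis using states_s(3)[OF g(1) x(1)] states_s(3)[OF g(2) x(2)] x(3) y by simp
  qed
qed

definition agree :: "complex \<Rightarrow> complex \<Rightarrow> (flag \<Rightarrow> 't) \<Rightarrow> (flag \<Rightarrow> 't) \<Rightarrow> bool" where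
  "agree z z' g g' \<longleftrightarrow> (\<forall>x\<in>flags_at z \<inter> flags_at z'. g x = g' x)"

text \<open>
  Transport is agreement on common flags. A common flag exists for nearby points and determines the
  state on both sides.
\<close>

lemma locally_constant_states:
  assumes cont: "continuous_on UNIV \<rho>" and off: "\<And>w. \<rho> w \<notin> f0"
  shows "locally_constant (\<lambda>w. states (\<rho> w)) (\<lambda>w w'. agree (\<rho> w) (\<rho> w')) (\<lambda>w. \<rho> -` star (\<rho> w))"
proof
  show "open (\<rho> -` star (\<rho> w))" for w using open_vimage[OF star(1) cont] .
  show "w \<in> \<rho> -` star (\<rho> w)" for w using star(2) by simp
  show "agree (\<rho> w) (\<rho> w) x x" for w x by (simp add: agree_def)
next
  fix w w' g assume w: "w' \<in> \<rho> -` star (\<rho> w)" and g: "g \<in> states (\<rho> w)"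
  have b: "below (\<rho> w) (\<rho> w')" using w star_below by simp
  obtain x where x: "x \<in> flags_at (\<rho> w)" "x \<in> flags_at (\<rho> w')" using common_flag2[OF b] by blast
  have "g' \<in> states (\<rho> w') \<and> agree (\<rho> w) (\<rho> w') g g' \<longleftrightarrow> g' \<in> states (\<rho> w') \<and> g' x = g x" for g'
    using states_agree[OF b off g _ x] x unfolding agree_def by fastforce
  then show "\<exists>!g'. g' \<in> states (\<rho> w') \<and> agree (\<rho> w) (\<rho> w') g g'" using states_unique[OF off x(2)] by simp
next
  fix w w' g assume w: "w' \<in> \<rho> -` star (\<rho> w)" and g: "g \<in> states (\<rho> w')"
  have b: "below (\<rho> w) (\<rho> w')" using w star_below by simp
  obtain x where x: "x \<in> flags_at (\<rho> w)" "x \<in> flags_at (\<rho> w')" using common_flag2[OF b] by blast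
  have "g' \<in> states (\<rho> w) \<and> agree (\<rho> w) (\<rho> w') g' g \<longleftrightarrow> g' \<in> states (\<rho> w) \<and> g' x = g x" for g'
    using states_agree[OF b off _ g x] x unfolding agree_def by blast
  then show "\<exists>!g'. g' \<in> states (\<rho> w) \<and> agree (\<rho> w) (\<rho> w') g' g" using states_unique[OF off x(1)] by simp
next
  fix w w' w'' g g' g''
  assume w: "w' \<in> \<rho> -` star (\<rho> w)" "w'' \<in> \<rho> -` star (\<rho> w)" "w'' \<in> \<rho> -` star (\<rho> w')"
    and g: "g \<in> states (\<rho> w)" "g' \<in> states (\<rho> w')" "g'' \<in> states (\<rho> w'')"
    and a: "agree (\<rho> w) (\<rho> w') g g'" "agree (\<rho> w) (\<rho> w'') g g''"
  have b: "below (\<rho> w) (\<rho> w')" "below (\<rho> w) (\<rho> w'')" "below (\<rho> w') (\<rho> w'')" using w star_below by simp_all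
  obtain x where x: "x \<in> flags_at (\<rho> w)" "x \<in> flags_at (\<rho> w')" "x \<in> flags_at (\<rho> w'')" using common_flag3[OF b] by blast
  have "g' x = g'' x" using a x unfolding agree_def by (metis IntI)
  then show "agree (\<rho> w') (\<rho> w'') g' g''"
    using states_agree[OF b(3) off g(2,3) x(2,3)] unfolding agree_def by blast
qed

definition chart0 where
  "chart0 = (SOME (k, h, h', v, e). odd k \<and> 3 \<le> k \<and> is_polygon V E k f0 \<and> polygon_chart f0 k h h' v e)"

definition "n0 = fst chart0"
definition "h0 = fst (snd chart0)"
definition "h0' = fst (snd (snd chart0))"
definition "v0 = fst (snd (snd (snd chart0)))"
definition "e0 = snd (snd (snd (snd chart0)))"
definition "o0 = h0 0"

lemma chart0: "odd n0" "3 \<le> n0" "is_polygon V E n0 f0" "polygon_chart f0 n0 h0 h0' v0 e0"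
proof -
  obtain k where k: "odd k" "3 \<le> k" "is_polygon V E k f0" using odd_face(2) by blast
  obtain h h' v e where "polygon_chart f0 k h h' v e" using polygon[OF odd_face(1) k(3,2)] by blast
  then have "case (k, h, h', v, e) of (k, h, h', v, e) \<Rightarrow>
      odd k \<and> 3 \<le> k \<and> is_polygon V E k f0 \<and> polygon_chart f0 k h h' v e" using k by simp
  from someI[where P = "\<lambda>(k, h, h', v, e). odd k \<and> 3 \<le> k \<and> is_polygon V E k f0 \<and> polygon_chart f0 k h h' v e", OF this]
  have "odd n0 \<and> 3 \<le> n0 \<and> is_polygon V E n0 f0 \<and> polygon_chart f0 n0 h0 h0' v0 e0"
    unfolding chart0_def[symmetric] n0_def h0_def h0'_def v0_def e0_def by (simp add: case_prod_beta)
  then show "odd n0" "3 \<le> n0" "is_polygon V E n0 f0" "polygon_chart f0 n0 h0 h0' v0 e0" by auto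
qed

lemmas chart0D = polygon_chartD[OF chart0(4)]
lemmas homeo0 = homeoD[OF chart0D(1)]

lemma o0: "o0 \<in> f0" using chart0D(2) by (force simp: o0_def)

lemma h0'_o0: "h0' o0 = 0" using homeo0(3)[of 0] by (simp add: o0_def)

lemma h0'_nonzero: "\<lbrakk>z \<in> closure f0; z \<noteq> o0\<rbrakk> \<Longrightarrow> h0' z \<noteq> 0"
  using homeo0(4)[of z] by (auto simp: o0_def)

lemma h0'_norm: assumes "z \<in> closure f0" "z \<notin> f0" shows "norm (h0' z) = 1"
proof -
  have "h0' z \<notin> ball 0 1" using homeo0(4)[OF assms(1)] chart0D(2) assms(2) by (metis imageI)
  then show ?thesis using homeo0(6)[OF assms(1)] by simp
qed

lemma h0_sphere: assumes "norm u = 1" shows "h0 u \<in> closure f0" "h0 u \<notin> f0"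
proof -
  have u: "u \<in> cball 0 1" using assms by simp
  show "h0 u \<in> closure f0" by (rule homeo0(5)[OF u])
  show "h0 u \<notin> f0"
  proof
    assume "h0 u \<in> f0"
    then obtain u' where u': "u' \<in> ball 0 1" "h0 u = h0 u'" using chart0D(2) by (metis imageE)
    have "u = h0' (h0 u)" by (rule homeo0(3)[OF u, symmetric])
    also have "\<dots> = h0' (h0 u')" by (simp only: u'(2))
    also have "\<dots> = u'" by (rule homeo0(3)) (use u'(1) in auto)
    finally have "u = u'" .
    then show False using assms u' by simp
  qed
qed

text \<open>
  The radial retraction of the plane without the centre \<open>o0\<close> of the odd face onto the complement of
  that face.
\<close>

definition retr :: "complex \<Rightarrow> complex" where
  "retr z = (if z \<in> closure f0 then h0 (sgn (h0' z)) else z)"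

lemma retr_off: "z \<noteq> o0 \<Longrightarrow> retr z \<notin> f0"
proof -
  assume z: "z \<noteq> o0"
  show ?thesis
  proof (cases "z \<in> closure f0")
    case True
    then have "norm (sgn (h0' z)) = 1" using h0'_nonzero[OF True z] by (simp add: norm_sgn)
    then show ?thesis using h0_sphere(2) True by (simp add: retr_def)
  next
    case False then show ?thesis using closure_subset[of f0] by (auto simp: retr_def)
  qed
qed

lemma retr_id: assumes "z \<notin> f0" shows "retr z = z"
proof (cases "z \<in> closure f0")
  case True
  then have "sgn (h0' z) = h0' z" using h0'_norm[OF True assms] by (simp add: sgn_div_norm)
  then show ?thesis using True homeo0(4) by (simp add: retr_def)
qed (simp add: retr_def)

lemma retr_closure: "\<lbrakk>z \<in> closure f0; z \<noteq> o0\<rbrakk> \<Longrightarrow> retr z \<in> closure f0"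
  using h0_sphere(1)[of "sgn (h0' z)"] h0'_nonzero[of z] by (simp add: retr_def norm_sgn)

lemma retr_continuous: "continuous_on (- {o0}) retr"
proof -
  let ?S = "closure f0 - {o0}" and ?T = "- f0"
  have un: "- {o0} = ?S \<union> ?T" using o0 closure_subset[of f0] by blast
  have "?S = (- {o0}) \<inter> closure f0" "?T = (- {o0}) \<inter> - f0" using o0 by auto
  then have cl: "closedin (top_of_set (?S \<union> ?T)) ?S" "closedin (top_of_set (?S \<union> ?T)) ?T"
    unfolding un[symmetric] using closedin_closed_Int[of "closure f0" "- {o0}"]
      closedin_closed_Int[of "- f0" "- {o0}"] face_open[OF odd_face(1)] by (simp_all add: closed_Compl)
  have fixed: "h0 (sgn (h0' z)) = z" if "z \<in> closure f0" "z \<notin> f0" for z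
    using retr_id[OF that(2)] that(1) by (simp add: retr_def)
  have "continuous_on ?S (\<lambda>z. h0 (sgn (h0' z)))"
  proof (rule continuous_on_compose2[OF homeo0(1)])
    show "continuous_on ?S (\<lambda>z. sgn (h0' z))"
      by (intro continuous_on_sgn continuous_on_subset[OF homeo0(2)]) (use h0'_nonzero in auto)
    show "(\<lambda>z. sgn (h0' z)) ` ?S \<subseteq> cball 0 1" by (auto simp: norm_sgn split: if_splits)
  qed
  then have "continuous_on (?S \<union> ?T) (\<lambda>z. if z \<in> closure f0 then h0 (sgn (h0' z)) else z)"
    by (intro continuous_on_cases_local[OF cl] continuous_on_id)
       (use fixed in auto)
  then show ?thesis unfolding un retr_def[abs_def] .
qed

text \<open>
  The universal covering of the complement of the odd face, up to homotopy: the exponential map covers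
  the plane without \<open>o0\<close>, which retracts onto the complement.
\<close>

definition \<rho> :: "complex \<Rightarrow> complex" where "\<rho> w = retr (o0 + exp w)"

lemma \<rho>_continuous: "continuous_on UNIV \<rho>"
  unfolding \<rho>_def by (intro continuous_on_compose2[OF retr_continuous] continuous_intros) auto

lemma \<rho>_off: "\<rho> w \<notin> f0" unfolding \<rho>_def by (rule retr_off) simp

lemma \<rho>_period: "\<rho> (w + 2 * of_int k * pi * \<i>) = \<rho> w"
proof -
  have "exp (w + 2 * of_int k * pi * \<i>) = exp w"
    using exp_eq[of "w + 2 * of_int k * pi * \<i>" w] by (auto intro!: exI[of _ k])
  then show ?thesis by (simp add: \<rho>_def)
qed

lemma \<rho>_surj: assumes "z \<notin> f0" shows "o0 + exp (Ln (z - o0)) = z" "\<rho> (Ln (z - o0)) = z"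
proof -
  have "z \<noteq> o0" using assms o0 by blast
  then show "o0 + exp (Ln (z - o0)) = z" by (simp add: exp_Ln)
  then show "\<rho> (Ln (z - o0)) = z" using retr_id[OF assms] by (simp add: \<rho>_def)
qed

sublocale L: locally_constant "\<lambda>w. states (\<rho> w)" "\<lambda>w w'. agree (\<rho> w) (\<rho> w')" "\<lambda>w. \<rho> -` star (\<rho> w)"
  by (rule locally_constant_states[OF \<rho>_continuous \<rho>_off])

definition B0 :: "nat \<Rightarrow> flag" where "B0 i = (v0 (Suc i), e0 i, f0)"

text \<open>
  The development of the flags of the odd face: one flag of each side gets the central state, the
  other one its mirror image. It is equivariant because a turn fixes the central state.
\<close>

definition K :: "flag \<Rightarrow> 't" where "K x = (if x \<in> range B0 then c0 else t0 c0)"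

lemmas cycle0 = chart_cycle[OF chart0(4) odd_face(1) chart0(2), folded B0_def]

lemma K_s: assumes "x \<in> Flags" "face x = f0" shows "K (s0 x) = t0 (K x)" "K (s1 x) = t1 (K x)"
proof -
  have A: "(v0 i, e0 i, f0) \<notin> range B0" for i using cycle0(12) by blast
  have t1c: "t1 (t0 c0) = c0" using t_inv(2) c0 by metis
  have "K (B0 i) = c0" "K (v0 i, e0 i, f0) = t0 c0" for i using A by (auto simp: K_def)
  note KK = this
  obtain i where i: "x = (v0 i, e0 i, f0) \<or> x = B0 i" using cycle0(11)[OF assms] by blast
  show "K (s0 x) = t0 (K x)" using i cycle0(3,4)[of i] KK[of i] t_inv(1) by auto
  show "K (s1 x) = t1 (K x)"
  proof (cases "x = B0 i")
    case True then show ?thesis using cycle0(5)[of i] KK c0 by simp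
  next
    case False
    then have x: "x = (v0 i, e0 i, f0)" using i by blast
    also have "\<dots> = (v0 (Suc (i + n0 - 1)), e0 (Suc (i + n0 - 1)), f0)"
      using cycle0(9)[of i "Suc (i + n0 - 1)"] chart0(2) by simp
    finally have "s1 x = B0 (i + n0 - 1)" using cycle0(6)[of "i + n0 - 1"] by simp
    then show ?thesis using KK x t1c by simp
  qed
qed

lemma below_o0: "z \<in> closure f0 \<Longrightarrow> below z o0"
  unfolding below_def using cells_disjoint cellsI(3)[OF odd_face(1)] o0 by metis

lemma at_o0: "x \<in> flags_at o0 \<longleftrightarrow> x \<in> Flags \<and> face x = f0"
  using at_face[OF odd_face(1) o0] by (cases x) (simp add: face_def)

definition central :: "complex \<Rightarrow> (flag \<Rightarrow> 't) \<Rightarrow> bool" where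
  "central z g \<longleftrightarrow> g \<in> states z \<and> (\<forall>x\<in>flags_at z \<inter> flags_at o0. g x = K x)"

text \<open>
  At a boundary point of the odd face the common flags with the centre of that face are related by
  one of the involutions around it, for which \<open>K\<close> is equivariant.
\<close>

lemma central_ex1: assumes z: "z \<in> closure f0" "z \<notin> f0" shows "\<exists>!g. central z g"
proof -
  note b = below_o0[OF z(1)]
  obtain x where x: "x \<in> flags_at z" "x \<in> flags_at o0" using common_flag2[OF b] by blast
  have ne: "flags_at z \<noteq> flags_at o0"
  proof
    assume eq: "flags_at z = flags_at o0"
    have "s2 x \<notin> flags_at o0" using face_at_closed[OF odd_face(1) o0 x(2)] by blast
    then have no: "s2 x \<notin> flags_at z" using eq by simp
    show False
    proof (cases z rule: point_cases)
      case 1 then show False using vertex_at_walk(4)[OF 1 x(1) x(1)] no by blast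
    next
      case (2 e) then show False using edge_at_walk(4)[OF 2 x(1) x(1)] no by blast
    next
      case (3 f)
      have "f = f0" using x at_face[OF 3] at_o0 by (cases x) (auto simp: face_def)
      then show False using 3 z by blast
    qed
  qed
  obtain g where g: "g \<in> states z" "g x = K x" using states_unique[OF z(2) x(1)] by blast
  have "g y = K y" if y: "y \<in> flags_at z" "y \<in> flags_at o0" for y
  proof -
    have y0: "x \<in> Flags" "face x = f0" using x(2) at_o0 by auto
    consider "y = x" | "y = s0 x" | "y = s1 x" | "y = s2 x"
      using common_flags[OF b x y] ne by blast
    then show ?thesis
    proof cases
      case 2 then show ?thesis using states_s(1)[OF g(1) x(1)] y K_s(1)[OF y0] g(2) by simp
    next
      case 3 then show ?thesis using states_s(2)[OF g(1) x(1)] y K_s(2)[OF y0] g(2) by simp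
    next
      case 4
      then show ?thesis using y(2) face_at_closed[OF odd_face(1) o0 x(2)] by blast
    qed (use g in simp)
  qed
  then have "central z g" using g(1) by (simp add: central_def)
  moreover have "g' = g" if "central z g'" for g'
    using that states_unique[OF z(2) x(1)] g x unfolding central_def by blast
  ultimately show ?thesis by blast
qed

text \<open>
  The section of central states over the points that \<open>\<rho>\<close> maps to the boundary of the odd face.
\<close>

definition T :: "complex \<Rightarrow> flag \<Rightarrow> 't" where "T w = (THE g. central (\<rho> w) g)"

lemma T: assumes "\<rho> w \<in> closure f0" shows "central (\<rho> w) (T w)"
  unfolding T_def by (rule theI'[OF central_ex1[OF assms \<rho>_off]])

lemma \<rho>_closure: "\<rho> w \<in> closure f0 \<longleftrightarrow> o0 + exp w \<in> closure f0"
proof (cases "o0 + exp w \<in> f0")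
  case True
  then have "o0 + exp w \<in> closure f0" using closure_subset by blast
  then show ?thesis using retr_closure[of "o0 + exp w"] by (simp add: \<rho>_def)
next
  case False then show ?thesis using retr_id[OF False] by (simp add: \<rho>_def)
qed

lemma flat_T: "L.flat {w. \<rho> w \<in> closure f0} T"
  unfolding L.flat_def
proof (intro ballI conjI)
  fix w assume "w \<in> {w. \<rho> w \<in> closure f0}"
  then have w: "\<rho> w \<in> closure f0" by simp
  note c = T[OF w]
  show "T w \<in> states (\<rho> w)" using c by (simp add: central_def)
  have "\<forall>\<^sub>F w' in nhds w. w' \<in> \<rho> -` star (\<rho> w)" using L.N eventually_nhds by blast
  then show "\<forall>\<^sub>F w' in nhds w. w' \<in> {w. \<rho> w \<in> closure f0} \<longrightarrow> agree (\<rho> w) (\<rho> w') (T w) (T w')"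
  proof eventually_elim
    case (elim w')
    show ?case
    proof
      assume "w' \<in> {w. \<rho> w \<in> closure f0}"
      then have w': "\<rho> w' \<in> closure f0" by simp
      note c' = T[OF w']
      have b: "below (\<rho> w) (\<rho> w')" using elim star_below by simp
      obtain x where x: "x \<in> flags_at (\<rho> w)" "x \<in> flags_at (\<rho> w')" "x \<in> flags_at o0"
        using common_flag3[OF b below_o0[OF w] below_o0[OF w']] by blast
      have "T w x = T w' x" using c c' x by (simp add: central_def)
      then show "agree (\<rho> w) (\<rho> w') (T w) (T w')"
        using states_agree[OF b \<rho>_off _ _ x(1,2)] c c' by (auto simp: agree_def central_def)
    qed
  qed
qed

lemma far_left: obtains m where "\<And>w. Re w < m \<Longrightarrow> o0 + exp w \<in> f0"
proof -
  obtain r where r: "r > 0" "ball o0 r \<subseteq> f0" using face_open[OF odd_face(1)] o0 open_contains_ball by blast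
  have "o0 + exp w \<in> f0" if "Re w < ln r" for w
  proof -
    have "exp (Re w) < r" using that r(1) by (metis exp_less_mono exp_ln)
    then show ?thesis using r(2) by (auto simp: dist_norm)
  qed
  then show thesis by (rule that)
qed

lemma section_exists:
  obtains G m where "L.flat UNIV G" "\<And>w. Re w < m \<Longrightarrow> G w = T w" "\<And>w. Re w < m \<Longrightarrow> o0 + exp w \<in> f0"
proof -
  obtain m where m: "\<And>w. Re w < m \<Longrightarrow> o0 + exp w \<in> f0" using far_left by blast
  define w0 :: complex where "w0 = of_real (m - 1)"
  have cl: "\<rho> w \<in> closure f0" if "Re w < m" for w unfolding \<rho>_closure using m[OF that] closure_subset[of f0] by blast
  have w0: "Re w0 < m" by (simp add: w0_def)
  have "T w0 \<in> states (\<rho> w0)" using T[OF cl[OF w0]] by (simp add: central_def)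
  then obtain G where G: "L.flat UNIV G" "G w0 = T w0" by (rule L.flat_section)
  have conv: "connected {w. Re w < m}" by (intro convex_connected convex_halfspace_Re_lt)
  have "G w = T w" if "Re w < m" for w
    by (rule L.flat_unique[OF conv L.flat_subset[OF G(1)] L.flat_subset[OF flat_T], of w0])
       (use G(2) w0 that cl in auto)
  then show thesis using that G(1) m by blast
qed

lemma log_unique:
  assumes "o0 + exp w = o0 + exp w'" obtains k :: int where "w = w' + 2 * of_int k * pi * \<i>"
proof -
  have "exp w = exp w'" using assms by simp
  then obtain k :: int where "w = w' + (of_int (2 * k) * pi) * \<i>" unfolding exp_eq by blast
  then show thesis using that[of k] by simp
qed

text \<open>
  A section that is central on a left half-plane has period \<open>2 * pi * \<i>\<close>: its translate is another
  section, and the two agree on the half-plane because the central states depend only on the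
  image under \<open>\<rho>\<close>. A face other than the odd one is a disc that does not contain \<open>o0\<close>, so it
  lifts to the plane and the section is constant on the lift; by periodicity it is the same on all lifts. So
  the section assigns one state to each flag of the lattice. Equivariance can be read off at points of edges
  and at vertices, where the fibre involves both faces of an edge or all edges at a vertex.
\<close>

theorem development:
  obtains \<Sigma> where "\<And>x. x \<in> Flags \<Longrightarrow> \<Sigma> (s0 x) = t0 (\<Sigma> x)" "\<And>x. x \<in> Flags \<Longrightarrow> \<Sigma> (s1 x) = t1 (\<Sigma> x)"
    "\<And>x. x \<in> Flags \<Longrightarrow> \<Sigma> (s2 x) = t2 (\<Sigma> x)" "\<Sigma> (B0 0) = c0"
proof -
  obtain G m where G: "L.flat UNIV G" "\<And>w. Re w < m \<Longrightarrow> G w = T w" "\<And>w. Re w < m \<Longrightarrow> o0 + exp w \<in> f0"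
    by (rule section_exists, rule that)
  have st: "G w \<in> states (\<rho> w)" and ev: "\<forall>\<^sub>F w' in nhds w. agree (\<rho> w) (\<rho> w') (G w) (G w')" for w
    using L.flatD[OF G(1), of w] by auto
  define c :: complex where "c = 2 * pi * \<i>"
  have \<rho>c: "\<rho> (w + c) = \<rho> w" for w using \<rho>_period[of w 1] by (simp add: c_def)
  have "L.flat UNIV (\<lambda>w. G (w + c))"
    unfolding L.flat_def
  proof (intro ballI conjI)
    fix w
    show "G (w + c) \<in> states (\<rho> w)" using st[of "w + c"] \<rho>c by simp
    have "filterlim (\<lambda>w'. w' + c) (nhds (w + c)) (nhds w)" by (intro tendsto_intros filterlim_ident)
    from eventually_compose_filterlim[OF ev[of "w + c"] this]
    show "\<forall>\<^sub>F w' in nhds w. w' \<in> UNIV \<longrightarrow> agree (\<rho> w) (\<rho> w') (G (w + c)) (G (w' + c))"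
      by (simp add: \<rho>c)
  qed
  moreover define w0 :: complex where "w0 = of_real (m - 1)"
  have "G (w0 + c) = G w0" using G(2)[of w0] G(2)[of "w0 + c"] \<rho>c[of w0] by (simp add: w0_def c_def T_def)
  ultimately have per1: "G (w + c) = G w" for w
    using L.flat_unique[OF connected_UNIV, of "\<lambda>w. G (w + c)" G w0 w] G(1) by simp
  have pern: "G (w + of_nat k * c) = G w" for w k
  proof (induction k)
    case (Suc k)
    have "G (w + of_nat (Suc k) * c) = G (w + of_nat k * c + c)" by (simp add: algebra_simps)
    then show ?case using per1 Suc by simp
  qed simp
  have per: "G (w + 2 * of_int k * pi * \<i>) = G w" for w and k :: int
  proof (cases "0 \<le> k")
    case True
    then show ?thesis using pern[of w "nat k"] by (simp add: c_def mult_ac)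
  next
    case False
    then show ?thesis using pern[of "w + 2 * of_int k * pi * \<i>" "nat (- k)"] by (simp add: c_def mult_ac)
  qed
  have const: "G (\<phi> a) = G (\<phi> b)" if S: "connected S" "continuous_on S \<phi>" "a \<in> S" "b \<in> S"
    and A: "\<And>s. s \<in> S \<Longrightarrow> flags_at (\<rho> (\<phi> s)) = A" for S :: "'s::topological_space set" and \<phi> a b A
  proof (rule connected_local_const[OF S(1,3,4)], intro ballI)
    fix s assume s: "s \<in> S"
    have "filterlim \<phi> (nhds (\<phi> s)) (at s within S)" using S(2) s unfolding continuous_on_def by blast
    from eventually_compose_filterlim[OF ev this]
    have "\<forall>\<^sub>F b in at s within S. agree (\<rho> (\<phi> s)) (\<rho> (\<phi> b)) (G (\<phi> s)) (G (\<phi> b))" .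
    moreover have "\<forall>\<^sub>F b in at s within S. b \<in> S" by (simp add: eventually_at_filter)
    ultimately show "\<forall>\<^sub>F b in at s within S. G (\<phi> s) = G (\<phi> b)"
    proof eventually_elim
      case (elim b)
      show ?case
        by (rule states_ext[OF st st]) (use elim A s in \<open>auto simp: agree_def\<close>)
    qed
  qed
  \<comment> \<open>Points over the odd face are joined to the left half-plane by a lift of the radius, along which \<open>\<rho>\<close> is constant.\<close>
  have central: "G w = T w" if w: "\<rho> w \<in> closure f0" for w
  proof -
    define u where "u = h0' (o0 + exp w)"
    have z: "o0 + exp w \<in> closure f0" using w unfolding \<rho>_closure .
    have u: "u \<noteq> 0" "norm u \<le> 1" "h0 u = o0 + exp w"
      using h0'_nonzero[OF z] homeo0(6)[OF z] homeo0(4)[OF z] by (simp_all add: u_def)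
    have su: "s *\<^sub>R u \<in> cball 0 1" if "s \<in> {0<..1}" for s :: real
      using that u(2) by (simp add: mult_le_one)
    have ne: "h0 (s *\<^sub>R u) - o0 \<noteq> 0" if "s \<in> {0<..1}" for s :: real
    proof
      assume "h0 (s *\<^sub>R u) - o0 = 0"
      then have "h0' (h0 (s *\<^sub>R u)) = h0' o0" by simp
      then show False using homeo0(3)[OF su[OF that]] h0'_o0 u(1) that by simp
    qed
    have cont: "continuous_on {0<..1::real} (\<lambda>s. h0 (s *\<^sub>R u) - o0)"
      by (intro continuous_intros continuous_on_compose2[OF homeo0(1)]) (use su in auto)
    have "contractible {0<..1::real}" by (intro convex_imp_contractible) simp
    then obtain \<nu> where \<nu>: "continuous_on {0<..1} \<nu>" "\<And>s. s \<in> {0<..1::real} \<Longrightarrow> h0 (s *\<^sub>R u) - o0 = exp (\<nu> s)"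
      using continuous_logarithm_on_contractible[OF cont _ ne] by blast
    have \<nu>\<rho>: "\<rho> (\<nu> s) = h0 (sgn u)" if s: "s \<in> {0<..1}" for s
    proof -
      have "o0 + exp (\<nu> s) = h0 (s *\<^sub>R u)" using \<nu>(2)[OF s] by (simp add: algebra_simps)
      moreover have "h0 (s *\<^sub>R u) \<in> closure f0" by (rule homeo0(5)[OF su[OF s]])
      moreover have "sgn (s *\<^sub>R u) = sgn u" using s by (simp add: sgn_scaleR)
      ultimately show ?thesis using homeo0(3)[OF su[OF s]] by (simp add: \<rho>_def retr_def)
    qed
    have one: "(1::real) \<in> {0<..1}" by simp
    have "o0 + exp w = o0 + exp (\<nu> 1)" using \<nu>(2)[OF one] u(3) by simp
    then obtain k :: int where k: "w = \<nu> 1 + 2 * of_int k * pi * \<i>" using log_unique by blast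
    have "((\<lambda>s. h0 (s *\<^sub>R u)) \<longlongrightarrow> h0 (0 *\<^sub>R u)) (at 0 within {0..1::real})"
    proof -
      have "continuous_on {0..1::real} (\<lambda>s. h0 (s *\<^sub>R u))"
        by (intro continuous_on_compose2[OF homeo0(1)] continuous_intros) (use u(2) in \<open>auto simp: mult_le_one\<close>)
      then show ?thesis unfolding continuous_on_def by (rule bspec) simp
    qed
    then have "((\<lambda>s. norm (h0 (s *\<^sub>R u) - o0)) \<longlongrightarrow> norm (h0 (0 *\<^sub>R u) - o0)) (at 0 within {0..1::real})"
      by (intro tendsto_intros)
    then have "\<forall>\<^sub>F s in at 0 within {0..1::real}. norm (h0 (s *\<^sub>R u) - o0) < exp m"
      by (rule order_tendstoD(2)) (simp add: o0_def)
    then obtain d where d: "d > 0" "\<And>s. s \<in> {0..1} \<Longrightarrow> s \<noteq> 0 \<Longrightarrow> dist s 0 < d \<Longrightarrow> norm (h0 (s *\<^sub>R u) - o0) < exp m"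
      unfolding eventually_at by blast
    define s where "s = min 1 (d / 2)"
    have s: "s \<in> {0<..1}" "norm (h0 (s *\<^sub>R u) - o0) < exp m" using d(1) d(2)[of s] by (auto simp: s_def)
    have "exp (Re (\<nu> s)) < exp m" using s(2) \<nu>(2)[OF s(1)] by simp
    then have "Re (\<nu> s) < m" by simp
    then have "G (\<nu> s) = T (\<nu> s)" by (rule G(2))
    moreover have "G (\<nu> 1) = G (\<nu> s)"
      by (rule const[OF _ \<nu>(1) one s(1)]) (use \<nu>\<rho> in auto)
    moreover have "T w = T (\<nu> s)" using \<nu>\<rho>[OF one] \<nu>\<rho>[OF s(1)] k \<rho>_period by (simp add: T_def)
    ultimately show ?thesis using k per by simp
  qed
  have over_face: "G w = G w'" if f: "f \<in> F" "f \<noteq> f0" and w: "\<rho> w \<in> f" "\<rho> w' \<in> f" for f w w'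
  proof -
    have dis: "f \<inter> closure f0 = {}"
      using open_Int_closure_eq_empty[OF face_open[OF f(1)], of f0] faces_disjoint[OF f(1) odd_face(1)] f(2) by blast
    obtain k where k: "3 \<le> k" "is_polygon V E k f" using face_polygon[OF f(1)] by blast
    obtain h h' v e where "polygon_chart f k h h' v e" using polygon[OF f(1) k(2,1)] by blast
    note ch = polygon_chartD[OF this] and hm = homeoD[OF polygon_chartD(1)[OF this]]
    have hf: "h u \<in> f" if "u \<in> ball 0 1" for u using ch(2) that by blast
    have ne: "h u - o0 \<noteq> 0" if "u \<in> ball 0 1" for u
      using hf[OF that] dis o0 closure_subset[of f0] by auto
    have cont: "continuous_on (ball 0 1) (\<lambda>u. h u - o0)"
      by (intro continuous_intros continuous_on_subset[OF hm(1)] ball_subset_cball)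
    have "contractible (ball (0::complex) 1)" by (intro convex_imp_contractible) simp
    then obtain \<nu> where \<nu>: "continuous_on (ball 0 1) \<nu>" "\<And>u. u \<in> ball 0 1 \<Longrightarrow> h u - o0 = exp (\<nu> u)"
      using continuous_logarithm_on_contractible[OF cont _ ne] by blast
    have \<nu>\<rho>: "\<rho> (\<nu> u) \<in> f" if u: "u \<in> ball 0 1" for u
    proof -
      have "o0 + exp (\<nu> u) = h u" using \<nu>(2)[OF u] by (simp add: algebra_simps)
      moreover have "h u \<notin> closure f0" using hf[OF u] dis by blast
      ultimately show ?thesis using hf[OF u] by (simp add: \<rho>_def retr_def)
    qed
    have fl: "flags_at z = {x \<in> Flags. face x = f}" if "z \<in> f" for z
      using at_face[OF f(1) that] by (auto simp: face_def)
    have "G w = G (\<nu> 0)" if w: "\<rho> w \<in> f" for w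
    proof -
      have "o0 + exp w \<notin> closure f0" using w dis \<rho>_closure by blast
      then have "\<rho> w = o0 + exp w" by (simp add: \<rho>_def retr_def)
      moreover obtain u where u: "u \<in> ball 0 1" "\<rho> w = h u" using ch(2) w by blast
      ultimately have "o0 + exp w = o0 + exp (\<nu> u)" using \<nu>(2)[OF u(1)] by (simp add: algebra_simps)
      then obtain k :: int where k: "w = \<nu> u + 2 * of_int k * pi * \<i>" using log_unique by blast
      have "G (\<nu> u) = G (\<nu> 0)"
        by (rule const[OF _ \<nu>(1) u(1)]) (use fl \<nu>\<rho> in auto)
      then show ?thesis using k per by simp
    qed
    then show ?thesis using w by metis
  qed
  define \<Sigma> where "\<Sigma> x = (if face x = f0 then K x else G (SOME w. \<rho> w \<in> face x) x)" for x
  have G\<Sigma>: "G w x = \<Sigma> x" if x: "x \<in> flags_at (\<rho> w)" for w x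
  proof -
    have xF: "x \<in> Flags" using at_Flags[OF x] .
    obtain v e f where xe: "x = (v, e, f)" by (cases x)
    note d = FlagsD[OF xF[unfolded xe]]
    have "\<rho> w = v \<or> \<rho> w \<in> e \<or> \<rho> w \<in> f" using x by (simp add: xe flags_at_def)
    then have cl: "\<rho> w \<in> closure f" using d(5,6) closure_subset[of f] by auto
    show ?thesis
    proof (cases "f = f0")
      case True
      then have "\<rho> w \<in> closure f0" using cl by simp
      then have "central (\<rho> w) (G w)" using central T by simp
      moreover have "x \<in> flags_at o0" using at_o0 xF xe True by (simp add: face_def)
      ultimately have "G w x = K x" using x by (simp add: central_def)
      then show ?thesis using True xe by (simp add: \<Sigma>_def face_def)
    next
      case False
      define z where "z = \<rho> w"
      have zf: "z \<notin> f0" using \<rho>_off by (simp add: z_def)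
      have zo: "z - o0 \<noteq> 0" using zf o0 by auto
      \<comment> \<open>Where \<open>\<rho>\<close> collapses radii, pass to the end of the radius: the section does not change, and \<open>\<rho>\<close> is a local homeomorphism towards the outside there.\<close>
      obtain w1 where w1: "o0 + exp w1 = z" "G w1 = G w"
      proof (cases "o0 + exp w \<in> f0")
        case True
        let ?w = "Ln (z - o0)"
        have r: "\<rho> ?w = z" "o0 + exp ?w = z" using \<rho>_surj[OF zf] by simp_all
        have "z \<in> closure f0" using True closure_subset[of f0] \<rho>_closure[of w] by (auto simp: z_def)
        then have "G ?w = T ?w" "G w = T w" using central r by (simp_all add: z_def)
        then show ?thesis using that[of ?w] r by (simp add: T_def z_def)
      next
        case False
        then have "o0 + exp w = z" using retr_id by (simp add: z_def \<rho>_def)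
        then show ?thesis using that by blast
      qed
      have \<rho>w1: "\<rho> w1 = z" using w1(1) retr_id[OF zf] by (simp add: \<rho>_def)
      \<comment> \<open>A local inverse of \<open>\<rho>\<close> that follows points of the face \<open>f\<close> close to \<open>z\<close>.\<close>
      define l where "l z' = w1 + Ln ((z' - o0) / (z - o0))" for z'
      have "isCont l z" unfolding l_def using zo by (intro continuous_intros) auto
      then have "filterlim l (nhds (l z)) (nhds z)" by (simp add: isCont_def tendsto_at_iff_tendsto_nhds)
      moreover have lz: "l z = w1" using zo by (simp add: l_def)
      ultimately have "filterlim l (nhds w1) (nhds z)" by simp
      from eventually_compose_filterlim[OF ev this]
      have "\<forall>\<^sub>F z' in nhds z. agree z (\<rho> (l z')) (G w) (G (l z'))" by (simp add: \<rho>w1 w1(2))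
      then obtain N where N: "open N" "z \<in> N" "\<And>z'. z' \<in> N \<Longrightarrow> agree z (\<rho> (l z')) (G w) (G (l z'))"
        unfolding eventually_nhds by blast
      obtain z' where z': "z' \<in> f" "z' \<in> N" using cl N(1,2) closure_iff_nhds_not_empty[of z f] unfolding z_def[symmetric] by blast
      have z'0: "z' \<notin> f0" using faces_disjoint[OF d(3) odd_face(1) z'(1)] False by blast
      then have z'o: "z' - o0 \<noteq> 0" using o0 by auto
      have "exp (l z') = (z - o0) * ((z' - o0) / (z - o0))"
        using w1(1) z'o zo by (simp add: l_def exp_add exp_Ln flip: w1(1))
      then have "o0 + exp (l z') = z'" using zo by simp
      then have \<rho>l: "\<rho> (l z') = z'" using retr_id[OF z'0] by (simp add: \<rho>_def)
      have "x \<in> flags_at z'" using at_face[OF d(3) z'(1)] xF xe by simp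
      then have "G w x = G (l z') x" using N(3)[OF z'(2)] x by (simp add: agree_def \<rho>l z_def)
      also have "G (l z') = G (SOME w. \<rho> w \<in> f)"
        by (rule over_face[OF d(3) False]) (use \<rho>l z'(1) someI[of "\<lambda>w. \<rho> w \<in> f" "l z'"] in auto)
      finally show ?thesis using False xe by (simp add: \<Sigma>_def face_def)
    qed
  qed
  show thesis
  proof (rule that[of \<Sigma>])
    fix x assume x: "x \<in> Flags"
    obtain v e f where xe: "x = (v, e, f)" by (cases x)
    note d = FlagsD[OF x[unfolded xe]]
    obtain z where z: "z \<in> e" using edge_nonempty[OF d(2)] by blast
    have z0: "z \<notin> f0" using edge_face_disjoint[OF d(2) odd_face(1) z] .
    have v0: "v \<notin> f0" using vertex_not_in_face[OF d(1) odd_face(1)] .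
    let ?w = "Ln (z - o0)" and ?u = "Ln (v - o0)"
    have \<rho>: "\<rho> ?w = z" "\<rho> ?u = v" using \<rho>_surj(2) z0 v0 by auto
    have xz: "x \<in> flags_at z" "x \<in> flags_at v" using at_edge[OF d(2) z] at_vertex[OF d(1)] x xe by auto
    note cz = edge_at_walk(4)[OF d(2) z xz(1) xz(1)] and cv = vertex_at_walk(4)[OF d(1) xz(2) xz(2)]
    have Gw: "G ?w \<in> states z" "G ?u \<in> states v" using st[of ?w] st[of ?u] \<rho> by simp_all
    have G\<Sigma>z: "G ?w y = \<Sigma> y" if "y \<in> flags_at z" for y using G\<Sigma>[of y ?w] \<rho> that by simp
    have G\<Sigma>v: "G ?u y = \<Sigma> y" if "y \<in> flags_at v" for y using G\<Sigma>[of y ?u] \<rho> that by simp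
    show "\<Sigma> (s0 x) = t0 (\<Sigma> x)" using states_s(1)[OF Gw(1) xz(1)] cz G\<Sigma>z xz(1) by simp
    show "\<Sigma> (s2 x) = t2 (\<Sigma> x)" using states_s(3)[OF Gw(1) xz(1)] cz G\<Sigma>z xz(1) by simp
    show "\<Sigma> (s1 x) = t1 (\<Sigma> x)" using states_s(2)[OF Gw(2) xz(2)] cv G\<Sigma>v xz(2) by simp
  next
    have "face (B0 0) = f0" by (simp add: face_def B0_def)
    then show "\<Sigma> (B0 0) = c0" by (simp add: \<Sigma>_def K_def)
  qed
qed

end

section \<open>The regular hexagonal lattice\<close>

text \<open>
  The flag \<open>(a, b, x, y, p)\<close> belongs to the face at the position \<open>(a, b)\<close>, with respect to two axes at an
  angle of 120 degrees; its edge is the one towards the neighbour at \<open>(a + x, b + y)\<close>, and \<open>p\<close> tells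
  which end of that edge is its vertex.
\<close>

type_synonym hexflag = "int \<times> int \<times> int \<times> int \<times> bool"

fun hex0 :: "hexflag \<Rightarrow> hexflag" where "hex0 (a, b, x, y, p) = (a, b, x, y, \<not> p)"
fun hex1 :: "hexflag \<Rightarrow> hexflag" where
  "hex1 (a, b, x, y, p) = (if p then (a, b, x - y, x, False) else (a, b, y, y - x, True))"
fun hex2 :: "hexflag \<Rightarrow> hexflag" where "hex2 (a, b, x, y, p) = (a + x, b + y, - x, - y, \<not> p)"
text \<open>
  Rotation by 60 degrees about the face at the origin.
\<close>

fun turn :: "hexflag \<Rightarrow> hexflag" where "turn (a, b, x, y, p) = (a - b, a, x - y, x, p)"

text \<open>
  Flags of the regular lattice modulo rotations about the origin.
\<close>

definition orbit :: "hexflag \<Rightarrow> hexflag set" where "orbit x = {(turn ^^ k) x |k. k < 6}"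

lemma turn_6: "(turn ^^ 6) x = x"
  by (cases x) (simp add: eval_nat_numeral)

lemma less_6: "{k. k < (6::nat)} = {0, 1, 2, 3, 4, 5}" by auto

lemma orbit_eq: "orbit x = {x, turn x, turn (turn x), turn (turn (turn x)),
    turn (turn (turn (turn x))), turn (turn (turn (turn (turn x))))}"
proof -
  have "orbit x = (\<lambda>k. (turn ^^ k) x) ` {k. k < 6}" unfolding orbit_def by auto
  then show ?thesis unfolding less_6 by (simp add: eval_nat_numeral)
qed

lemma hex_turn: "hex0 (turn x) = turn (hex0 x)" "hex1 (turn x) = turn (hex1 x)"
    "hex2 (turn x) = turn (hex2 x)"
  by (cases x; simp)+

lemma orbit_image:
  assumes "\<And>x. f (turn x) = turn (f x)" shows "f ` orbit x = orbit (f x)"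
  by (simp add: orbit_eq assms)

lemma orbit_turn: "orbit (turn x) = orbit x"
  using turn_6[of x] by (simp add: orbit_eq eval_nat_numeral insert_commute)

lemma hex_involution: "hex0 (hex0 x) = x" "hex1 (hex1 x) = x" "hex2 (hex2 x) = x"
  by (cases x; simp)+

lemma hex_commute: "hex2 (hex0 x) = hex0 (hex2 x)"
  by (cases x) simp

lemma hex_braid: "hex1 (hex2 (hex1 x)) = hex2 (hex1 (hex2 x))"
  by (cases x) simp

lemma walk_add: "even i \<Longrightarrow> walk a b x (i + j) = walk a b (walk a b x i) j"
  by (induction j) simp_all

lemma walk_image: "walk ((`) a) ((`) b) S i = (\<lambda>x. walk a b x i) ` S"
  by (induction i) (simp_all add: image_image)

lemma hex_hexagon: "walk hex0 hex1 x 12 = x" "walk hex1 hex0 x 12 = x"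
proof -
  have "walk a b x 12 = walk a b (walk a b x 6) 6" for a b :: "hexflag \<Rightarrow> hexflag"
    using walk_add[of 6 a b x 6] by simp
  then show "walk hex0 hex1 x 12 = x" "walk hex1 hex0 x 12 = x"
    by (cases x; simp add: walk_numeral)+
qed

section \<open>Coordinates and colours on a cone\<close>

text \<open>
  A connected flag system with the relations of a hexagonal lattice, except that the face \<open>centre\<close> has
  \<open>n\<close> sides, together with a development \<open>pos\<close> modulo rotations that sends the centre to the origin.
\<close>

locale cone_flags =
  fixes Fl :: "'a set" and s0 s1 s2 :: "'a \<Rightarrow> 'a" and face :: "'a \<Rightarrow> 'f" and centre :: 'f
    and n :: nat and r0 :: 'a and pos :: "'a \<Rightarrow> hexflag set"
  assumes inv [simp]: "s0 (s0 x) = x" "s1 (s1 x) = x" "s2 (s2 x) = x"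
    and comm: "s2 (s0 x) = s0 (s2 x)"
    and braid: "s1 (s2 (s1 x)) = s2 (s1 (s2 x))"
    and closed [simp]: "x \<in> Fl \<Longrightarrow> s0 x \<in> Fl" "x \<in> Fl \<Longrightarrow> s1 x \<in> Fl" "x \<in> Fl \<Longrightarrow> s2 x \<in> Fl"
    and face_inv [simp]: "face (s0 x) = face x" "face (s1 x) = face x"
    and face_s2: "x \<in> Fl \<Longrightarrow> face (s2 x) \<noteq> face x"
    and same_face: "\<lbrakk>x \<in> Fl; y \<in> Fl; face x = face y\<rbrakk> \<Longrightarrow>
        \<exists>k. y = ((\<lambda>z. s0 (s1 z)) ^^ k) x \<or> y = s0 (((\<lambda>z. s0 (s1 z)) ^^ k) x)"
    and hexagon: "\<lbrakk>x \<in> Fl; face x \<noteq> centre\<rbrakk> \<Longrightarrow> ((\<lambda>z. s0 (s1 z)) ^^ 6) x = x"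
    and r0: "r0 \<in> Fl" "face r0 = centre" "((\<lambda>z. s0 (s1 z)) ^^ n) r0 = r0"
        "\<And>j. \<lbrakk>0 < j; j < n\<rbrakk> \<Longrightarrow> ((\<lambda>z. s0 (s1 z)) ^^ j) r0 \<noteq> r0"
    and n: "odd n" "3 \<le> n"
    and connected: "\<And>P x. \<lbrakk>P r0; \<And>x. \<lbrakk>x \<in> Fl; P x\<rbrakk> \<Longrightarrow> P (s0 x) \<and> P (s1 x) \<and> P (s2 x); x \<in> Fl\<rbrakk> \<Longrightarrow> P x"
    and pos_s: "x \<in> Fl \<Longrightarrow> pos (s0 x) = hex0 ` pos x" "x \<in> Fl \<Longrightarrow> pos (s1 x) = hex1 ` pos x"
        "x \<in> Fl \<Longrightarrow> pos (s2 x) = hex2 ` pos x"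
    and pos_r0: "pos r0 = orbit (0, 0, 1, 0, True)"
begin

text \<open>
  In the development, \<open>R\<close> turns a flag within its face by 60 degrees and \<open>M\<close> moves it by one step in
  the direction of its edge without turning it. \<open>M2\<close> is the step in the direction that makes an angle of
  120 degrees with that of \<open>M\<close>, and \<open>P r a b\<close> is the walk to the face with coordinates \<open>(a, b)\<close> in the
  wedge that starts at the flag \<open>r\<close> of the centre.
\<close>

definition R :: "'a \<Rightarrow> 'a" where "R x = s0 (s1 x)"
definition R' :: "'a \<Rightarrow> 'a" where "R' x = s1 (s0 x)"
definition M :: "'a \<Rightarrow> 'a" where "M x = R (R (R (s0 (s2 x))))"
definition M2 :: "'a \<Rightarrow> 'a" where "M2 x = R' (R' (M (R (R x))))"
definition P :: "'a \<Rightarrow> nat \<Rightarrow> nat \<Rightarrow> 'a" where "P r a b = (M2 ^^ b) ((M ^^ a) r)"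

lemma R_eq: "(\<lambda>z. s0 (s1 z)) = R" by (rule ext) (simp add: R_def)

lemma R_inv [simp]: "R (R' x) = x" "R' (R x) = x" by (simp_all add: R_def R'_def)

lemma R_closed [simp]: "x \<in> Fl \<Longrightarrow> R x \<in> Fl" "x \<in> Fl \<Longrightarrow> R' x \<in> Fl" "x \<in> Fl \<Longrightarrow> M x \<in> Fl" "x \<in> Fl \<Longrightarrow> M2 x \<in> Fl"
  by (simp_all add: R_def R'_def M_def M2_def)

lemma face_R [simp]: "face (R x) = face x" "face (R' x) = face x"
  by (simp_all add: R_def R'_def)

lemma face_M: "face (M x) = face (s2 x)" by (simp add: M_def comm)

lemma R6: "\<lbrakk>x \<in> Fl; face x \<noteq> centre\<rbrakk> \<Longrightarrow> R (R (R (R (R (R x))))) = x"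
  using hexagon[of x] unfolding R_eq by (simp add: eval_nat_numeral)

text \<open>
  Both this word and the one in \<open>M2_M\<close> describe the passage from a face to the neighbour in the
  direction between \<open>M\<close> and \<open>M2\<close>. Only the second one uses that an intermediate face is a hexagon,
  so the two steps commute as long as the centre is not met.
\<close>

lemma M_M2: "M (M2 x) = R (R (s2 (s1 x)))"
proof -
  have "M (M2 x) = R (R (R (s0 (s2 (R (s0 (s2 (R (R x)))))))))" by (simp add: M_def M2_def)
  also have "\<dots> = R (R (s2 (s1 x)))"
    by (simp add: R_def comm braid[symmetric])
  finally show ?thesis .
qed

lemma R_M_R: "R' (M (R x)) = R (R (s2 (s1 x)))"
  by (simp add: M_def) (simp add: R_def comm)

lemma M2_M:
  assumes "x \<in> Fl" "face (M x) \<noteq> centre" shows "M2 (M x) = R (R (s2 (s1 x)))"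
proof -
  have c: "face (s2 x) \<noteq> centre" using assms by (simp add: face_M)
  let ?y = "s0 (s2 x)"
  have y: "?y \<in> Fl" "face ?y \<noteq> centre" using assms c by simp_all
  have "R (R (R (R (R ?y)))) = R' ?y" using R6[OF y] by (metis R_inv(2))
  then have "M2 (M x) = R (s0 (s2 (R' ?y)))" by (simp add: M_def M2_def)
  also have "\<dots> = R (R (s2 (s1 x)))" by (simp add: R_def R'_def comm braid)
  finally show ?thesis .
qed

lemma M_back:
  assumes "x \<in> Fl" "face (M x) \<noteq> centre" shows "M (R (R (R (M x)))) = R (R (R x))"
proof -
  let ?y = "s0 (s2 x)"
  have y: "?y \<in> Fl" "face ?y \<noteq> centre" using assms by (simp_all add: face_M)
  show ?thesis using R6[OF y] by (simp add: M_def comm)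
qed

lemma M_inj: "M x = M y \<Longrightarrow> x = y"
  unfolding M_def by (metis R_inv(2) inv)

lemma M2_inj: "M2 x = M2 y \<Longrightarrow> x = y"
  unfolding M2_def by (metis R_inv M_inj)

lemma P_closed [simp]: "r \<in> Fl \<Longrightarrow> P r a b \<in> Fl"
proof -
  assume "r \<in> Fl"
  then have "(M ^^ a) r \<in> Fl" by (induction a) auto
  then show ?thesis unfolding P_def by (induction b) auto
qed

definition root :: "'a \<Rightarrow> bool" where
  "root r \<longleftrightarrow> r \<in> Fl \<and> face r = centre \<and> pos r = orbit (0, 0, 1, 0, True)"

lemma pos_R: "x \<in> Fl \<Longrightarrow> pos (R x) = (hex0 \<circ> hex1) ` pos x"
  by (simp add: R_def pos_s image_comp)

lemma pos_R': "x \<in> Fl \<Longrightarrow> pos (R' x) = (hex1 \<circ> hex0) ` pos x"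
  by (simp add: R'_def pos_s image_comp)

lemma root_R: assumes "root r" shows "root (R r)"
proof -
  have "pos (R r) = orbit (turn (0, 0, 1, 0, True))"
    using assms unfolding root_def by (simp add: pos_R image_comp[symmetric] orbit_image hex_turn)
  then show ?thesis using assms unfolding root_def orbit_turn by simp
qed

lemma pos_in:
  assumes "x \<in> Fl" "h \<in> pos x"
  shows "hex0 (hex1 h) \<in> pos (R x)" "hex1 (hex0 h) \<in> pos (R' x)"
    "hex2 h \<in> pos (s2 x)" "hex0 h \<in> pos (s0 x)"
  using assms by (auto simp: pos_R pos_R' pos_s)

lemma pos_M:
  assumes "x \<in> Fl" "(a, b, u, v, True) \<in> pos x" shows "(a + u, b + v, u, v, True) \<in> pos (M x)"
proof -
  have x: "s2 x \<in> Fl" "s0 (s2 x) \<in> Fl" "R (s0 (s2 x)) \<in> Fl" "R (R (s0 (s2 x))) \<in> Fl" using assms by auto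
  have "hex0 (hex2 (a, b, u, v, True)) \<in> pos (s0 (s2 x))" using pos_in x assms by blast
  note pos_in(1)[OF x(4) pos_in(1)[OF x(3) pos_in(1)[OF x(2) this]]]
  then show ?thesis by (simp add: M_def)
qed

lemma pos_M2:
  assumes "x \<in> Fl" "(a, b, 1, 0, True) \<in> pos x" shows "(a, b + 1, 1, 0, True) \<in> pos (M2 x)"
proof -
  have x: "R x \<in> Fl" "R (R x) \<in> Fl" "M (R (R x)) \<in> Fl" "R' (M (R (R x))) \<in> Fl" using assms by auto
  have "(a, b, 0, 1, True) \<in> pos (R (R x))"
    using pos_in(1)[OF x(1) pos_in(1)[OF assms]] by simp
  note pos_M[OF x(2) this]
  note pos_in(2)[OF x(4) pos_in(2)[OF x(3) this]]
  then show ?thesis by (simp add: M2_def)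
qed

lemma pos_P:
  assumes "root r" shows "(int a, int b, 1, 0, True) \<in> pos (P r a b)"
proof -
  have Fl: "(M ^^ a) r \<in> Fl" for a using P_closed[of r a 0] assms by (simp add: P_def root_def)
  have 1: "(int a, 0, 1, 0, True) \<in> pos ((M ^^ a) r)"
  proof (induction a)
    case 0 then show ?case using assms by (simp add: root_def orbit_eq)
  next
    case (Suc a) then show ?case using pos_M[OF Fl Suc] by (simp add: add.commute)
  qed
  show ?thesis
  proof (induction b)
    case 0 then show ?case using 1 by (simp add: P_def)
  next
    case (Suc b)
    have "P r a (Suc b) = M2 (P r a b)" by (simp add: P_def)
    then show ?case using pos_M2[OF _ Suc] assms by (simp add: add.commute root_def)
  qed
qed

lemma same_centre:
  assumes "x \<in> Fl" "face x = centre" "(a, b, u, v, p) \<in> pos x" shows "a = 0 \<and> b = 0"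
proof -
  have *: "(\<forall>a b u v p. (a, b, u, v, p) \<in> pos ((R ^^ k) r0) \<longrightarrow> a = 0 \<and> b = 0) \<and> (R ^^ k) r0 \<in> Fl" for k
  proof (induction k)
    case 0 then show ?case using pos_r0 r0 by (auto simp: orbit_eq)
  next
    case (Suc k) then show ?case by (auto simp: pos_R split: if_splits) blast+
  qed
  obtain k where "x = (R ^^ k) r0 \<or> x = s0 ((R ^^ k) r0)"
    using same_face[OF r0(1) assms(1)] assms r0 unfolding R_eq by auto
  then show ?thesis
  proof
    assume "x = (R ^^ k) r0" then show ?thesis using * assms(3) by blast
  next
    assume "x = s0 ((R ^^ k) r0)"
    then have "(a, b, u, v, p) \<in> hex0 ` pos ((R ^^ k) r0)" using * assms(3) pos_s(1) by metis
    then have "(a, b, u, v, \<not> p) \<in> pos ((R ^^ k) r0)" by auto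
    then show ?thesis using * by blast
  qed
qed

text \<open>
  The development of the walk ends at \<open>(a, b)\<close>, whereas the centre develops to the origin only.
\<close>

lemma P_off_centre: assumes "root r" "1 \<le> a" shows "face (P r a b) \<noteq> centre"
  using same_centre[OF _ _ pos_P[OF assms(1)], of a b] assms by (auto simp: root_def)

lemma P_Suc: "P r a (Suc b) = M2 (P r a b)" by (simp add: P_def)

lemma M_P:
  assumes "root r" "1 \<le> a" shows "M (P r a b) = P r (Suc a) b"
proof (induction b)
  case 0 then show ?case by (simp add: P_def)
next
  case (Suc b)
  have Fl: "P r a b \<in> Fl" using assms by (simp add: root_def)
  have "M (P r a (Suc b)) = R (R (s2 (s1 (P r a b))))" by (simp add: P_Suc M_M2)
  also have "\<dots> = M2 (M (P r a b))"
    using M2_M[OF Fl] P_off_centre[OF assms(1), of "Suc a" b] Suc by simp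
  also have "\<dots> = P r (Suc a) (Suc b)" by (simp add: Suc P_Suc)
  finally show ?case .
qed

lemma RMR_P:
  assumes "root r" "1 \<le> a" shows "R' (M (R (P r a b))) = P r (Suc a) (Suc b)"
  using M_P[OF assms, of "Suc b"] by (simp add: P_Suc M_M2 R_M_R)

text \<open>
  The second axis of a wedge is the first axis of the next one.
\<close>

lemma P_diagonal:
  assumes "root r" "1 \<le> a" shows "P r a a = R' (P (R r) a 0)"
  using assms(2)
proof (induction a rule: nat_induct_at_least)
  case base
  have "face (M r) \<noteq> centre" using P_off_centre[OF assms(1), of 1 0] by (simp add: P_def)
  then show ?case using M2_M[of r] assms(1) by (simp add: P_def R_M_R root_def)
next
  case (Suc a)
  have "P r (Suc a) (Suc a) = R' (M (R (P r a a)))" using RMR_P[OF assms(1) Suc(1), symmetric] .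
  also have "\<dots> = R' (P (R r) (Suc a) 0)" using Suc by (simp add: P_def)
  finally show ?case .
qed

lemma face_P_diagonal: "\<lbrakk>root r; 1 \<le> a\<rbrakk> \<Longrightarrow> face (P r a a) = face (P (R r) a 0)"
  by (simp add: P_diagonal)

lemma neighbour:
  assumes "x \<in> Fl" "y \<in> Fl" "face x = face y" "face x \<noteq> centre"
  obtains k where "k < 6" "face (s2 y) = face (M ((R ^^ k) x))" "y = (R ^^ k) x \<or> y = s0 ((R ^^ k) x)"
proof -
  obtain k where k: "y = (R ^^ k) x \<or> y = s0 ((R ^^ k) x)"
    using same_face[OF assms(1-3)] unfolding R_eq by auto
  have 6: "(R ^^ (6 * m)) x = x" for m
    by (induction m) (simp_all add: funpow_add hexagon[OF assms(1,4), unfolded R_eq])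
  have "(R ^^ k) x = (R ^^ (k mod 6 + 6 * (k div 6))) x" by simp
  also have "\<dots> = (R ^^ (k mod 6)) x" by (simp only: funpow_add o_apply 6)
  finally have "(R ^^ k) x = (R ^^ (k mod 6)) x" .
  with k show thesis by (intro that[of "k mod 6"]) (auto simp: face_M comm)
qed

text \<open>
  The six sides of a face in a wedge with root \<open>r\<close>; only faces on its first axis have neighbours in
  the wedge of the previous root \<open>r'\<close>. Faces with \<open>a = b\<close> on the second axis belong to the next wedge.
\<close>

lemma P_neighbours:
  assumes "root r" "root r'" "R r' = r" "b < a" "y \<in> Fl" "face y = face (P r a b)"
  shows "face (s2 y) \<in> {face (P r (Suc a) b), face (P r (Suc a) (Suc b)), face (P r a (Suc b))} \<or>
     (1 < a \<and> face (s2 y) = face (P r (a - 1) b)) \<or> (a = 1 \<and> face (s2 y) = centre) \<or>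
     (0 < b \<and> face (s2 y) \<in> {face (P r (a - 1) (b - 1)), face (P r a (b - 1))}) \<or>
     (b = 0 \<and> face (s2 y) \<in> {face (P r' a (a - 1)), face (P r' (Suc a) a)})"
proof -
  let ?x = "P r a b"
  have a: "1 \<le> a" and rF: "r \<in> Fl" "r' \<in> Fl" using assms by (auto simp: root_def)
  have xF: "?x \<in> Fl" using rF by simp
  have xc: "face ?x \<noteq> centre" using P_off_centre assms a by blast
  obtain k where k: "k < 6" "face (s2 y) = face (M ((R ^^ k) ?x))"
    using neighbour[OF xF assms(5) assms(6)[symmetric] xc] by metis
  have Mb: "face (M (R (R (R (M z))))) = face z" if "z \<in> Fl" "face (M z) \<noteq> centre" for z
    using M_back[OF that] by simp
  from k(1) consider "k = 0" | "k = 1" | "k = 2" | "k = 3" | "k = 4" | "k = 5" by linarith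
  then show ?thesis
  proof cases
    case 1 then show ?thesis using k M_P[OF assms(1) a, of b] by simp
  next
    case 2 then show ?thesis using k RMR_P[OF assms(1) a, of b] face_R(2)[of "M (R ?x)"] by simp
  next
    case 3
    have "face (M (R (R ?x))) = face (M2 ?x)" by (simp add: M2_def)
    then show ?thesis using k 3 by (simp add: P_Suc eval_nat_numeral)
  next
    case 4
    show ?thesis
    proof (cases "a = 1")
      case True
      then have "?x = M r" using assms by (simp add: P_def)
      then show ?thesis using k 4 Mb[of r] xc rF assms(1) True by (simp add: eval_nat_numeral root_def)
    next
      case False
      then have "?x = M (P r (a - 1) b)" using M_P[OF assms(1), of "a - 1" b] a by simp
      then show ?thesis using k 4 Mb[of "P r (a - 1) b"] xc rF False a by (simp add: eval_nat_numeral)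
    qed
  next
    case 5
    show ?thesis
    proof (cases "b = 0")
      case True
      let ?z = "P r' a (a - 1)"
      have "?x = R (P r' a a)" using P_diagonal[OF assms(2) a] assms True by simp
      also have "P r' a a = M2 ?z" using P_Suc[of r' a "a - 1"] a by simp
      finally have x: "?x = R' (M (R (R ?z)))" by (simp add: M2_def)
      then have "face (M (R (R ?z))) \<noteq> centre" using xc by simp
      then have "face (M ((R ^^ 4) ?x)) = face ?z"
        using Mb[of "R (R ?z)"] rF by (simp add: eval_nat_numeral x)
      then show ?thesis using k 5 True by simp
    next
      case False
      let ?z = "P r (a - 1) (b - 1)"
      have x: "?x = R' (M (R ?z))" using RMR_P[OF assms(1), of "a - 1" "b - 1"] False assms(4) by simp
      then have "face (M (R ?z)) \<noteq> centre" using xc by simp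
      then show ?thesis using k 5 Mb[of "R ?z"] rF False by (simp add: eval_nat_numeral x)
    qed
  next
    case 6
    show ?thesis
    proof (cases "b = 0")
      case True
      have x: "?x = R (P r' a a)" using P_diagonal[OF assms(2) a] assms True by simp
      have "P r' a a \<in> Fl" "face (P r' a a) \<noteq> centre" using rF P_off_centre[OF assms(2) a] by auto
      from R6[OF this] have "M ((R ^^ 5) ?x) = P r' (Suc a) a"
        using M_P[OF assms(2) a, of a] by (simp add: x eval_nat_numeral)
      then show ?thesis using k 6 True by simp
    next
      case False
      let ?z = "P r a (b - 1)"
      have x: "?x = R' (R' (M (R (R ?z))))" using P_Suc[of r a "b - 1"] False by (simp add: M2_def)
      then have "face (M (R (R ?z))) \<noteq> centre" using xc by simp
      then show ?thesis using k 6 Mb[of "R (R ?z)"] rF False by (simp add: eval_nat_numeral x)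
    qed
  qed
qed

definition sector_root :: "nat \<Rightarrow> 'a" where "sector_root j = (R ^^ j) r0"
definition Q :: "nat \<Rightarrow> nat \<Rightarrow> nat \<Rightarrow> 'f" where "Q j a b = face (P (sector_root j) a b)"

lemma root_sector: "root (sector_root j)"
  unfolding sector_root_def
proof (induction j)
  case 0 then show ?case using r0 pos_r0 by (simp add: root_def)
next
  case (Suc j) then show ?case by (simp add: root_R)
qed

lemma sector_next: "R (sector_root j) = sector_root (Suc j mod n)" if "j < n"
proof (cases "Suc j = n")
  case True then show ?thesis using r0(3) unfolding R_eq by (auto simp: sector_root_def)
next
  case False then show ?thesis using that by (simp add: sector_root_def)
qed

lemma sector_root_inj: assumes "i < n" "j < n" "sector_root i = sector_root j" shows "i = j"
proof -
  have *: "i = j" if "i \<le> j" "j < n" "sector_root i = sector_root j" for i j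
  proof -
    have inj: "inj R" by (metis R_inv(2) injI)
    have "(R ^^ i) r0 = (R ^^ i) ((R ^^ (j - i)) r0)"
      using that unfolding sector_root_def by (metis funpow_add o_apply le_add_diff_inverse)
    then have "(R ^^ (j - i)) r0 = r0" using inj_fn[OF inj, of i] by (metis injD)
    then have "\<not> (0 < j - i \<and> j - i < n)" using r0(4)[unfolded R_eq, of "j - i"] by blast
    then show ?thesis using that by linarith
  qed
  show ?thesis using *[of i j] *[of j i] assms by (metis nat_le_linear)
qed

definition prev :: "nat \<Rightarrow> nat" where "prev j = (if j = 0 then n - 1 else j - 1)"

lemma prev: "j < n \<Longrightarrow> prev j < n \<and> R (sector_root (prev j)) = sector_root j"
  using sector_next[of "prev j"] n by (auto simp: prev_def)

lemma Q_diagonal: "\<lbrakk>j < n; 1 \<le> a\<rbrakk> \<Longrightarrow> Q j a a = Q (Suc j mod n) a 0"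
  unfolding Q_def using face_P_diagonal[OF root_sector] by (simp add: sector_next)

lemma Q_neighbours:
  assumes "j < n" "b < a" "y \<in> Fl" "face y = Q j a b"
  shows "face (s2 y) \<in> {Q j (Suc a) b, Q j (Suc a) (Suc b), Q j a (Suc b)} \<or>
     (1 < a \<and> face (s2 y) = Q j (a - 1) b) \<or> (a = 1 \<and> face (s2 y) = centre) \<or>
     (0 < b \<and> face (s2 y) \<in> {Q j (a - 1) (b - 1), Q j a (b - 1)}) \<or>
     (b = 0 \<and> face (s2 y) \<in> {Q (prev j) a (a - 1), Q (prev j) (Suc a) a})"
  using P_neighbours[OF root_sector root_sector _ assms(2,3), of "prev j" j] prev[OF assms(1)] assms(4)
  unfolding Q_def by simp

lemma centre_neighbours:
  assumes "y \<in> Fl" "face y = centre" obtains j where "j < n" "face (s2 y) = Q j 1 0"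
proof -
  obtain k where k: "y = (R ^^ k) r0 \<or> y = s0 ((R ^^ k) r0)"
    using same_face[OF r0(1) assms(1)] assms r0 unfolding R_eq by auto
  have nn: "(R ^^ (n * m)) r0 = r0" for m
    by (induction m) (simp_all add: funpow_add r0(3)[unfolded R_eq])
  have "(R ^^ k) r0 = (R ^^ (k mod n + n * (k div n))) r0" by simp
  also have "\<dots> = (R ^^ (k mod n)) r0" by (simp only: funpow_add o_apply nn)
  finally have "(R ^^ k) r0 = sector_root (k mod n)" by (simp add: sector_root_def)
  then have "face (s2 y) = Q (k mod n) 1 0" using k by (auto simp: Q_def P_def face_M comm)
  then show thesis using that[of "k mod n"] n by simp
qed

text \<open>
  The faces with coordinates and the centre are closed under adjacency.
\<close>

lemma Q_cover:
  assumes "x \<in> Fl" shows "face x = centre \<or> (\<exists>j a b. j < n \<and> b < a \<and> face x = Q j a b)"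
proof -
  define T where "T f \<longleftrightarrow> f = centre \<or> (\<exists>j a b. j < n \<and> b < a \<and> f = Q j a b)" for f
  have "T (face x)"
  proof (rule connected[OF _ _ assms])
    show "T (face r0)" using r0 by (simp add: T_def)
  next
    fix x assume x: "x \<in> Fl" "T (face x)"
    have T:  "T (Q j a b)" if "j < n" "b \<le> a" "1 \<le> a" for j a b
    proof (cases "b = a")
      case True
      have "Suc j mod n < n" using n by simp
      with True Q_diagonal that show ?thesis unfolding T_def by (metis less_le_trans zero_less_one)
    next
      case False then show ?thesis using that unfolding T_def by (metis le_neq_implies_less)
    qed
    have "T (face (s2 x))"
    proof (cases "face x = centre")
      case True
      then obtain j where "j < n" "face (s2 x) = Q j 1 0" using centre_neighbours[OF x(1)] by metis
      then show ?thesis using T[of j 0 1] by simp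
    next
      case False
      then obtain j a b where jab: "j < n" "b < a" "face x = Q j a b" using x by (auto simp: T_def)
      have p: "prev j < n" using prev jab by auto
      consider (1) "face (s2 x) \<in> {Q j (Suc a) b, Q j (Suc a) (Suc b), Q j a (Suc b)}"
        | (2) "1 < a" "face (s2 x) = Q j (a - 1) b" | (3) "face (s2 x) = centre"
        | (4) "0 < b" "face (s2 x) \<in> {Q j (a - 1) (b - 1), Q j a (b - 1)}"
        | (5) "face (s2 x) \<in> {Q (prev j) a (a - 1), Q (prev j) (Suc a) a}"
        using Q_neighbours[OF jab(1,2) x(1) jab(3)] by blast
      then show ?thesis
      proof cases
        case 1 then show ?thesis
          using T[OF jab(1), of b "Suc a"] T[OF jab(1), of "Suc b" "Suc a"] T[OF jab(1), of "Suc b" a] jab(2) by auto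
      next
        case 2 then show ?thesis using T[OF jab(1), of b "a - 1"] jab(2) by auto
      next
        case 3 then show ?thesis by (simp add: T_def)
      next
        case 4 then show ?thesis using T[OF jab(1), of "b - 1" "a - 1"] T[OF jab(1), of "b - 1" a] jab(2) by auto
      next
        case 5 then show ?thesis using T[OF p, of "a - 1" a] T[OF p, of a "Suc a"] jab(2) by auto
      qed
    qed
    then show "T (face (s0 x)) \<and> T (face (s1 x)) \<and> T (face (s2 x))" using x by simp
  qed
  then show ?thesis by (simp add: T_def)
qed

lemma Q_off_centre: "b < a \<Longrightarrow> Q j a b \<noteq> centre"
  unfolding Q_def using P_off_centre[OF root_sector] by simp

lemma pos_connected:
  assumes "x \<in> Fl" "h \<in> pos x" shows "pos x = orbit h"
proof -
  have self: "h \<in> orbit h" for h by (simp add: orbit_eq)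
  have orb: "orbit h' = orbit h" if h': "h' \<in> orbit h" for h h'

  proof -
    obtain k where "h' = (turn ^^ k) h" using h' unfolding orbit_def by blast
    moreover have "orbit ((turn ^^ k) h) = orbit h" for k by (induction k) (simp_all add: orbit_turn)
    ultimately show ?thesis by simp
  qed
  have "\<exists>h. pos x = orbit h"
  proof (rule connected[OF _ _ assms(1)])
    show "\<exists>h. pos r0 = orbit h" using pos_r0 by blast
    show "(\<exists>h. pos (s0 x) = orbit h) \<and> (\<exists>h. pos (s1 x) = orbit h) \<and> (\<exists>h. pos (s2 x) = orbit h)"
      if "x \<in> Fl" "\<exists>h. pos x = orbit h" for x
      using that orbit_image[of hex0, OF hex_turn(1)] orbit_image[of hex1, OF hex_turn(2)] orbit_image[of hex2, OF hex_turn(3)] pos_s[of x] by metis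
  qed
  then show ?thesis using assms(2) orb by metis
qed

lemma pos_R_pow: "(a, b, 1, 0, True) \<in> pos x \<Longrightarrow> x \<in> Fl \<Longrightarrow> k < 6 \<Longrightarrow>
    (a, b, [1, 1, 0, -1, -1, 0] ! k, [0, 1, 1, 0, -1, -1] ! k, True) \<in> pos ((R ^^ k) x) \<and> (R ^^ k) x \<in> Fl"
proof (induction k)
  case (Suc k)
  then have *: "(a, b, [1, 1, 0, -1, -1, 0] ! k, [0, 1, 1, 0, -1, -1] ! k, True) \<in> pos ((R ^^ k) x)" "(R ^^ k) x \<in> Fl" by auto
  have "k = 0 \<or> k = 1 \<or> k = 2 \<or> k = 3 \<or> k = 4" using Suc by linarith
  then show ?case using pos_in(1)[OF *(2,1)] *(2) by (elim disjE) (simp_all add: eval_nat_numeral)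
qed simp

text \<open>
  The position determines the coordinates because no two faces of a wedge are related by a rotation
  about the origin. The flag at the end of the walk is the one whose edge points in direction
  \<open>(1, 0)\<close>, so it is determined by the face, and the walk can be retraced to its root.
\<close>

lemma Q_inj:
  assumes "j < n" "b < a" "j' < n" "b' < a'" "Q j a b = Q j' a' b'"
  shows "j = j' \<and> a = a' \<and> b = b'"
proof -
  let ?x = "P (sector_root j) a b" and ?y = "P (sector_root j') a' b'"
  have x: "?x \<in> Fl" "?y \<in> Fl" "(int a, int b, 1, 0, True) \<in> pos ?x" "(int a', int b', 1, 0, True) \<in> pos ?y"
    using pos_P root_sector by (auto simp: root_def)
  have xc: "face ?x \<noteq> centre" using Q_off_centre[OF assms(2)] by (simp add: Q_def)
  obtain k where k: "k < 6" "?y = (R ^^ k) ?x \<or> ?y = s0 ((R ^^ k) ?x)"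
    using neighbour[OF x(1,2) _ xc] assms(5) unfolding Q_def by metis
  note p = pos_R_pow[OF x(3,1) k(1)]
  let ?h = "(int a, int b, [1, 1, 0, -1, -1, 0] ! k, [0, 1, 1, 0, -1, -1] ! k, True)"
  have k6: "k = 0 \<or> k = 1 \<or> k = 2 \<or> k = 3 \<or> k = 4 \<or> k = 5" using k by linarith
  have y: "?y = (R ^^ k) ?x"
  proof (rule ccontr)
    assume "\<not> ?thesis"
    then have "pos ?y = hex0 ` orbit ?h" using k pos_connected[of "(R ^^ k) ?x" ?h] p by (auto simp: pos_s)
    then show False using x(4) by (auto simp: orbit_eq)
  qed
  then have "(int a', int b', 1, 0, True) \<in> orbit ?h" using pos_connected[of "(R ^^ k) ?x" ?h] p x(4) by auto
  then have ab: "a = a' \<and> b = b' \<and> k = 0" using k6 assms(2,4)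
    by (elim disjE) (auto simp: orbit_eq eval_nat_numeral)
  then have "?x = ?y" using y by simp
  then have "(M2 ^^ b) ((M ^^ a) (sector_root j)) = (M2 ^^ b) ((M ^^ a) (sector_root j'))" using ab by (simp add: P_def)
  moreover have "inj (M2 ^^ b)" "inj (M ^^ a)" using inj_fn[of M2 b] inj_fn[of M a] M_inj M2_inj by (metis injI)+
  ultimately have "sector_root j = sector_root j'" by (metis injD)
  then show ?thesis using sector_root_inj assms ab by auto
qed

text \<open>
  The colour class of a face with \<open>a + b = m\<close> in sector \<open>j\<close>, continued from sector 0 through the
  sectors \<open>1, \<dots>, j\<close>: the classes 1 and 2 are exchanged at each step.
\<close>

definition residue :: "nat \<Rightarrow> nat \<Rightarrow> nat" where
  "residue j m = (if even j then m else 2 * m) mod 3"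

text \<open>
  The colour of a class: class 0 is always painted 1, and the classes 1 and 2 are painted 2 and 3,
  except that sector 0 uses 4 instead of 3 and sector \<open>n - 1\<close> uses 4 instead of 2.
\<close>

definition shade :: "nat \<Rightarrow> nat \<Rightarrow> nat" where
  "shade j q = (if q = 0 then 1 else if q = 1 then (if j = n - 1 then 4 else 2)
     else (if j = 0 then 4 else 3))"

definition colour :: "nat \<Rightarrow> nat \<Rightarrow> nat \<Rightarrow> nat" where
  "colour j a b = shade j (residue j (a + b))"

lemma residue_less: "residue j m \<in> {0, 1, 2}"
proof -
  have "k mod 3 \<in> {0, 1, 2}" for k :: nat by auto
  then show ?thesis unfolding residue_def .
qed

lemma mod_3_cases: "(k::nat) mod 3 = 0 \<or> k mod 3 = 1 \<or> k mod 3 = 2" by auto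

lemma residue_inj: "m mod 3 \<noteq> m' mod 3 \<Longrightarrow> residue j m \<noteq> residue j m'"
proof -
  assume "m mod 3 \<noteq> m' mod 3"
  moreover from this have "(2 * m) mod 3 \<noteq> (2 * m') mod 3"
    using mod_3_cases[of m] mod_3_cases[of m'] mod_mult_right_eq[of 2 m 3] mod_mult_right_eq[of 2 m' 3] by auto
  ultimately show ?thesis unfolding residue_def by (cases "even j") simp_all
qed

lemma residue_next: "(m + m') mod 3 \<noteq> 0 \<Longrightarrow> residue j m \<noteq> residue (Suc j) m'"
proof -
  assume *: "(m + m') mod 3 \<noteq> 0"
  have "m mod 3 = (2 * m') mod 3 \<Longrightarrow> (m + m') mod 3 = (2 * m' + m') mod 3" by (rule mod_add_cong) simp_all
  moreover have "(2 * m) mod 3 = m' mod 3 \<Longrightarrow> (m + m') mod 3 = (m + 2 * m) mod 3" by (rule mod_add_cong) simp_all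
  ultimately have "m mod 3 \<noteq> (2 * m') mod 3" "(2 * m) mod 3 \<noteq> m' mod 3" using * by auto
  then show ?thesis unfolding residue_def by (cases "even j") simp_all
qed

lemma shade_inj: "\<lbrakk>q \<in> {0, 1, 2}; q' \<in> {0, 1, 2}; q \<noteq> q'\<rbrakk> \<Longrightarrow> shade j q \<noteq> shade j q'"
  using n by (auto simp: shade_def)

lemma shade_next: "\<lbrakk>q \<in> {0, 1, 2}; q' \<in> {0, 1, 2}; q \<noteq> q'; Suc j < n\<rbrakk> \<Longrightarrow> shade j q \<noteq> shade (Suc j) q'"
  using n by (auto simp: shade_def)

lemma colour_same_sector:
  "(a + b) mod 3 \<noteq> (a' + b') mod 3 \<Longrightarrow> colour j a b \<noteq> colour j a' b'"
  unfolding colour_def by (intro shade_inj residue_less residue_inj)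

text \<open>
  Between consecutive sectors the classes match. At the seam from sector \<open>n - 1\<close> to sector 0 both
  numbers are even, so class 1 on one side continues as class 2 on the other side. Class 1 before the
  seam and class 2 after it are both painted 4 and never meet; no other colour but 1, which belongs to
  class 0 on both sides, occurs on both sides.
\<close>

lemma colour_next_sector:
  assumes "j < n" "(a + b + a') mod 3 \<noteq> 0"
  shows "colour j a b \<noteq> colour (Suc j mod n) a' 0"
proof (cases "Suc j = n")
  case True
  then have j: "even j" "j \<noteq> 0" "j = n - 1" "Suc j mod n = 0" "n - 1 \<noteq> 0" using n by auto
  have q: "\<not> (residue j (a + b) = 0 \<and> residue 0 a' = 0)" "\<not> (residue j (a + b) = 1 \<and> residue 0 a' = 2)"
  proof -
    have "(a + b + a') mod 3 = ((a + b) mod 3 + a' mod 3) mod 3" by (rule mod_add_eq[symmetric])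
    then show "\<not> (residue j (a + b) = 0 \<and> residue 0 a' = 0)" "\<not> (residue j (a + b) = 1 \<and> residue 0 a' = 2)"
      using assms(2) j(1) by (auto simp add: residue_def simp del: One_nat_def)
  qed
  show ?thesis using q j residue_less[of j "a + b"] residue_less[of 0 "a'"]
    unfolding colour_def j(4) by (auto simp: shade_def)
next
  case False
  then have j: "Suc j mod n = Suc j" "Suc j < n" using assms(1) by auto
  show ?thesis unfolding colour_def j(1)
    using assms(2) by (intro shade_next residue_less residue_next j(2)) simp
qed

definition paint :: "'f \<Rightarrow> nat" where
  "paint f = (if f = centre then 1 else THE k. \<exists>j a b. j < n \<and> b < a \<and> f = Q j a b \<and> k = colour j a b)"

lemma paint_centre: "paint centre = 1" by (simp add: paint_def)

lemma colour_first: "colour j (Suc 0) 0 \<noteq> Suc 0"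
  by (simp add: colour_def shade_def residue_def)

lemma paint_Q: assumes "j < n" "b < a" shows "paint (Q j a b) = colour j a b"
proof -
  have "(THE k. \<exists>j' a' b'. j' < n \<and> b' < a' \<and> Q j a b = Q j' a' b' \<and> k = colour j' a' b') = colour j a b"
  proof (rule the_equality)
    fix k assume "\<exists>j' a' b'. j' < n \<and> b' < a' \<and> Q j a b = Q j' a' b' \<and> k = colour j' a' b'"
    then show "k = colour j a b" using Q_inj[OF assms] by metis
  qed (use assms in blast)
  then show ?thesis using Q_off_centre[OF assms(2)] by (simp add: paint_def)
qed

lemma Q_cases:
  assumes "x \<in> Fl" obtains "face x = centre" | j a b where "j < n" "b < a" "face x = Q j a b"
  using Q_cover[OF assms] by blast

lemma paint_proper: assumes "x \<in> Fl" shows "paint (face (s2 x)) \<noteq> paint (face x)"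
  using assms
proof (cases rule: Q_cases)
  case 1
  obtain j where j: "j < n" "face (s2 x) = Q j 1 0" using centre_neighbours[OF assms 1] by metis
  then show ?thesis using 1 by (simp add: paint_Q paint_centre colour_first)
next
  case (2 j a b)
  have p: "prev j < n" "Suc (prev j) mod n = j" using 2 n by (auto simp: prev_def)
  have x: "paint (face x) = colour j a b" using 2 by (simp add: paint_Q)
  have m3: "(3 * k + 1) mod 3 \<noteq> (0::nat)" "(3 * k + 2) mod 3 \<noteq> (0::nat)" for k by presburger+
  have same: "paint (Q j a' b') \<noteq> colour j a b"
    if "b' < a'" "a' + b' = a + b + 1 \<or> a' + b' = a + b + 2 \<or> a + b = a' + b' + 1 \<or> a + b = a' + b' + 2" for a' b'
  proof -
    have "(m + 1) mod 3 \<noteq> m mod 3" "(m + 2) mod 3 \<noteq> m mod 3" for m :: nat by presburger+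
    then have "(a' + b') mod 3 \<noteq> (a + b) mod 3" using that(2) by metis
    from colour_same_sector[OF this, of j] show ?thesis by (simp add: paint_Q 2 that)
  qed
  have diag: "paint (Q j a' a') \<noteq> colour j a b" if "1 \<le> a'" "a + b + a' = 3 * k + 1 \<or> a + b + a' = 3 * k + 2" for a' k
  proof -
    have s: "Suc j mod n < n" using n by simp
    have "(a + b + a') mod 3 \<noteq> 0" using that(2) m3 by metis
    from colour_next_sector[OF 2(1) this] show ?thesis using paint_Q[OF s, of 0 a'] that
      by (simp add: Q_diagonal 2)
  qed
  have prior: "paint (Q (prev j) a' b') \<noteq> colour j a b"
    if "b' < a'" "b = 0" "a' + b' + a = 3 * k + 1 \<or> a' + b' + a = 3 * k + 2" for a' b' k
  proof -
    have "(a' + b' + a) mod 3 \<noteq> 0" using that(3) m3 by metis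
    from colour_next_sector[OF p(1) this] show ?thesis using that p by (simp add: paint_Q)
  qed
  consider (e) "face (s2 x) = Q j (Suc a) b" | (ne) "face (s2 x) = Q j (Suc a) (Suc b)"
    | (nw) "face (s2 x) = Q j a (Suc b)" | (w) "1 < a" "face (s2 x) = Q j (a - 1) b"
    | (c) "a = 1" "face (s2 x) = centre"
    | (sw) "0 < b" "face (s2 x) = Q j (a - 1) (b - 1)" | (se) "0 < b" "face (s2 x) = Q j a (b - 1)"
    | (sw') "b = 0" "face (s2 x) = Q (prev j) a (a - 1)" | (se') "b = 0" "face (s2 x) = Q (prev j) (Suc a) a"
    using Q_neighbours[OF 2(1,2) assms 2(3)] by blast
  then have "paint (face (s2 x)) \<noteq> colour j a b"
  proof cases
    case e then show ?thesis using same[of b "Suc a"] 2 by simp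
  next
    case ne then show ?thesis using same[of "Suc b" "Suc a"] 2 by simp
  next
    case nw
    show ?thesis
    proof (cases "Suc b = a")
      case True then show ?thesis using diag[of a b] nw 2 by auto
    next
      case False then show ?thesis using same[of "Suc b" a] nw 2 by simp
    qed
  next
    case w
    show ?thesis
    proof (cases "Suc b = a")
      case True then show ?thesis using diag[of b b] w by auto
    next
      case False then show ?thesis using same[of b "a - 1"] w 2 by simp
    qed
  next
    case c then show ?thesis using 2 colour_first[of j] by (auto simp: paint_centre)
  next
    case sw show ?thesis unfolding sw(2) by (rule same) (use sw 2 in linarith)+
  next
    case se show ?thesis unfolding se(2) by (rule same) (use se 2 in linarith)+
  next
    case sw' show ?thesis unfolding sw'(2)
      by (rule prior[where k = "a - 1"]) (use sw' 2 in linarith)+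
  next
    case se' then show ?thesis using prior[of a "Suc a" a] 2 by simp
  qed
  then show ?thesis unfolding x .
qed

definition adj :: "'f \<Rightarrow> 'f \<Rightarrow> bool" where "adj f g \<longleftrightarrow> (\<exists>x\<in>Fl. face x = f \<and> face (s2 x) = g)"

lemma adj_sym: "adj f g \<Longrightarrow> adj g f"
  unfolding adj_def using closed(3) inv(3) by metis

lemma adj_Q:
  shows "adj (Q j a 0) (Q j (Suc a) 0)" "adj (Q j a b) (Q j a (Suc b))"
proof -
  have x: "P (sector_root j) a b \<in> Fl" for a b using root_sector by (simp add: root_def)
  show "adj (Q j a 0) (Q j (Suc a) 0)"
    unfolding adj_def Q_def using x[of a 0] face_M[of "P (sector_root j) a 0"]
    by (intro bexI[of _ "P (sector_root j) a 0"]) (simp_all add: P_def)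
  show "adj (Q j a b) (Q j a (Suc b))"
    unfolding adj_def Q_def using x[of a b] face_M[of "R (R (P (sector_root j) a b))"]
    by (intro bexI[of _ "R (R (P (sector_root j) a b))"]) (simp_all add: P_Suc M2_def)
qed

lemma Q_0: "Q j 0 0 = centre" using root_sector by (simp add: Q_def P_def root_def)

abbreviation linked :: "'f set \<Rightarrow> 'f \<Rightarrow> 'f \<Rightarrow> bool" where
  "linked Z f g \<equiv> f \<in> Z \<and> g \<in> Z \<and> adj f g"

lemma sector_connected:
  assumes "\<And>a b. b < a \<Longrightarrow> Q j a b \<in> Z" "b < a"
  shows "(linked Z)\<^sup>*\<^sup>* (Q j 1 0) (Q j a b)"
proof -
  let ?W = "linked Z"
  have 1: "?W\<^sup>*\<^sup>* (Q j 1 0) (Q j (Suc a) 0)" for a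
  proof (induction a)
    case (Suc a)
    have "?W (Q j (Suc a) 0) (Q j (Suc (Suc a)) 0)" using adj_Q assms by blast
    then show ?case using Suc by (rule rtranclp.rtrancl_into_rtrancl[rotated])
  qed simp
  show ?thesis using assms(2)
  proof (induction b)
    case 0 then show ?case using 1[of "a - 1"] by simp
  next
    case (Suc b)
    then have "?W\<^sup>*\<^sup>* (Q j 1 0) (Q j a b)" by simp
    moreover have "?W (Q j a b) (Q j a (Suc b))" using adj_Q assms Suc by auto
    ultimately show ?case by (rule rtranclp.rtrancl_into_rtrancl)
  qed
qed

lemma connected_from:
  assumes "\<And>f. f \<in> Z \<Longrightarrow> (linked Z)\<^sup>*\<^sup>* z f" "f \<in> Z" "g \<in> Z"
  shows "(linked Z)\<^sup>*\<^sup>* f g"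
proof -
  have "symp (linked Z)" using adj_sym by (auto intro: sympI)
  then have "symp (linked Z)\<^sup>*\<^sup>*" by (rule symp_rtranclp)
  then show ?thesis using assms by (meson rtranclp_trans sympD)
qed

definition zones :: "nat \<Rightarrow> 'f set" where
  "zones i = (if i = 1 then {Q 0 a b |a b. b < a} else if i = 2 then {Q (n - 1) a b |a b. b < a}
     else insert centre {Q j a b |j a b. 0 < j \<and> j < n - 1 \<and> b < a})"

lemma one_sector_connected:
  assumes Z: "Z = {Q j a b |a b. b < a}" and fg: "f \<in> Z" "g \<in> Z"
  shows "(linked Z)\<^sup>*\<^sup>* f g"
proof (rule connected_from[OF _ fg])
  fix h assume "h \<in> Z"
  then obtain a b where h: "h = Q j a b" "b < a" unfolding Z by blast
  have "Q j a b \<in> Z" if "b < a" for a b using that unfolding Z by blast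
  from sector_connected[OF this h(2)] show "(linked Z)\<^sup>*\<^sup>* (Q j 1 0) h"
    unfolding h(1) by simp
qed

lemma zones_connected:
  assumes "f \<in> zones i" "g \<in> zones i"
  shows "(linked (zones i))\<^sup>*\<^sup>* f g"
proof -
  consider "i = 1" | "i = 2" | (mid) "i \<noteq> 1" "i \<noteq> 2" by auto
  then show ?thesis
  proof cases
    case 1
    then have "zones i = {Q 0 a b |a b. b < a}" by (simp add: zones_def)
    then show ?thesis using assms by (rule one_sector_connected)
  next
    case 2
    then have "zones i = {Q (n - 1) a b |a b. b < a}" by (simp add: zones_def)
    then show ?thesis using assms by (rule one_sector_connected)
  next
    case mid
    let ?W = "linked (zones i)"
    have c: "centre \<in> zones i" using mid by (simp add: zones_def)
    have "?W\<^sup>*\<^sup>* centre f" if f: "f \<in> zones i" for f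
    proof (cases "f = centre")
      case False
      then obtain j a b where j: "f = Q j a b" "0 < j" "j < n - 1" "b < a" using f mid by (auto simp: zones_def)
      have Z: "Q j a b \<in> zones i" if "b < a" for a b using that mid j(2,3) by (auto simp: zones_def)
      have "?W centre (Q j 1 0)" using adj_Q(1)[of j 0] c Z[of 0 1] by (simp add: Q_0)
      then show ?thesis unfolding j(1) using sector_connected[of j "zones i", OF Z j(4)]
        by (rule converse_rtranclp_into_rtranclp)
    qed simp
    then show ?thesis using assms by (rule connected_from)
  qed
qed

theorem cone_colouring:
  "\<exists>(c :: 'f \<Rightarrow> nat) (Z :: nat \<Rightarrow> 'f set) (S :: nat \<Rightarrow> nat set).
     c ` face ` Fl \<subseteq> {1, 2, 3, 4} \<and> (\<forall>f g. adj f g \<longrightarrow> c f \<noteq> c g) \<and>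
     (\<forall>i\<in>{1, 2, 3}. Z i \<noteq> {} \<and> Z i \<subseteq> face ` Fl \<and>
       (\<forall>f\<in>Z i. \<forall>g\<in>Z i. (\<lambda>a b. a \<in> Z i \<and> b \<in> Z i \<and> adj a b)\<^sup>*\<^sup>* f g)) \<and>
     disjoint_family_on Z {1, 2, 3} \<and> (\<Union>i\<in>{1, 2, 3}. Z i) = face ` Fl \<and>
     inj_on S {1, 2, 3} \<and>
     (\<forall>i\<in>{1, 2, 3}. S i \<subseteq> {1, 2, 3, 4} \<and> card (S i) = 3 \<and> (\<forall>f\<in>Z i. c f \<in> S i))"
proof -
  define S :: "nat \<Rightarrow> nat set" where
    "S i = (if i = 1 then {1, 2, 4} else if i = 2 then {1, 3, 4} else {1, 2, 3})" for i
  have QF: "Q j a b \<in> face ` Fl" for j a b using root_sector by (auto simp: Q_def root_def)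
  have cF: "centre \<in> face ` Fl" using r0 by auto
  have n': "0 < n" "n - 1 < n" "n - 1 \<noteq> 0" "n - 1 \<noteq> 1" using n by auto
  have sub: "zones i \<subseteq> face ` Fl" for i using QF cF by (auto simp: zones_def)
  have ne: "zones i \<noteq> {}" for i by (auto simp: zones_def)
  have paintS: "paint f \<in> S i" if "f \<in> zones i" "i \<in> {1, 2, 3}" for f i
  proof -
    have "colour 0 a b \<in> S 1" "colour (n - 1) a b \<in> S 2" for a b
      using n' by (auto simp: colour_def shade_def residue_def S_def)
    moreover have "colour j a b \<in> S 3" if "0 < j" "j < n - 1" for j a b
      using that by (auto simp: colour_def shade_def residue_def S_def)
    moreover have "paint centre \<in> S 3" by (simp add: paint_def S_def)
    ultimately show ?thesis using that n' by (auto simp: zones_def paint_Q split: if_splits)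
  qed
  have un: "(\<Union>i\<in>{1, 2, 3}. zones i) = face ` Fl"
  proof
    show "face ` Fl \<subseteq> (\<Union>i\<in>{1, 2, 3}. zones i)"
    proof (clarify)
      fix x assume "x \<in> Fl"
      then show "face x \<in> (\<Union>i\<in>{1, 2, 3}. zones i)"
      proof (cases rule: Q_cases)
        case (2 j a b)
        then consider "j = 0" | "j = n - 1" | "0 < j" "j < n - 1" by linarith
        then show ?thesis
        proof cases
          case 1 then have "face x \<in> zones 1" using 2 by (auto simp: zones_def)
          then show ?thesis by blast
        next
          case 2 then have "face x \<in> zones 2" using \<open>b < a\<close> \<open>face x = Q j a b\<close> by (auto simp: zones_def)
          then show ?thesis by blast
        next
          case 3 then have "face x \<in> zones 3" using 2 by (auto simp: zones_def)
          then show ?thesis by blast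
        qed
      qed (simp add: zones_def)
    qed
  qed (use sub in blast)
  have disj: "disjoint_family_on zones {1, 2, 3}"
  proof -
    have "zones 1 \<inter> zones 2 = {}" "zones 1 \<inter> zones 3 = {}" "zones 2 \<inter> zones 3 = {}"
      using n' Q_off_centre by (auto simp: zones_def dest!: Q_inj[rotated 4])
    then show ?thesis by (auto simp: disjoint_family_on_def)
  qed
  have "2 \<in> S 1" "2 \<notin> S 2" "4 \<in> S 1" "4 \<in> S 2" "4 \<notin> S 3" by (simp_all add: S_def)
  then have "S 1 \<noteq> S 2" "S 1 \<noteq> S 3" "S 2 \<noteq> S 3" by metis+
  then have inj: "inj_on S {1, 2, 3}" by (auto simp: inj_on_def)
  have S: "S i \<subseteq> {1, 2, 3, 4}" "card (S i) = 3" for i by (auto simp: S_def)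
  have pt: "paint ` face ` Fl \<subseteq> {1, 2, 3, 4}"
    using paintS S(1) unfolding un[symmetric] by blast
  have proper: "\<forall>f g. adj f g \<longrightarrow> paint f \<noteq> paint g"
    unfolding adj_def using paint_proper by metis
  show ?thesis
    by (intro exI[of _ paint] exI[of _ zones] exI[of _ S] conjI ballI pt proper ne sub zones_connected
        disj un inj S paintS)
qed

end

section \<open>Zones of the lattice\<close>

theorem theorem6:
  fixes V :: "complex set" and E F :: "complex set set" and f\<^sub>0 :: "complex set"
  assumes "hexagonal_lattice_around_odd_face V E F f\<^sub>0"
  shows "\<exists>(c :: complex set \<Rightarrow> nat) (Z :: nat \<Rightarrow> complex set set) (S :: nat \<Rightarrow> nat set).
           proper_face_coloring E F {1, 2, 3, 4} c \<and>
           (\<forall>i\<in>{1, 2, 3}. zone E F (Z i)) \<and>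
           disjoint_family_on Z {1, 2, 3} \<and> (\<Union>i\<in>{1, 2, 3}. Z i) = F \<and>
           inj_on S {1, 2, 3} \<and>
           (\<forall>i\<in>{1, 2, 3}. S i \<subseteq> {1, 2, 3, 4} \<and> card (S i) = 3 \<and> (\<forall>f\<in>Z i. c f \<in> S i))"
proof -
  interpret developing V E F f\<^sub>0 "(`) hex0" "(`) hex1" "(`) hex2" "orbit (0, 0, 1, 0, True)"
  proof
    show "hexagonal_lattice_around_odd_face V E F f\<^sub>0" by (rule assms)
    have "orbit (hex1 (0, 0, 1, 0, True)) = orbit (turn (hex0 (0, 0, 1, 0, True)))" by simp
    then show "hex1 ` orbit (0, 0, 1, 0, True) = hex0 ` orbit (0, 0, 1, 0, True)"
      unfolding orbit_turn by (simp only: orbit_image[of hex0, OF hex_turn(1)] orbit_image[of hex1, OF hex_turn(2)])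
  qed (simp_all only: walk_image image_image hex_involution hex_commute hex_braid hex_hexagon image_ident)
  obtain \<Sigma> where \<Sigma>: "\<And>x. x \<in> Flags \<Longrightarrow> \<Sigma> (s0 x) = hex0 ` \<Sigma> x" "\<And>x. x \<in> Flags \<Longrightarrow> \<Sigma> (s1 x) = hex1 ` \<Sigma> x"
    "\<And>x. x \<in> Flags \<Longrightarrow> \<Sigma> (s2 x) = hex2 ` \<Sigma> x" "\<Sigma> (B0 0) = orbit (0, 0, 1, 0, True)"
    by (rule development, rule that)
  have Req: "(\<lambda>z. s0 (s1 z)) = R" by (rule ext) (simp add: R_def)
  have B: "B0 0 \<in> Flags" "face (B0 0) = f\<^sub>0" using cycle0(2) by (simp_all add: B0_def face_def)
  have poly: "\<exists>k\<ge>3. is_polygon V E k (face x)" if "x \<in> Flags" for x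
  proof -
    have "face x \<in> F" using that face_image by blast
    then obtain k where "3 \<le> k" "is_polygon V E k (face x)" by (rule face_polygon)
    then show ?thesis by blast
  qed
  interpret cone: cone_flags Flags s0 s1 s2 face "f\<^sub>0" n0 "B0 0" \<Sigma>
  proof (unfold_locales, unfold Req)
    show "\<exists>k. y = (R ^^ k) x \<or> y = s0 ((R ^^ k) x)" if "x \<in> Flags" "y \<in> Flags" "face x = face y" for x y
      using poly[OF that(1)] face_rotation(3)[OF that(1)] that by metis
    show "(R ^^ 6) x = x" if "x \<in> Flags" "face x \<noteq> f\<^sub>0" for x
      using face_rotation(1)[OF that(1) hexagons] that face_image by fastforce
    show "(R ^^ n0) (B0 0) = B0 0" "\<And>j. \<lbrakk>0 < j; j < n0\<rbrakk> \<Longrightarrow> (R ^^ j) (B0 0) \<noteq> B0 0"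
      using face_rotation(1,2)[OF B(1), of n0] chart0(2,3) B(2) by simp_all
    show "P x" if "P (B0 0)" "\<And>x. \<lbrakk>x \<in> Flags; P x\<rbrakk> \<Longrightarrow> P (s0 x) \<and> P (s1 x) \<and> P (s2 x)" "x \<in> Flags" for P x
      using flags_connected[of P "B0 0" x] that B(1) by blast
  qed (use s_inv s_comm s_braid s_closed face_inv face_s2 B chart0 \<Sigma> in simp_all)
  obtain c Z S where cZS: "c ` face ` Flags \<subseteq> {1, 2, 3, 4}" "\<forall>f g. cone.adj f g \<longrightarrow> c f \<noteq> c g"
    "\<forall>i\<in>{1, 2, 3}. Z i \<noteq> {} \<and> Z i \<subseteq> face ` Flags \<and>
       (\<forall>f\<in>Z i. \<forall>g\<in>Z i. (\<lambda>a b. a \<in> Z i \<and> b \<in> Z i \<and> cone.adj a b)\<^sup>*\<^sup>* f g)"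
    "disjoint_family_on Z {1, 2, 3::nat}" "(\<Union>i\<in>{1, 2, 3}. Z i) = face ` Flags" "inj_on S {1, 2, 3::nat}"
    "\<forall>i\<in>{1, 2, 3}. S i \<subseteq> {1, 2, 3, 4::nat} \<and> card (S i) = 3 \<and> (\<forall>f\<in>Z i. c f \<in> S i)"
    using cone.cone_colouring by (elim exE conjE) (rule that)
  note cZS = cZS[unfolded face_image]
  have adj: "cone.adj f g \<longleftrightarrow> adjacent E f g" if "f \<in> F" "g \<in> F" for f g
    unfolding cone.adj_def adjacent_iff[OF that] ..
  have "proper_face_coloring E F {1, 2, 3, 4} c"
    unfolding proper_face_coloring_def using cZS(1,2) adj by blast
  moreover have "zone E F (Z i)" if "i \<in> {1, 2, 3}" for i
  proof -
    have Z: "Z i \<noteq> {}" "Z i \<subseteq> F"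
      "\<forall>f\<in>Z i. \<forall>g\<in>Z i. (\<lambda>a b. a \<in> Z i \<and> b \<in> Z i \<and> cone.adj a b)\<^sup>*\<^sup>* f g"
      using bspec[OF cZS(3) that] by blast+
    have "(\<lambda>a b. a \<in> Z i \<and> b \<in> Z i \<and> cone.adj a b) = (\<lambda>a b. a \<in> Z i \<and> b \<in> Z i \<and> adjacent E a b)"
      using adj Z(2) by (intro ext) blast
    then show ?thesis unfolding zone_def using Z by simp
  qed
  ultimately show ?thesis using cZS(4-7)
    by (intro exI[of _ c] exI[of _ Z] exI[of _ S] conjI ballI) auto
qed

end
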